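(* Let $D_{v_k}$ be the degree of the $k$-th backbone vertex of the invasion percolation cluster on the branching process tree with offspring variable $X$, where $\mathbb P(X=0)=0$ and $\mathbb P(X>x)=c_Xx^{-\alpha}(1+o(1))$ as $x\to\infty$, let $(W_k)_{k\ge0}$ be the future maximum weight process, and let $\hat\theta(p)=p\,\theta(p)$. Let $D^\star_{v_k}$ be a random variable which, conditionally on $W_k$, has the size-biased version of the conditional law of $D_{v_k}$ given $W_k$. As $k\to\infty$: (1) if $\alpha>2$, then $D_{v_k}\xrightarrow{d}X^\star$ and $D_{v_k}^\star\xrightarrow{d}X^{\star\star}$, where $\mathbb E[X^\star]<\infty$; (2) if $\alpha\in(1,2)$, then $D_{v_k}\xrightarrow{d}X^\star$ and $\hat\theta(W_k)D^\star_{v_k}\xrightarrow{d}\mathtt{Gamma}(2-\alpha,1)$, where $\mathbb E[X^\star]=\infty$; (3) if $\alpha\in(0,1)$, then $\hat\theta(W_k)D_{v_k}\xrightarrow{d}\mathtt{Gamma}(1-\alpha,1)$.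
   Context: $X$ takes values in $\{1,2,\dots\}$; $\alpha>0$ and $c_X>0$ are as in the tail assumption. $\mathcal T$ is the branching process tree with i.i.d. offspring distributed as $X$ and root $\varnothing$; its edges carry i.i.d. Uniform$[0,1]$ weights, independent of the tree. $\theta(p)$ is the probability that the connected component of the root is infinite when all edges of weight larger than $p$ are removed. Invasion percolation: $T^{(0)}=\{\varnothing\}$ and $T^{(n+1)}$ is obtained from $T^{(n)}$ by adding the edge (and its end vertex) of smallest weight among all edges of $\mathcal T$ incident to $T^{(n)}$ and not yet in it. The invasion percolation cluster is $T(\varnothing)=\lim_{n\to\infty}T^{(n)}$. Almost surely it contains a unique infinite self-avoiding path from the root, the backbone $\varnothing=v_0,v_1,v_2,\dots$. Let $\beta_i$ be the weight of the edge $\{v_{i-1},v_i\}$ and $W_k=\max_{i>k}\beta_i$. $D_{v_k}$ is the number of children of $v_k$ in $\mathcal T$. For a non-negative integer-valued variable $Y$ with $0<\mathbb E[Y]<\infty$, the size-biased version $Y^\star$ has $\mathbb P(Y^\star=y)=y\,\mathbb P(Y=y)/\mathbb E[Y]$; if $\mathbb E[Y^2]<\infty$, the doubly size-biased version $Y^{\star\star}$ has $\mathbb P(Y^{\star\star}=y)=y^2\,\mathbb P(Y=y)/\mathbb E[Y^2]$. $\mathtt{Gamma}(r,\lambda)$ has shape $r$ and rate $\lambda$. *)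

theory Defs
  imports "HOL-Probability.Probability"
begin

section \<open>Size-biased laws, Gamma laws, conditional laws\<close>

text \<open>Both size-biased laws are only meaningful when the normalising moment is finite and positive
  (see the two lemmas); otherwise the argument of \<open>embed_pmf\<close> does not sum to 1.\<close>

definition size_biased :: "nat pmf \<Rightarrow> nat pmf" where
  "size_biased Y =
     embed_pmf (\<lambda>y. real y * pmf Y y / measure_pmf.expectation Y real)"

definition doubly_size_biased :: "nat pmf \<Rightarrow> nat pmf" where
  "doubly_size_biased Y =
     embed_pmf (\<lambda>y. (real y)\<^sup>2 * pmf Y y / measure_pmf.expectation Y (\<lambda>x. (real x)\<^sup>2))"

lemma pmf_embed_weighted:
  fixes g :: "nat \<Rightarrow> real"
  assumes g: "\<And>y. 0 \<le> g y" and int: "integrable (measure_pmf Y) g"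
    and pos: "0 < measure_pmf.expectation Y g"
  shows "pmf (embed_pmf (\<lambda>y. g y * pmf Y y / measure_pmf.expectation Y g)) x
           = g x * pmf Y x / measure_pmf.expectation Y g"
proof (rule pmf_embed_pmf)
  let ?E = "measure_pmf.expectation Y g"
  show "0 \<le> g y * pmf Y y / ?E" for y
    using g pos by (simp add: less_imp_le)
  have "(\<integral>\<^sup>+ y. ennreal (g y * pmf Y y / ?E) \<partial>count_space UNIV)
      = (\<integral>\<^sup>+ y. ennreal (pmf Y y) * ennreal (g y / ?E) \<partial>count_space UNIV)"
    using g pos by (intro nn_integral_cong)
      (simp add: ennreal_mult'[symmetric] mult.commute)
  also have "\<dots> = (\<integral>\<^sup>+ y. ennreal (g y / ?E) \<partial>measure_pmf Y)"
    by (simp add: nn_integral_measure_pmf)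
  also have "\<dots> = ennreal (measure_pmf.expectation Y (\<lambda>y. g y / ?E))"
    using g pos int by (intro nn_integral_eq_integral) (auto simp: less_imp_le)
  also have "\<dots> = 1"
    using pos by simp
  finally show "(\<integral>\<^sup>+ y. ennreal (g y * pmf Y y / ?E) \<partial>count_space UNIV) = 1" .
qed

lemma pmf_size_biased:
  assumes "integrable (measure_pmf Y) real" "0 < measure_pmf.expectation Y real"
  shows "pmf (size_biased Y) y = real y * pmf Y y / measure_pmf.expectation Y real"
  unfolding size_biased_def using assms by (intro pmf_embed_weighted) auto

lemma pmf_doubly_size_biased:
  assumes "integrable (measure_pmf Y) (\<lambda>x. (real x)\<^sup>2)"
    "0 < measure_pmf.expectation Y (\<lambda>x. (real x)\<^sup>2)"
  shows "pmf (doubly_size_biased Y) y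
           = (real y)\<^sup>2 * pmf Y y / measure_pmf.expectation Y (\<lambda>x. (real x)\<^sup>2)"
  unfolding doubly_size_biased_def using assms by (intro pmf_embed_weighted) auto

definition gamma_density :: "real \<Rightarrow> real \<Rightarrow> real \<Rightarrow> real" where
  "gamma_density r l x =
     (if x \<le> 0 then 0 else l powr r * x powr (r - 1) * exp (- l * x) / Gamma r)"

definition gamma_law :: "real \<Rightarrow> real \<Rightarrow> real measure" where
  "gamma_law r l = density lborel (\<lambda>x. ennreal (gamma_density r l x))"

text \<open>\<open>cond_law M D W \<kappa>\<close>: the kernel \<open>\<kappa>\<close> is a regular version of the conditional law of the
  integer-valued variable \<open>D\<close> given the real-valued variable \<open>W\<close>; the \<open>\<sigma>\<close>-algebra generated by
  \<open>W\<close> is \<open>vimage_algebra (space M) W borel\<close>.\<close>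

definition cond_law ::
    "'a measure \<Rightarrow> ('a \<Rightarrow> nat) \<Rightarrow> ('a \<Rightarrow> real) \<Rightarrow> (real \<Rightarrow> nat pmf) \<Rightarrow> bool" where
  "cond_law M D W \<kappa> \<longleftrightarrow>
     D \<in> M \<rightarrow>\<^sub>M count_space UNIV \<and>
     W \<in> M \<rightarrow>\<^sub>M borel \<and>
     (\<lambda>w. measure_pmf (\<kappa> w)) \<in> borel \<rightarrow>\<^sub>M prob_algebra (count_space UNIV) \<and>
     (\<forall>y. AE \<omega> in M.
        real_cond_exp M (vimage_algebra (space M) W borel) (indicat_real {\<omega>'. D \<omega>' = y}) \<omega>
          = pmf (\<kappa> (W \<omega>)) y)"

text \<open>Conditionally on \<open>W\<close>, the variable \<open>Ds\<close> has the size-biased version of the conditional law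
  of \<open>D\<close> given \<open>W\<close>.\<close>

definition cond_size_biased ::
    "'a measure \<Rightarrow> ('a \<Rightarrow> nat) \<Rightarrow> ('a \<Rightarrow> real) \<Rightarrow> ('a \<Rightarrow> nat) \<Rightarrow> bool" where
  "cond_size_biased M D W Ds \<longleftrightarrow>
     (\<exists>\<kappa>. cond_law M D W \<kappa> \<and> cond_law M Ds W (\<lambda>w. size_biased (\<kappa> w)))"


section \<open>Weighted branching process tree\<close>

text \<open>Ulam--Harris labelling: the root is \<open>[]\<close> and the children of \<open>v\<close> are \<open>v @ [i]\<close> for
  \<open>i < d v\<close>. An edge is the pair (parent, child), and its weight is stored at the child:
  the edge \<open>e\<close> has weight \<open>u (snd e)\<close>. In particular \<open>u []\<close> is never the weight of an edge.\<close>

type_synonym vertex = "nat list"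
type_synonym edge = "vertex \<times> vertex"

inductive_set bp_tree :: "(vertex \<Rightarrow> nat) \<Rightarrow> vertex set" for d :: "vertex \<Rightarrow> nat" where
  root: "[] \<in> bp_tree d"
| child: "v \<in> bp_tree d \<Longrightarrow> i < d v \<Longrightarrow> v @ [i] \<in> bp_tree d"

definition tree_edges :: "(vertex \<Rightarrow> nat) \<Rightarrow> edge set" where
  "tree_edges d = {(v, v @ [i]) | v i. v \<in> bp_tree d \<and> i < d v}"

definition open_edges :: "(vertex \<Rightarrow> nat) \<Rightarrow> (vertex \<Rightarrow> real) \<Rightarrow> real \<Rightarrow> edge set" where
  "open_edges d u p = {e \<in> tree_edges d. u (snd e) \<le> p}"

definition root_component :: "(vertex \<Rightarrow> nat) \<Rightarrow> (vertex \<Rightarrow> real) \<Rightarrow> real \<Rightarrow> vertex set" where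
  "root_component d u p = {v. ([], v) \<in> (open_edges d u p \<union> (open_edges d u p)\<inverse>)\<^sup>*}"


section \<open>Invasion percolation and its backbone\<close>

text \<open>A subtree is represented by its vertex set \<open>S\<close>; the tree edges contained in it are those with
  both endpoints in \<open>S\<close>. Hence the edges incident to it but not in it have exactly one endpoint
  in \<open>S\<close>.\<close>

definition boundary_edges :: "(vertex \<Rightarrow> nat) \<Rightarrow> vertex set \<Rightarrow> edge set" where
  "boundary_edges d S = {e \<in> tree_edges d. (fst e \<in> S) \<noteq> (snd e \<in> S)}"

text \<open>The case of an empty boundary (a finite tree that is fully invaded) and the choice made by
  \<open>arg_min_on\<close> among ties only matter on null events when \<open>X \<ge> 1\<close>.\<close>

definition invade :: "(vertex \<Rightarrow> nat) \<Rightarrow> (vertex \<Rightarrow> real) \<Rightarrow> vertex set \<Rightarrow> vertex set" where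
  "invade d u S =
     (if boundary_edges d S = {} then S
      else let e = arg_min_on (\<lambda>e. u (snd e)) (boundary_edges d S) in S \<union> {fst e, snd e})"

definition invasion :: "(vertex \<Rightarrow> nat) \<Rightarrow> (vertex \<Rightarrow> real) \<Rightarrow> nat \<Rightarrow> vertex set" where
  "invasion d u n = (invade d u ^^ n) {[]}"

definition invasion_cluster :: "(vertex \<Rightarrow> nat) \<Rightarrow> (vertex \<Rightarrow> real) \<Rightarrow> vertex set" where
  "invasion_cluster d u = (\<Union>n. invasion d u n)"

definition is_backbone ::
    "(vertex \<Rightarrow> nat) \<Rightarrow> (vertex \<Rightarrow> real) \<Rightarrow> (nat \<Rightarrow> vertex) \<Rightarrow> bool" where
  "is_backbone d u v \<longleftrightarrow>
     v 0 = [] \<and> inj v \<and> range v \<subseteq> invasion_cluster d u \<and>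
     (\<forall>i. (v i, v (Suc i)) \<in> tree_edges d \<union> (tree_edges d)\<inverse>)"

text \<open>The backbone exists and is unique almost surely. The fallback (the leftmost path) is used on
  a null event only; it is a fixed path whose vertices other than the root differ from \<open>[]\<close>, so
  that the variables below are measurable although nothing is assumed about \<open>u []\<close>.\<close>

definition backbone :: "(vertex \<Rightarrow> nat) \<Rightarrow> (vertex \<Rightarrow> real) \<Rightarrow> nat \<Rightarrow> vertex" where
  "backbone d u =
     (if \<exists>!v. is_backbone d u v then THE v. is_backbone d u v else (\<lambda>k. replicate k 0))"

text \<open>A self-avoiding path from the root moves from parent to child in each step, so its
  \<open>i\<close>-th edge has its \<open>i\<close>-th vertex as child endpoint.\<close>

definition backbone_weight :: "(vertex \<Rightarrow> nat) \<Rightarrow> (vertex \<Rightarrow> real) \<Rightarrow> nat \<Rightarrow> real" where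
  "backbone_weight d u i = u (backbone d u i)"


section \<open>The random quantities\<close>

definition backbone_degree ::
    "(vertex \<Rightarrow> 'a \<Rightarrow> nat) \<Rightarrow> (vertex \<Rightarrow> 'a \<Rightarrow> real) \<Rightarrow> nat \<Rightarrow> 'a \<Rightarrow> nat" where
  "backbone_degree N U k \<omega> = N (backbone (\<lambda>v. N v \<omega>) (\<lambda>v. U v \<omega>) k) \<omega>"

definition future_max ::
    "(vertex \<Rightarrow> 'a \<Rightarrow> nat) \<Rightarrow> (vertex \<Rightarrow> 'a \<Rightarrow> real) \<Rightarrow> nat \<Rightarrow> 'a \<Rightarrow> real" where
  "future_max N U k \<omega> = (SUP i\<in>{k<..}. backbone_weight (\<lambda>v. N v \<omega>) (\<lambda>v. U v \<omega>) i)"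

definition theta ::
    "'a measure \<Rightarrow> (vertex \<Rightarrow> 'a \<Rightarrow> nat) \<Rightarrow> (vertex \<Rightarrow> 'a \<Rightarrow> real) \<Rightarrow> real \<Rightarrow> real" where
  "theta M N U p =
     measure M {\<omega> \<in> space M. infinite (root_component (\<lambda>v. N v \<omega>) (\<lambda>v. U v \<omega>) p)}"

definition theta_hat ::
    "'a measure \<Rightarrow> (vertex \<Rightarrow> 'a \<Rightarrow> nat) \<Rightarrow> (vertex \<Rightarrow> 'a \<Rightarrow> real) \<Rightarrow> real \<Rightarrow> real" where
  "theta_hat M N U p = p * theta M N U p"

text \<open>The offspring numbers \<open>N v\<close> are i.i.d. with law \<open>X\<close>, the edge weights \<open>U v\<close>
  (\<open>v \<noteq> []\<close>) are i.i.d. uniform on \<open>[0,1]\<close>, and the two families are independent: the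
  disjoint union of both families is independent.\<close>

definition weighted_bp_tree ::
    "'a measure \<Rightarrow> nat pmf \<Rightarrow> (vertex \<Rightarrow> 'a \<Rightarrow> nat) \<Rightarrow> (vertex \<Rightarrow> 'a \<Rightarrow> real) \<Rightarrow> bool" where
  "weighted_bp_tree M X N U \<longleftrightarrow>
     prob_space M \<and>
     prob_space.indep_vars M (\<lambda>_. borel)
       (case_sum (\<lambda>v \<omega>. real (N v \<omega>)) U) (UNIV <+> {v. v \<noteq> []}) \<and>
     (\<forall>v. distr M (count_space UNIV) (N v) = measure_pmf X) \<and>
     (\<forall>v. v \<noteq> [] \<longrightarrow> distr M borel (U v) = uniform_measure lborel {0..1})"

definition conv_in_law :: "'a measure \<Rightarrow> (nat \<Rightarrow> 'a \<Rightarrow> real) \<Rightarrow> real measure \<Rightarrow> bool" where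
  "conv_in_law M Z \<mu> \<longleftrightarrow> weak_conv_m (\<lambda>k. distr M borel (Z k)) \<mu>"

definition real_law :: "nat pmf \<Rightarrow> real measure" where
  "real_law Y = distr (measure_pmf Y) borel real"

end

theory Submission
  imports Defs "HOL-Library.Sublist" "HOL-Real_Asymp.Real_Asymp"
begin

text \<open>Let \<open>W v\<close> (\<open>level\<close>) be the smallest \<open>p\<close> at which \<open>v\<close> lies on an infinite
  \<open>p\<close>-open path going away from the root, and for \<open>v \<noteq> []\<close> let \<open>R v\<close> (\<open>elevel\<close>) be the maximum of
  \<open>W v\<close> and the weight of the edge above \<open>v\<close>. Then \<open>W v\<close> is the minimum of \<open>R\<close> over the children
  of \<open>v\<close>, the backbone always moves to the child minimising \<open>R\<close>, and the future maximum after step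
  \<open>k\<close> is \<open>W v\<^sub>k\<close>. Since \<open>R\<close> has distribution function \<open>p * \<theta> p\<close>, which is continuous, \<open>p * \<theta> p\<close>
  evaluated at \<open>R\<close> is uniform, so given \<open>q = p * \<theta> p\<close> at \<open>p = W v\<close> the degree \<open>n\<close> of \<open>v\<close> has
  weight proportional to \<open>n * (1 - q) ^ (n - 1) * P(X = n)\<close>. The event that \<open>v\<close> is the \<open>k\<close>-th
  backbone vertex depends on the subtree of \<open>v\<close> through \<open>W v\<close> only, so the same holds for the degree of
  \<open>v\<^sub>k\<close>, and size-biasing multiplies the weight by \<open>n\<close>. Finally \<open>q\<close> tends to 0 in probability
  along the backbone, and the limits of the tilted laws as \<open>q\<close> tends to 0 follow by dominated
  convergence from \<open>q powr (- \<alpha>) * P(q * X > s) \<longlonglongrightarrow> c * s powr (- \<alpha>)\<close>.\<close>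

subsection \<open>Levels\<close>

text \<open>The critical weight is never isolated. Everything is parametrised by q instead of p:
  with \<open>slope q = survive q / q\<close>, strictly decreasing on (0,1] because X >= 2 has
  positive probability, \<open>p = 1 / slope q\<close> inverts \<open>survival_hat\<close>. This one
  monotonicity yields the absence of atoms of R, the recovery of \<open>W v\<close> from q, and the
  Lipschitz bound. The obstacle is that membership in the backbone is an event about the whole tree.
  It is written as a condition on the coordinates outside the subtree of v together with one real
  number; the outside is frozen by Fubini, and a statement about a single subtree remains. That q
  tends to 0 comes without a rate: for x_k = P(future maximum after step k exceeds p), the bound x_k
  <= C * (x_k - x_(k+1)) already forces x_k to tend to 0. The degree and its size-biased version are
  the cases j = 1 and j = 2 of one tilted family, so each type of limit is proved once, for general
  j.\<close>

primrec minmax :: "(vertex \<Rightarrow> nat) \<Rightarrow> (vertex \<Rightarrow> real) \<Rightarrow> nat \<Rightarrow> vertex \<Rightarrow> real" where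
  "minmax d u 0 v = 0"
| "minmax d u (Suc n) v =
     Min (insert 1 ((\<lambda>i. max (u (v @ [i])) (minmax d u n (v @ [i]))) ` {..<d v}))"

definition level :: "(vertex \<Rightarrow> nat) \<Rightarrow> (vertex \<Rightarrow> real) \<Rightarrow> vertex \<Rightarrow> real" where
  "level d u v = (SUP n. minmax d u n v)"

definition elevel :: "(vertex \<Rightarrow> nat) \<Rightarrow> (vertex \<Rightarrow> real) \<Rightarrow> vertex \<Rightarrow> real" where
  "elevel d u v = max (u v) (level d u v)"

text \<open>The disjunct \<open>1 \<le> p\<close> comes from the inserted 1, which keeps the set
  under \<open>Min\<close> nonempty at a childless vertex. Together with the base value 0 it
  confines \<open>minmax\<close> to [0,1] for every configuration, so bounds on levels need no
  almost sure hypotheses.\<close>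

lemma minmax_Suc_le_iff:
  "minmax d u (Suc n) v \<le> p \<longleftrightarrow>
     1 \<le> p \<or> (\<exists>i<d v. u (v @ [i]) \<le> p \<and> minmax d u n (v @ [i]) \<le> p)"
  by (auto simp: Min_le_iff)

lemma minmax_le_1: "minmax d u n v \<le> 1"
  by (cases n) (auto simp: minmax_Suc_le_iff simp del: minmax.simps(2))

lemma minmax_nonneg: "0 \<le> minmax d u n v"
proof (induction n arbitrary: v)
  case (Suc n)
  then show ?case
    by (auto simp: Min_ge_iff le_max_iff_disj)
qed simp

lemma minmax_Suc_mono: "minmax d u n v \<le> minmax d u (Suc n) v"
proof (induction n arbitrary: v)
  case 0
  then show ?case using minmax_nonneg[of d u "Suc 0" v] by (metis minmax.simps(1))
next
  case (Suc n)
  have "minmax d u (Suc n) v \<le> p" if "minmax d u (Suc (Suc n)) v \<le> p" for p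
    using that unfolding minmax_Suc_le_iff[of d u _ v] by (meson Suc order_trans)
  then show ?case by blast
qed

lemma minmax_mono: "m \<le> n \<Longrightarrow> minmax d u m v \<le> minmax d u n v"
  by (rule lift_Suc_mono_le[of "\<lambda>n. minmax d u n v"]) (rule minmax_Suc_mono)

lemma level_le_iff: "level d u v \<le> p \<longleftrightarrow> (\<forall>n. minmax d u n v \<le> p)"
  unfolding level_def
  by (subst cSUP_le_iff) (auto intro!: bdd_aboveI[of _ 1] minmax_le_1)

lemma level_bounds: "0 \<le> level d u v" "level d u v \<le> 1"
proof -
  show "level d u v \<le> 1" by (simp add: level_le_iff minmax_le_1)
  have "minmax d u 0 v \<le> level d u v" using level_le_iff by blast
  then show "0 \<le> level d u v" by simp
qed

text \<open>Finite branching lets the supremum over depths pass through the minimum over children: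
  if every child fails at some depth, all of them fail at one common depth, since
  \<open>minmax\<close> grows with the depth.\<close>

lemma level_rec:
  "level d u v \<le> p \<longleftrightarrow> 1 \<le> p \<or> (\<exists>i<d v. elevel d u (v @ [i]) \<le> p)"
proof
  assume L: "level d u v \<le> p"
  show "1 \<le> p \<or> (\<exists>i<d v. elevel d u (v @ [i]) \<le> p)"
  proof (rule disjCI)
    assume N: "\<not> (\<exists>i<d v. elevel d u (v @ [i]) \<le> p)"
    have "\<forall>i\<in>{..<d v}. u (v @ [i]) \<le> p \<longrightarrow> (\<exists>n. \<not> minmax d u n (v @ [i]) \<le> p)"
      using N by (auto simp: elevel_def level_le_iff)
    then obtain n where n: "\<And>i. i < d v \<Longrightarrow> u (v @ [i]) \<le> p \<Longrightarrow> \<not> minmax d u (n i) (v @ [i]) \<le> p"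
      by (metis lessThan_iff)
    \<comment> \<open>The sum is just a convenient common upper bound of the finitely many depths
      \<open>n i\<close>.\<close>
    define m where "m = (\<Sum>i<d v. n i)"
    have "n i \<le> m" if "i < d v" for i
      unfolding m_def by (rule member_le_sum) (use that in auto)
    then have "\<not> (\<exists>i<d v. u (v @ [i]) \<le> p \<and> minmax d u m (v @ [i]) \<le> p)"
      by (meson n minmax_mono order_trans)
    moreover have "minmax d u (Suc m) v \<le> p" using L level_le_iff by blast
    ultimately show "1 \<le> p" unfolding minmax_Suc_le_iff by blast
  qed
next
  assume R: "1 \<le> p \<or> (\<exists>i<d v. elevel d u (v @ [i]) \<le> p)"
  show "level d u v \<le> p"
  proof (cases "1 \<le> p")
    case True
    then show ?thesis using level_bounds(2) order_trans by blast
  next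
    case False
    then obtain i where i: "i < d v" "u (v @ [i]) \<le> p" "level d u (v @ [i]) \<le> p"
      using R by (auto simp: elevel_def)
    then have "0 \<le> p" using level_bounds(1) order_trans by blast
    have "minmax d u n v \<le> p" for n
    proof (cases n)
      case (Suc m)
      show ?thesis unfolding Suc minmax_Suc_le_iff using i by (auto simp: level_le_iff)
    qed (simp add: \<open>0 \<le> p\<close>)
    then show ?thesis by (simp add: level_le_iff)
  qed
qed

text \<open>Locality. The weight at \<open>v\<close> itself is not read; this is what later makes
  the level of a vertex independent of the weight of the edge above it.\<close>

lemma minmax_cong:
  assumes "\<And>x. d (v @ x) = d' (v @ x)" "\<And>x. x \<noteq> [] \<Longrightarrow> u (v @ x) = u' (v @ x)"
  shows "minmax d u n v = minmax d' u' n v"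
  using assms
proof (induction n arbitrary: v)
  case (Suc n)
  have "minmax d u n (v @ [i]) = minmax d' u' n (v @ [i])" for i
    by (rule Suc.IH) (use Suc.prems in auto)
  moreover have "d v = d' v" using Suc.prems(1)[of "[]"] by simp
  ultimately show ?case using Suc.prems(2) by simp
qed simp

lemma level_cong:
  assumes "\<And>x. d (v @ x) = d' (v @ x)" "\<And>x. x \<noteq> [] \<Longrightarrow> u (v @ x) = u' (v @ x)"
  shows "level d u v = level d' u' v"
  unfolding level_def using minmax_cong[of d v d' u u', OF assms] by simp

lemma elevel_cong:
  assumes "\<And>x. d (v @ x) = d' (v @ x)" "\<And>x. u (v @ x) = u' (v @ x)"
  shows "elevel d u v = elevel d' u' v"
  unfolding elevel_def using level_cong[of d v d' u u'] assms(1) assms(2) assms(2)[of "[]"] by simp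

subsection \<open>Infinite subtrees\<close>

lemma bp_tree_snoc_iff: "v @ [i] \<in> bp_tree d \<longleftrightarrow> v \<in> bp_tree d \<and> i < d v"
  by (auto intro: bp_tree.child elim: bp_tree.cases)

lemma bp_tree_prefix: "x @ y \<in> bp_tree d \<Longrightarrow> x \<in> bp_tree d"
  by (induction y rule: rev_induct) (auto simp: bp_tree_snoc_iff simp flip: append_assoc)

lemma bp_tree_root [simp]: "[] \<in> bp_tree d" by (rule bp_tree.root)

definition descendants :: "vertex set \<Rightarrow> vertex \<Rightarrow> vertex set" where
  "descendants S v = {x \<in> S. prefix v x}"

lemma infinite_descendants_child:
  assumes "S \<subseteq> bp_tree d" "infinite (descendants S v)"
  shows "\<exists>i<d v. infinite (descendants S (v @ [i]))"
proof (rule ccontr)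
  assume "\<not> ?thesis"
  then have "finite (insert v (\<Union>i<d v. descendants S (v @ [i])))" by auto
  moreover have "descendants S v \<subseteq> insert v (\<Union>i<d v. descendants S (v @ [i]))"
  proof
    fix x assume x: "x \<in> descendants S v"
    then obtain y where y: "x = v @ y" by (auto simp: descendants_def prefix_def)
    show "x \<in> insert v (\<Union>i<d v. descendants S (v @ [i]))"
    proof (cases y)
      case (Cons i z)
      then have "(v @ [i]) @ z \<in> bp_tree d" using x y assms(1) by (auto simp: descendants_def)
      then have "i < d v" using bp_tree_prefix bp_tree_snoc_iff by blast
      then show ?thesis using x y Cons by (auto simp: descendants_def)
    qed (use y in simp)
  qed
  ultimately show False using assms(2) finite_subset by blast
qed

definition prefix_closed :: "vertex set \<Rightarrow> bool" where
  "prefix_closed S \<longleftrightarrow> (\<forall>x y. x @ y \<in> S \<longrightarrow> x \<in> S)"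

text \<open>The path is required to pass through \<open>v\<close> at time \<open>length v\<close>:
  below that time it runs through the prefixes of \<open>v\<close>, afterwards it follows children
  with infinitely many descendants. With \<open>v = []\<close> this gives a backbone; for general
  \<open>v\<close> it detects the vertices that lie on one.\<close>

lemma koenig:
  assumes "S \<subseteq> bp_tree d" "prefix_closed S" "infinite (descendants S v)"
  shows "\<exists>b. b 0 = [] \<and> b (length v) = v \<and> (\<forall>k. b k \<in> S) \<and> (\<forall>k. \<exists>i. b (Suc k) = b k @ [i])"
proof -
  have "\<exists>f. \<forall>n. (infinite (descendants S (f n)) \<and> (n = 0 \<longrightarrow> f n = v)) \<and> (\<exists>i. f (Suc n) = f n @ [i])"
  proof (rule dependent_nat_choice)
    fix x and n :: nat
    assume "infinite (descendants S x) \<and> (n = 0 \<longrightarrow> x = v)"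
    then show "\<exists>y. (infinite (descendants S y) \<and> (Suc n = 0 \<longrightarrow> y = v)) \<and> (\<exists>i. y = x @ [i])"
      using infinite_descendants_child[OF assms(1)] by blast
  qed (use assms(3) in blast)
  then obtain f where f: "\<And>n. infinite (descendants S (f n))" "f 0 = v" "\<And>n. \<exists>i. f (Suc n) = f n @ [i]"
    by blast
  have fS: "f n \<in> S" for n
  proof -
    obtain x where "x \<in> descendants S (f n)" using f(1) by (metis finite.emptyI ex_in_conv)
    then show ?thesis using assms(2) by (auto simp: descendants_def prefix_def prefix_closed_def)
  qed
  define b where "b k = (if k \<le> length v then take k v else f (k - length v))" for k
  have "b k \<in> S" for k
  proof (cases "k \<le> length v")
    case True
    have "take k v @ drop k v \<in> S" using fS[of 0] f(2) by simp
    then show ?thesis using assms(2) True unfolding prefix_closed_def b_def by metis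
  qed (simp add: b_def fS)
  moreover have "\<exists>i. b (Suc k) = b k @ [i]" for k
  proof (cases "k < length v")
    case True
    then show ?thesis by (auto simp: b_def take_Suc_conv_app_nth)
  next
    case False
    then have "b (Suc k) = f (Suc (k - length v))" "b k = f (k - length v)"
      using f(2) by (auto simp: b_def Suc_diff_le)
    then show ?thesis using f(3) by simp
  qed
  moreover have "b 0 = []" "b (length v) = v" by (auto simp: b_def)
  ultimately show ?thesis by blast
qed

lemma path_length:
  assumes "b 0 = []" "\<forall>k. \<exists>i. b (Suc k) = b k @ [i]"
  shows "length (b k) = k"
proof (induction k)
  case (Suc k)
  then show ?case using assms(2) by (metis length_append_singleton)
qed (simp add: assms)

lemma path_prefix:
  assumes "\<forall>k. \<exists>i. b (Suc k) = b k @ [i]" "j \<le> k"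
  shows "prefix (b j) (b k)"
  using assms(2)
proof (induction k rule: dec_induct)
  case (step n)
  obtain i where "b (Suc n) = b n @ [i]" using assms(1) by blast
  then show ?case using step.IH by (simp add: prefix_snoc)
qed simp

lemma path_infinite_descendants:
  assumes "b 0 = []" "\<forall>k. \<exists>i. b (Suc k) = b k @ [i]" "\<forall>k. b k \<in> S"
  shows "infinite (descendants S (b k))"
proof -
  have len: "\<And>k. length (b k) = k" using path_length[OF assms(1,2)] .
  then have "inj b" by (metis injI)
  have "infinite (b ` {k..})" using finite_imageD[of b "{k..}"] \<open>inj b\<close>
    by (metis infinite_Ici inj_on_subset subset_UNIV)
  moreover have "b ` {k..} \<subseteq> descendants S (b k)"
    using path_prefix[OF assms(2)] assms(3) by (auto simp: descendants_def)
  ultimately show ?thesis using infinite_super by blast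
qed

subsection \<open>The percolation cluster of the root\<close>

definition open_vertices :: "(vertex \<Rightarrow> nat) \<Rightarrow> (vertex \<Rightarrow> real) \<Rightarrow> real \<Rightarrow> vertex set" where
  "open_vertices d u p = {x \<in> bp_tree d. \<forall>y. y \<noteq> [] \<longrightarrow> prefix y x \<longrightarrow> u y \<le> p}"

lemma open_vertices_snoc:
  "x @ [i] \<in> open_vertices d u p \<longleftrightarrow> x \<in> open_vertices d u p \<and> i < d x \<and> u (x @ [i]) \<le> p"
  by (auto simp: open_vertices_def bp_tree_snoc_iff)

lemma open_vertices_prefix: "x @ y \<in> open_vertices d u p \<Longrightarrow> x \<in> open_vertices d u p"
  by (induction y rule: rev_induct) (auto simp: open_vertices_snoc simp flip: append_assoc)

text \<open>Undirected connection to the root reduces to downward paths because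
  \<open>open_vertices\<close> is stable under crossing an open edge in either direction.\<close>

lemma root_component_eq: "root_component d u p = open_vertices d u p"
proof
  show "root_component d u p \<subseteq> open_vertices d u p"
  proof
    fix x assume "x \<in> root_component d u p"
    then have "([], x) \<in> (open_edges d u p \<union> (open_edges d u p)\<inverse>)\<^sup>*"
      by (simp add: root_component_def)
    then show "x \<in> open_vertices d u p"
    proof (induction rule: rtrancl_induct)
      case (step y z)
      then show ?case
        by (auto simp: open_edges_def tree_edges_def open_vertices_snoc)
    qed (auto simp: open_vertices_def)
  qed
  show "open_vertices d u p \<subseteq> root_component d u p"
  proof
    fix x assume "x \<in> open_vertices d u p"
    then show "x \<in> root_component d u p"
    proof (induction x rule: rev_induct)
      case (snoc i x)
      then have "x \<in> open_vertices d u p" "i < d x" "u (x @ [i]) \<le> p"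
        by (simp_all add: open_vertices_snoc)
      then have "x \<in> root_component d u p" "(x, x @ [i]) \<in> open_edges d u p"
        using snoc.IH by (auto simp: open_edges_def tree_edges_def open_vertices_def)
      then show ?case unfolding root_component_def
        by (auto intro: rtrancl_into_rtrancl)
    qed (simp add: root_component_def)
  qed
qed


lemma minmax_le_iff_open:
  assumes "\<And>x. 0 < d x" "\<And>x. x \<noteq> [] \<Longrightarrow> u x \<le> 1" "0 \<le> p" "v \<in> open_vertices d u p"
  shows "minmax d u n v \<le> p \<longleftrightarrow> (\<exists>y. length y = n \<and> v @ y \<in> open_vertices d u p)"
  using assms(4)
proof (induction n arbitrary: v)
  case 0
  then show ?case using assms(3) by auto
next
  case (Suc n)
  \<comment> \<open>The cap at 1 does no harm: for p at least 1 the child with label 0 exists and is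
    always admissible.\<close>
  have one: "\<exists>i<d v. u (v @ [i]) \<le> p \<and> minmax d u n (v @ [i]) \<le> p" if "1 \<le> p"
    using assms(1)[of v] assms(2)[of "v @ [0]"] that minmax_le_1[of d u n "v @ [0]"]
    by (intro exI[of _ 0]) auto
  have "minmax d u (Suc n) v \<le> p \<longleftrightarrow> (\<exists>i<d v. u (v @ [i]) \<le> p \<and> minmax d u n (v @ [i]) \<le> p)"
    using one unfolding minmax_Suc_le_iff by blast
  also have "\<dots> \<longleftrightarrow> (\<exists>i. v @ [i] \<in> open_vertices d u p \<and> minmax d u n (v @ [i]) \<le> p)"
    using Suc.prems by (auto simp: open_vertices_snoc)
  also have "\<dots> \<longleftrightarrow> (\<exists>i. v @ [i] \<in> open_vertices d u p \<and> (\<exists>y. length y = n \<and> (v @ [i]) @ y \<in> open_vertices d u p))"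
    using Suc.IH by blast
  also have "\<dots> \<longleftrightarrow> (\<exists>i y. length y = n \<and> (v @ [i]) @ y \<in> open_vertices d u p)"
    using open_vertices_prefix by blast
  also have "\<dots> \<longleftrightarrow> (\<exists>y. length y = Suc n \<and> v @ y \<in> open_vertices d u p)"
    by (auto simp: length_Suc_conv)
  finally show ?case .
qed

text \<open>A countable form of being infinite, which serves both measurability and the comparison
  with levels. One direction is the infinite path of \<open>koenig\<close>; for the other, a finite
  set meets only finitely many depths.\<close>

lemma infinite_root_component_iff:
  "infinite (root_component d u p) \<longleftrightarrow> (\<forall>n. \<exists>y. length y = n \<and> y \<in> open_vertices d u p)"
proof
  assume inf: "infinite (root_component d u p)"
  have "prefix_closed (open_vertices d u p)"
    using open_vertices_prefix by (auto simp: prefix_closed_def)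
  moreover have "open_vertices d u p \<subseteq> bp_tree d" by (auto simp: open_vertices_def)
  moreover have "descendants (open_vertices d u p) [] = open_vertices d u p"
    by (auto simp: descendants_def)
  ultimately obtain b where b: "b 0 = []" "\<forall>k. b k \<in> open_vertices d u p" "\<forall>k. \<exists>i. b (Suc k) = b k @ [i]"
    using koenig[of "open_vertices d u p" d "[]"] inf unfolding root_component_eq by auto
  then show "\<forall>n. \<exists>y. length y = n \<and> y \<in> open_vertices d u p"
    using path_length[of b] by metis
next
  assume *: "\<forall>n. \<exists>y. length y = n \<and> y \<in> open_vertices d u p"
  have "n \<in> length ` open_vertices d u p" for n using * by (metis imageI)
  then have "length ` open_vertices d u p = UNIV" by blast
  then show "infinite (root_component d u p)"
    unfolding root_component_eq by (metis finite_imageI infinite_UNIV_nat)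
qed

lemma infinite_root_component_level:
  assumes "\<And>x. 0 < d x" "\<And>x. x \<noteq> [] \<Longrightarrow> u x \<le> 1" "0 \<le> p"
  shows "infinite (root_component d u p) \<longleftrightarrow> level d u [] \<le> p"
proof -
  have "[] \<in> open_vertices d u p" by (auto simp: open_vertices_def)
  from minmax_le_iff_open[OF assms this] show ?thesis
    unfolding infinite_root_component_iff level_le_iff by simp
qed

subsection \<open>The invasion process\<close>

definition subtree_set :: "(vertex \<Rightarrow> nat) \<Rightarrow> vertex set \<Rightarrow> bool" where
  "subtree_set d S \<longleftrightarrow> finite S \<and> [] \<in> S \<and> S \<subseteq> bp_tree d \<and> prefix_closed S"

lemma prefix_closed_snocD: "prefix_closed S \<Longrightarrow> v @ [i] \<in> S \<Longrightarrow> v \<in> S"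
  unfolding prefix_closed_def by blast

lemma boundary_edges_subtree:
  assumes "subtree_set d S"
  shows "boundary_edges d S = {(v, v @ [i]) | v i. v \<in> S \<and> i < d v \<and> v @ [i] \<notin> S}"
  using assms prefix_closed_snocD[of S]
  by (auto simp: boundary_edges_def tree_edges_def subtree_set_def)

text \<open>Stated for every finite \<open>S\<close>, since \<open>pred_invade\<close> lets
  \<open>S\<close> range over arbitrary finite sets. An edge that enters \<open>S\<close> from
  outside starts at the \<open>butlast\<close> of its endpoint.\<close>

lemma finite_boundary_edges: "finite S \<Longrightarrow> finite (boundary_edges d S)"
proof -
  assume S: "finite S"
  have "boundary_edges d S \<subseteq> (\<Union>v\<in>S. (\<lambda>i. (v, v @ [i])) ` {..<d v}) \<union> (\<lambda>x. (butlast x, x)) ` S"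
    by (auto simp: boundary_edges_def tree_edges_def image_iff)
  then show ?thesis using S by (meson finite_UN_I finite_Un finite_imageI finite_lessThan finite_subset)
qed

lemma invade_subtree:
  assumes S: "subtree_set d S" and "boundary_edges d S \<noteq> {}"
  obtains v i where "v \<in> S" "i < d v" "v @ [i] \<notin> S" "invade d u S = insert (v @ [i]) S"
    "\<And>x j. x \<in> S \<Longrightarrow> j < d x \<Longrightarrow> x @ [j] \<notin> S \<Longrightarrow> u (v @ [i]) \<le> u (x @ [j])"
proof -
  define e where "e = arg_min_on (\<lambda>e. u (snd e)) (boundary_edges d S)"
  have fin: "finite (boundary_edges d S)"
    using S by (intro finite_boundary_edges) (simp add: subtree_set_def)
  have "e \<in> boundary_edges d S" and min: "\<And>e'. e' \<in> boundary_edges d S \<Longrightarrow> u (snd e) \<le> u (snd e')"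
    unfolding e_def using arg_min_if_finite(1)[OF fin assms(2)]
      arg_min_least[OF fin assms(2), of _ "\<lambda>e. u (snd e)"] by simp_all
  then obtain v i where vi: "e = (v, v @ [i])" "v \<in> S" "i < d v" "v @ [i] \<notin> S"
    unfolding boundary_edges_subtree[OF S] by auto
  have "invade d u S = insert (v @ [i]) S"
    using assms(2) vi by (auto simp: invade_def Let_def simp flip: e_def)
  moreover have "u (v @ [i]) \<le> u (x @ [j])" if "x \<in> S" "j < d x" "x @ [j] \<notin> S" for x j
    using min[of "(x, x @ [j])"] vi(1) that unfolding boundary_edges_subtree[OF S] by auto
  ultimately show ?thesis using that vi by metis
qed

lemma invasion_Suc: "invasion d u (Suc n) = invade d u (invasion d u n)"
  by (simp add: invasion_def)

lemma subtree_set_invade: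
  assumes S: "subtree_set d S"
  shows "subtree_set d (invade d u S)"
proof (cases "boundary_edges d S = {}")
  case True
  then show ?thesis using S by (simp add: invade_def)
next
  case False
  obtain v i where vi: "v \<in> S" "i < d v" "v @ [i] \<notin> S" "invade d u S = insert (v @ [i]) S"
    using invade_subtree[OF S False] by metis
  have "prefix_closed (insert (v @ [i]) S)"
    unfolding prefix_closed_def
  proof (intro allI impI)
    fix x y assume "x @ y \<in> insert (v @ [i]) S"
    moreover have "x \<in> insert (v @ [i]) S" if "x @ y = v @ [i]"
    proof (cases y rule: rev_cases)
      case (snoc z k)
      then show ?thesis using that S vi(1) unfolding subtree_set_def prefix_closed_def by auto
    qed (use that in simp)
    ultimately show "x \<in> insert (v @ [i]) S"
      using S unfolding subtree_set_def prefix_closed_def by blast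
  qed
  then show ?thesis using S vi by (auto simp: subtree_set_def bp_tree_snoc_iff)
qed

lemma subtree_set_invasion: "subtree_set d (invasion d u n)"
proof (induction n)
  case 0
  show ?case by (auto simp: subtree_set_def invasion_def prefix_closed_def)
qed (auto simp: invasion_Suc intro: subtree_set_invade)

lemma invasion_cluster_subtree:
  "[] \<in> invasion_cluster d u" "invasion_cluster d u \<subseteq> bp_tree d" "prefix_closed (invasion_cluster d u)"
  using subtree_set_invasion[of d u]
  by (auto simp: invasion_cluster_def subtree_set_def prefix_closed_def) blast

text \<open>The first step must descend because the root has no parent, and injectivity forbids ever
  stepping back to the parent, so the undirected path is a descending one.\<close>

lemma is_backbone_iff:
  "is_backbone d u v \<longleftrightarrow>
     v 0 = [] \<and> (\<forall>k. v k \<in> invasion_cluster d u) \<and> (\<forall>k. \<exists>i. v (Suc k) = v k @ [i])"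
proof
  assume bb: "is_backbone d u v"
  have "\<exists>i. v (Suc k) = v k @ [i]" for k
  proof (induction k)
    case 0
    have "(v 0, v (Suc 0)) \<in> tree_edges d \<union> (tree_edges d)\<inverse>" "v 0 = []"
      using bb unfolding is_backbone_def by blast+
    then show ?case by (auto simp: tree_edges_def)
  next
    case (Suc k)
    then obtain i where i: "v (Suc k) = v k @ [i]" by blast
    have "(v (Suc k), v (Suc (Suc k))) \<in> tree_edges d \<union> (tree_edges d)\<inverse>"
      using bb by (simp add: is_backbone_def)
    moreover have "v (Suc k) \<noteq> v (Suc (Suc k)) @ [j]" for j
    proof
      assume "v (Suc k) = v (Suc (Suc k)) @ [j]"
      then have "v (Suc (Suc k)) = v k" using i by simp
      then show False using bb by (auto simp: is_backbone_def dest: injD)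
    qed
    ultimately show ?case by (auto simp: tree_edges_def)
  qed
  then show "v 0 = [] \<and> (\<forall>k. v k \<in> invasion_cluster d u) \<and> (\<forall>k. \<exists>i. v (Suc k) = v k @ [i])"
    using bb by (auto simp: is_backbone_def)
next
  assume *: "v 0 = [] \<and> (\<forall>k. v k \<in> invasion_cluster d u) \<and> (\<forall>k. \<exists>i. v (Suc k) = v k @ [i])"
  then have "length (v k) = k" for k using path_length[of v] by blast
  then have "inj v" by (metis injI)
  moreover have "(v k, v (Suc k)) \<in> tree_edges d" for k
  proof -
    obtain i where i: "v (Suc k) = v k @ [i]" using * by blast
    then have "v k @ [i] \<in> bp_tree d" using * invasion_cluster_subtree(2)[of d u] by (metis subsetD)
    then show ?thesis using i by (auto simp: tree_edges_def bp_tree_snoc_iff)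
  qed
  ultimately show "is_backbone d u v" using * by (auto simp: is_backbone_def)
qed

text \<open>Below the vertex \<open>v\<close> the invasion never needs an edge heavier than the level of \<open>v\<close>, since
  an infinite path starting at \<open>v\<close> with no such edge leaves every finite set.\<close>

lemma light_boundary_edge:
  assumes S: "subtree_set d S" and good: "\<And>x. 0 < d x" "\<And>x. x \<noteq> [] \<Longrightarrow> u x \<le> 1" and v: "v \<in> S"
  shows "\<exists>x\<in>S. \<exists>j<d x. x @ [j] \<notin> S \<and> u (x @ [j]) \<le> level d u v \<and> prefix v x"
proof -
  \<comment> \<open>A deepest element of this finite set has a child whose \<open>elevel\<close> is
    at most the level of \<open>v\<close>; that child would be a deeper element if it belonged to
    \<open>S\<close>, so the edge to it is a boundary edge.\<close>
  define A where "A = {x \<in> S. prefix v x \<and> level d u x \<le> level d u v}"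
  have "finite (length ` A)" "length ` A \<noteq> {}" using S v by (auto simp: A_def subtree_set_def)
  then obtain x where x: "x \<in> A" "\<And>y. y \<in> A \<Longrightarrow> length y \<le> length x"
    using Max_in[of "length ` A"] Max_ge[of "length ` A"] by fastforce
  have "\<exists>j<d x. elevel d u (x @ [j]) \<le> level d u x"
  proof (cases "1 \<le> level d u x")
    case True
    then have "elevel d u (x @ [0]) \<le> level d u x"
      using good(2)[of "x @ [0]"] level_bounds(2)[of d u "x @ [0]"] by (auto simp: elevel_def)
    then show ?thesis using good(1) by blast
  qed (use level_rec[of d u x "level d u x"] in auto)
  then obtain j where j: "j < d x" "elevel d u (x @ [j]) \<le> level d u v"
    using x(1) by (auto simp: A_def)
  have "x @ [j] \<notin> S"
  proof
    assume "x @ [j] \<in> S"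
    then have "x @ [j] \<in> A" using x(1) j(2) by (auto simp: A_def elevel_def prefix_snoc)
    then show False using x(2)[of "x @ [j]"] by simp
  qed
  then show ?thesis using x(1) j by (auto simp: A_def elevel_def)
qed

text \<open>The almost sure properties (see \<open>AE_good\<close>) on which the deterministic
  analysis rests. Distinctness of \<open>elevel\<close> at siblings rules out ties, so the
  minimising child is unique.\<close>

locale good_config =
  fixes d :: "vertex \<Rightarrow> nat" and u :: "vertex \<Rightarrow> real"
  assumes d_pos: "0 < d x"
    and u_le_1: "x \<noteq> [] \<Longrightarrow> u x \<le> 1"
    and u_nonneg: "x \<noteq> [] \<Longrightarrow> 0 \<le> u x"
    and siblings_distinct: "i \<noteq> j \<Longrightarrow> elevel d u (x @ [i]) \<noteq> elevel d u (x @ [j])"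
begin

lemma invasion_weight_le_level:
  "x \<in> invasion d u n \<Longrightarrow> strict_prefix v x \<Longrightarrow> u x \<le> level d u v"
proof (induction n arbitrary: x v)
  case 0
  then show ?case by (simp add: invasion_def)
next
  case (Suc n)
  let ?S = "invasion d u n"
  note S = subtree_set_invasion[of d u n]
  have ne: "boundary_edges d ?S \<noteq> {}"
    using light_boundary_edge[OF S, of u "[]", OF d_pos u_le_1] S
    unfolding boundary_edges_subtree[OF S] by (auto simp: subtree_set_def)
  obtain y i where yi: "y \<in> ?S" "i < d y" "y @ [i] \<notin> ?S" "invade d u ?S = insert (y @ [i]) ?S"
    "\<And>x j. x \<in> ?S \<Longrightarrow> j < d x \<Longrightarrow> x @ [j] \<notin> ?S \<Longrightarrow> u (y @ [i]) \<le> u (x @ [j])"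
    using invade_subtree[OF S ne] by metis
  show ?case
  proof (cases "x \<in> ?S")
    case False
    then have x: "x = y @ [i]" using Suc.prems yi(4) by (simp add: invasion_Suc)
    then have "prefix v y" using Suc.prems(2) by (auto simp: strict_prefix_def prefix_snoc)
    then have "v \<in> ?S" using yi(1) S by (auto simp: subtree_set_def prefix_closed_def prefix_def)
    then show ?thesis using light_boundary_edge[OF S, of u v, OF d_pos u_le_1] yi(5) x order_trans by blast
  qed (use Suc in blast)
qed

lemma infinite_invasion_cluster: "infinite (invasion_cluster d u)"
proof
  assume fin: "finite (invasion_cluster d u)"
  have sub: "invasion d u n \<subset> invasion d u (Suc n)" for n
  proof -
    note S = subtree_set_invasion[of d u n]
    have ne: "boundary_edges d (invasion d u n) \<noteq> {}"
      using light_boundary_edge[OF S, of u "[]", OF d_pos u_le_1] S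
      unfolding boundary_edges_subtree[OF S] by (auto simp: subtree_set_def)
    show ?thesis unfolding invasion_Suc by (rule invade_subtree[OF S ne, of u]) auto
  qed
  have "n \<le> card (invasion d u n)" for n
  proof (induction n)
    case (Suc n)
    have "card (invasion d u n) < card (invasion d u (Suc n))"
      using sub[of n] subtree_set_invasion[of d u "Suc n"] by (intro psubset_card_mono) (auto simp: subtree_set_def)
    then show ?case using Suc by simp
  qed simp
  then have "Suc (card (invasion_cluster d u)) \<le> card (invasion d u (Suc (card (invasion_cluster d u))))" .
  also have "\<dots> \<le> card (invasion_cluster d u)"
    by (rule card_mono[OF fin]) (auto simp: invasion_cluster_def)
  finally show False by simp
qed

text \<open>The invasion bounds all later backbone weights by the level of \<open>v k\<close>, and
  the backbone itself is an infinite route with these weights. So the chosen child has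
  \<open>elevel\<close> at most the level of \<open>v k\<close>, whereas the \<open>elevel\<close>
  of any child is at least this level; distinct siblings make the comparison strict.\<close>

lemma backbone_child:
  assumes "is_backbone d u v"
  shows "\<exists>i<d (v k). v (Suc k) = v k @ [i] \<and> elevel d u (v k @ [i]) = level d u (v k) \<and>
    (\<forall>j<d (v k). j \<noteq> i \<longrightarrow> elevel d u (v k @ [i]) < elevel d u (v k @ [j]))"
proof -
  have v: "v 0 = []" "\<And>k. v k \<in> invasion_cluster d u" "\<forall>k. \<exists>i. v (Suc k) = v k @ [i]"
    using assms by (auto simp: is_backbone_iff)
  have len: "\<And>k. length (v k) = k" using path_length[OF v(1,3)] .
  have le: "u (v i) \<le> level d u (v k)" if "k < i" for i k
  proof -
    obtain n where "v i \<in> invasion d u n" using v(2) by (auto simp: invasion_cluster_def)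
    moreover have "strict_prefix (v k) (v i)"
      using path_prefix[OF v(3), of k i] that len[of k] len[of i] by (auto simp: strict_prefix_def)
    ultimately show ?thesis by (rule invasion_weight_le_level)
  qed
  \<comment> \<open>The backbone supplies a downward path of every length, so a bound on its later
    weights is a bound on \<open>minmax\<close>.\<close>
  have lt: "minmax d u n (v i) \<le> p" if "\<And>m. m > i \<Longrightarrow> u (v m) \<le> p" "0 \<le> p" for n i p
    using that(1)
  proof (induction n arbitrary: i)
    case (Suc n)
    obtain j where j: "v (Suc i) = v i @ [j]" using v(3) by blast
    then have "v i @ [j] \<in> bp_tree d" using subsetD[OF invasion_cluster_subtree(2) v(2)[of "Suc i"]] by simp
    then have "j < d (v i)" by (simp add: bp_tree_snoc_iff)
    moreover have "minmax d u n (v (Suc i)) \<le> p" by (rule Suc.IH) (use Suc.prems in simp)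
    moreover have "u (v (Suc i)) \<le> p" using Suc.prems by simp
    ultimately show ?case unfolding minmax_Suc_le_iff using j by auto
  qed (use that(2) in simp)
  obtain i where i: "v (Suc k) = v k @ [i]" using v(3) by blast
  then have "v k @ [i] \<in> bp_tree d" using subsetD[OF invasion_cluster_subtree(2) v(2)[of "Suc k"]] by simp
  then have id: "i < d (v k)" by (simp add: bp_tree_snoc_iff)
  have "level d u (v (Suc k)) \<le> level d u (v k)"
    unfolding level_le_iff[of d u "v (Suc k)"] using lt[of "Suc k"] le level_bounds(1) by simp
  then have el: "elevel d u (v k @ [i]) \<le> level d u (v k)" using le[of k "Suc k"] i by (simp add: elevel_def)
  have ge: "level d u (v k) \<le> elevel d u (v k @ [j])" if "j < d (v k)" for j
    using level_rec that by blast
  have "elevel d u (v k @ [i]) < elevel d u (v k @ [j])" if "j < d (v k)" "j \<noteq> i" for j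
    using el ge[OF that(1)] siblings_distinct[of i j "v k"] that(2) by fastforce
  then show ?thesis using i id el ge[OF id] by (intro exI[of _ i]) auto
qed

lemma ex1_backbone: "\<exists>!v. is_backbone d u v"
proof (rule ex_ex1I)
  have "descendants (invasion_cluster d u) [] = invasion_cluster d u" by (auto simp: descendants_def)
  then obtain b where "b 0 = []" "\<forall>k. b k \<in> invasion_cluster d u" "\<forall>k. \<exists>i. b (Suc k) = b k @ [i]"
    using koenig[OF invasion_cluster_subtree(2,3), of d u "[]"] infinite_invasion_cluster by auto
  then show "\<exists>v. is_backbone d u v" unfolding is_backbone_iff by blast
  fix v w assume vw: "is_backbone d u v" "is_backbone d u w"
  show "v = w"
  proof
    fix k show "v k = w k"
    proof (induction k)
      case 0
      show ?case using vw by (simp add: is_backbone_iff)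
    next
      case (Suc k)
      obtain i where i: "i < d (v k)" "v (Suc k) = v k @ [i]"
        "\<forall>j<d (v k). j \<noteq> i \<longrightarrow> elevel d u (v k @ [i]) < elevel d u (v k @ [j])"
        using backbone_child[OF vw(1), of k] by blast
      obtain j where j: "j < d (v k)" "w (Suc k) = v k @ [j]"
        "\<forall>i<d (v k). i \<noteq> j \<longrightarrow> elevel d u (v k @ [j]) < elevel d u (v k @ [i])"
        using backbone_child[OF vw(2), of k] Suc by auto
      have "i = j" using i(1,3) j(1,3) less_asym by blast
      then show ?case using i j by simp
    qed
  qed
qed

lemma is_backbone_backbone: "is_backbone d u (backbone d u)"
  unfolding backbone_def using ex1_backbone theI'[OF ex1_backbone] by simp

lemma level_backbone: "level d u (backbone d u k) = (SUP i\<in>{k<..}. backbone_weight d u i)"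
proof -
  let ?v = "backbone d u"
  have step: "level d u (?v k) = max (u (?v (Suc k))) (level d u (?v (Suc k)))" for k
  proof -
    obtain i where "?v (Suc k) = ?v k @ [i]" "elevel d u (?v k @ [i]) = level d u (?v k)"
      using backbone_child[OF is_backbone_backbone, of k] by blast
    then show ?thesis unfolding elevel_def by metis
  qed
  have dec: "level d u (?v m) \<le> level d u (?v k)" if "k \<le> m" for k m
  proof (rule lift_Suc_antimono_le[OF _ that])
    show "level d u (?v (Suc k)) \<le> level d u (?v k)" for k using step[of k] by linarith
  qed
  have le: "u (?v i) \<le> level d u (?v k)" if "k < i" for i k
  proof -
    obtain m where m: "i = Suc m" "k \<le> m" using \<open>k < i\<close> by (cases i) auto
    have "u (?v (Suc m)) \<le> level d u (?v m)" using step[of m] by simp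
    then show ?thesis using dec[OF m(2)] unfolding m(1) by linarith
  qed
  show ?thesis unfolding backbone_weight_def
  proof (rule antisym)
    let ?s = "SUP i\<in>{k<..}. u (?v i)"
    have bdd: "bdd_above ((\<lambda>i. u (?v i)) ` {k<..})" using le by (auto intro!: bdd_aboveI)
    show "?s \<le> level d u (?v k)" by (rule cSUP_least) (use le in auto)
    have us: "u (?v i) \<le> ?s" if "k < i" for i by (rule cSUP_upper[OF _ bdd]) (use that in simp)
    \<comment> \<open>The \<open>max 0\<close> is needed because \<open>minmax\<close> starts from
      0; that the supremum is nonnegative is shown afterwards, from the weight of a vertex other
      than the root.\<close>
    have "minmax d u n (?v i) \<le> max 0 ?s" if "k \<le> i" for n i
      using that
    proof (induction n arbitrary: i)
      case (Suc n)
      obtain j where "j < d (?v i)" "?v (Suc i) = ?v i @ [j]"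
        using backbone_child[OF is_backbone_backbone, of i] by blast
      moreover have "minmax d u n (?v (Suc i)) \<le> max 0 ?s" by (rule Suc.IH) (use Suc.prems in simp)
      moreover have "u (?v (Suc i)) \<le> ?s" using us[of "Suc i"] Suc.prems by simp
      ultimately show ?case unfolding minmax_Suc_le_iff
        by (auto simp: le_max_iff_disj)
    qed simp
    then have "level d u (?v k) \<le> max 0 ?s" by (simp add: level_le_iff)
    moreover have "0 \<le> ?s"
    proof -
      have "?v (Suc k) \<noteq> []"
        using backbone_child[OF is_backbone_backbone, of k] by (metis snoc_eq_iff_butlast)
      then show ?thesis using u_nonneg us[of "Suc k"] by (meson lessI order_trans)
    qed
    ultimately show "level d u (?v k) \<le> ?s" by simp
  qed
qed

end

subsection \<open>Selection of a vertex by the backbone\<close>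

text \<open>\<open>selects d u (rev v) r\<close> says that the path to \<open>v\<close> beats all its siblings and the siblings of its
  ancestors when \<open>r\<close> is the minimal weight of a route to infinity through \<open>v\<close> from its parent.\<close>

primrec selects :: "(vertex \<Rightarrow> nat) \<Rightarrow> (vertex \<Rightarrow> real) \<Rightarrow> nat list \<Rightarrow> real \<Rightarrow> bool" where
  "selects d u [] r \<longleftrightarrow> True"
| "selects d u (i # w) r \<longleftrightarrow> i < d (rev w) \<and>
     (\<forall>j<d (rev w). j \<noteq> i \<longrightarrow> r < elevel d u (rev w @ [j])) \<and>
     selects d u w (max (u (rev w)) r)"

text \<open>A smaller \<open>r\<close> beats more competitors. Hence the admissible \<open>r\<close>
  form a down-set, the shape required of \<open>J\<close> in
  \<open>prob_elev_selected_le\<close>.\<close>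

lemma selects_antimono: "selects d u w r \<Longrightarrow> r' \<le> r \<Longrightarrow> selects d u w r'"
proof (induction w arbitrary: r r')
  case (Cons i w)
  have "max (u (rev w)) r' \<le> max (u (rev w)) r" using Cons.prems(2) by auto
  then have "selects d u w (max (u (rev w)) r')" using Cons by auto
  then show ?case using Cons.prems by (auto intro: le_less_trans)
qed simp

text \<open>Nothing inside the subtree of \<open>rev w\<close>, nor the edge above it, is read
  directly; all of this enters through \<open>r\<close>. Independence of the selection from the
  subtree rests on this.\<close>

lemma selects_cong:
  assumes "\<And>x. \<not> prefix (rev w) x \<Longrightarrow> d x = d' x"
    "\<And>x. x \<noteq> [] \<Longrightarrow> \<not> prefix (rev w) x \<Longrightarrow> u x = u' x"
  shows "selects d u w r = selects d' u' w r"
  using assms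
proof (induction w arbitrary: r)
  case (Cons i w)
  have "elevel d u (rev w @ [j]) = elevel d' u' (rev w @ [j])" if "j \<noteq> i" for j
    by (rule elevel_cong) (use Cons.prems that in simp_all)
  moreover have "d (rev w) = d' (rev w)" using Cons.prems by simp
  \<comment> \<open>For \<open>w = []\<close> the argument contains the unspecified weight at the
    root, but \<open>selects\<close> ignores its argument there.\<close>
  moreover have "selects d u w (max (u (rev w)) r) = selects d' u' w (max (u' (rev w)) r)"
  proof (cases "w = []")
    case False
    then have "u (rev w) = u' (rev w)" using Cons.prems(2) by simp
    moreover have "selects d u w r' = selects d' u' w r'" for r'
      by (rule Cons.IH) (use Cons.prems in \<open>auto simp: prefix_snoc dest: append_prefixD\<close>)
    ultimately show ?thesis by simp
  qed simp
  ultimately show ?case by auto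
qed simp

context good_config
begin

lemma backbone_iff_selects:
  "backbone d u k = v \<longleftrightarrow> length v = k \<and> selects d u (rev v) (elevel d u v)"
proof (induction k arbitrary: v)
  case 0
  have "backbone d u 0 = []" using is_backbone_backbone by (simp add: is_backbone_def)
  then show ?case by auto
next
  case (Suc k)
  obtain i where i: "i < d (backbone d u k)" "backbone d u (Suc k) = backbone d u k @ [i]"
    "elevel d u (backbone d u k @ [i]) = level d u (backbone d u k)"
    "\<And>j. j<d (backbone d u k) \<Longrightarrow> j \<noteq> i \<Longrightarrow>
      elevel d u (backbone d u k @ [i]) < elevel d u (backbone d u k @ [j])"
    using backbone_child[OF is_backbone_backbone, of k] by blast
  show ?case
  proof
    assume v: "backbone d u (Suc k) = v"
    have "length (backbone d u k) = k \<and>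
      selects d u (rev (backbone d u k)) (elevel d u (backbone d u k))"
      using Suc.IH[of "backbone d u k"] by simp
    then show "length v = Suc k \<and> selects d u (rev v) (elevel d u v)"
      using i v by (auto simp: elevel_def[of d u "backbone d u k"])
  next
    assume *: "length v = Suc k \<and> selects d u (rev v) (elevel d u v)"
    then obtain x j where v: "v = x @ [j]" "length x = k" by (metis length_Suc_conv_rev)
    from * have s: "j < d x" "\<And>l. l < d x \<Longrightarrow> l \<noteq> j \<Longrightarrow> elevel d u v < elevel d u (x @ [l])"
      "selects d u (rev x) (max (u x) (elevel d u v))"
      by (simp_all add: v)
    \<comment> \<open>The strict comparisons in \<open>selects\<close> say that \<open>v\<close> is
      the minimising child of \<open>x\<close>, so the level of \<open>x\<close> is attained at
      \<open>v\<close> and the condition can be passed on to \<open>x\<close>.\<close>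
    have "level d u x = elevel d u v"
    proof (rule antisym)
      show "level d u x \<le> elevel d u v" using level_rec s(1) v(1) by blast
      show "elevel d u v \<le> level d u x"
      proof (cases "1 \<le> level d u x")
        case True
        then show ?thesis using u_le_1[of v] level_bounds(2)[of d u v] v by (auto simp: elevel_def)
      next
        case False
        then obtain l where "l < d x" "elevel d u (x @ [l]) \<le> level d u x"
          using level_rec[of d u x "level d u x"] by auto
        then show ?thesis using s(2)[of l] v(1) by (cases "l = j") auto
      qed
    qed
    then have "selects d u (rev x) (elevel d u x)" using s(3) by (simp add: elevel_def[of d u x])
    then have b: "backbone d u k = x" using Suc.IH v(2) by blast
    have "i = j"
    proof (rule ccontr)
      assume "i \<noteq> j"
      then show False using i(4)[of j] s(2)[of i] i(1) s(1) v(1) b by auto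
    qed
    then show "backbone d u (Suc k) = v" using b i(2) v(1) by simp
  qed
qed

end

subsection \<open>Measurability\<close>

text \<open>Nothing is assumed about the weight stored at the root, which no quantity of interest uses.\<close>

locale random_config =
  fixes M :: "'a measure" and d :: "'a \<Rightarrow> vertex \<Rightarrow> nat" and u :: "'a \<Rightarrow> vertex \<Rightarrow> real"
  assumes measurable_d [measurable]: "(\<lambda>\<omega>. d \<omega> v) \<in> M \<rightarrow>\<^sub>M count_space UNIV"
    and measurable_u: "v \<noteq> [] \<Longrightarrow> (\<lambda>\<omega>. u \<omega> v) \<in> borel_measurable M"
begin

lemma measurable_u_child [measurable]: "(\<lambda>\<omega>. u \<omega> (v @ [i])) \<in> borel_measurable M"
  by (rule measurable_u) simp

lemma measurable_minmax [measurable]: "(\<lambda>\<omega>. minmax (d \<omega>) (u \<omega>) n v) \<in> borel_measurable M"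
proof (induction n arbitrary: v)
  case (Suc n)
  note Suc [measurable]
  have "{\<omega> \<in> space M. minmax (d \<omega>) (u \<omega>) (Suc n) v \<le> p} \<in> sets M" for p
    unfolding minmax_Suc_le_iff by measurable
  then show ?case unfolding borel_measurable_iff_le by blast
qed simp

lemma measurable_level [measurable]: "(\<lambda>\<omega>. level (d \<omega>) (u \<omega>) v) \<in> borel_measurable M"
proof -
  have "{\<omega> \<in> space M. level (d \<omega>) (u \<omega>) v \<le> p} \<in> sets M" for p
    unfolding level_le_iff by measurable
  then show ?thesis unfolding borel_measurable_iff_le by blast
qed

lemma measurable_elevel: "v \<noteq> [] \<Longrightarrow> (\<lambda>\<omega>. elevel (d \<omega>) (u \<omega>) v) \<in> borel_measurable M"
  using measurable_u[of v] unfolding elevel_def by measurable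

lemma measurable_elevel_child [measurable]: "(\<lambda>\<omega>. elevel (d \<omega>) (u \<omega>) (v @ [i])) \<in> borel_measurable M"
  by (rule measurable_elevel) simp

lemma measurable_selects [measurable]:
  "f \<in> borel_measurable M \<Longrightarrow> Measurable.pred M (\<lambda>\<omega>. selects (d \<omega>) (u \<omega>) w (f \<omega>))"
proof (induction w arbitrary: f)
  case (Cons i w)
  have [measurable]: "f \<in> borel_measurable M" by fact
  have [measurable]: "Measurable.pred M (\<lambda>\<omega>. selects (d \<omega>) (u \<omega>) w (max (u \<omega> (rev w)) (f \<omega>)))"
  proof (cases "w = []")
    case False
    then have [measurable]: "(\<lambda>\<omega>. u \<omega> (rev w)) \<in> borel_measurable M" by (simp add: measurable_u)
    show ?thesis by (rule Cons.IH) measurable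
  qed simp
  show ?case by simp
qed simp

lemma pred_bp_tree [measurable]: "Measurable.pred M (\<lambda>\<omega>. v \<in> bp_tree (d \<omega>))"
proof (induction v rule: rev_induct)
  case (snoc i v)
  note snoc [measurable]
  show ?case unfolding bp_tree_snoc_iff by measurable
qed simp

lemma pred_open_vertices [measurable]: "Measurable.pred M (\<lambda>\<omega>. v \<in> open_vertices (d \<omega>) (u \<omega>) p)"
proof (induction v rule: rev_induct)
  case Nil
  then show ?case by (simp add: open_vertices_def)
next
  case (snoc i v)
  note snoc [measurable]
  show ?case unfolding open_vertices_snoc by measurable
qed

lemma pred_infinite_root_component [measurable]:
  "Measurable.pred M (\<lambda>\<omega>. infinite (root_component (d \<omega>) (u \<omega>) p))"
  unfolding infinite_root_component_iff by measurable

lemma pred_boundary_edges [measurable]: "Measurable.pred M (\<lambda>\<omega>. e \<in> boundary_edges (d \<omega>) S)"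
proof -
  have "e \<in> boundary_edges (d \<omega>) S \<longleftrightarrow> ((fst e \<in> S) \<noteq> (snd e \<in> S)) \<and>
    (\<exists>i. snd e = fst e @ [i] \<and> fst e \<in> bp_tree (d \<omega>) \<and> i < d \<omega> (fst e))" for \<omega>
    by (cases e) (auto simp: boundary_edges_def tree_edges_def)
  then show ?thesis by simp
qed

lemma pred_set_eq:
  fixes A :: "'a \<Rightarrow> 'b :: countable set"
  assumes [measurable]: "\<And>e. Measurable.pred M (\<lambda>\<omega>. e \<in> A \<omega>)"
  shows "Measurable.pred M (\<lambda>\<omega>. A \<omega> = F)"
  unfolding set_eq_iff by measurable

text \<open>The invaded edge is a function of the finite set of minimisers, which takes countably many
  values; this covers the arbitrary choice among ties.\<close>

lemma pred_invade:
  assumes "finite S"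
  shows "Measurable.pred M (\<lambda>\<omega>. x \<in> invade (d \<omega>) (u \<omega>) S)"
proof -
  define m where "m \<omega> = {e. is_arg_min (\<lambda>e. u \<omega> (snd e)) (\<lambda>e. e \<in> boundary_edges (d \<omega>) S) e}" for \<omega>
  define h :: "edge list \<Rightarrow> edge list \<Rightarrow> vertex set"
    where "h ys zs = (if ys = [] then S else let e = (SOME e. e \<in> set zs) in S \<union> {fst e, snd e})" for ys zs
  have m_iff: "e \<in> m \<omega> \<longleftrightarrow> e \<in> boundary_edges (d \<omega>) S \<and>
     \<not> (\<exists>e'. e' \<in> boundary_edges (d \<omega>) S \<and> (snd e' \<noteq> [] \<and> snd e \<noteq> [] \<and> u \<omega> (snd e') < u \<omega> (snd e)))"
    for \<omega> e
  proof -
    have "snd e \<noteq> []" if "e \<in> boundary_edges (d \<omega>) S" for e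
      using that by (auto simp: boundary_edges_def tree_edges_def)
    then show ?thesis unfolding m_def is_arg_min_def by blast
  qed
  have [measurable]: "Measurable.pred M (\<lambda>\<omega>. snd e' \<noteq> [] \<and> snd e \<noteq> [] \<and> u \<omega> (snd e') < u \<omega> (snd e))"
    for e e' :: edge
  proof (cases "snd e' \<noteq> [] \<and> snd e \<noteq> []")
    case True
    then have [measurable]: "(\<lambda>\<omega>. u \<omega> (snd e)) \<in> borel_measurable M" "(\<lambda>\<omega>. u \<omega> (snd e')) \<in> borel_measurable M"
      by (auto intro: measurable_u)
    show ?thesis by measurable
  qed auto
  have [measurable]: "Measurable.pred M (\<lambda>\<omega>. e \<in> m \<omega>)" for e
    unfolding m_iff by measurable
  have [measurable]: "Measurable.pred M (\<lambda>\<omega>. m \<omega> = F)" for F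
    by (rule pred_set_eq) measurable
  have [measurable]: "Measurable.pred M (\<lambda>\<omega>. boundary_edges (d \<omega>) S = F)" for F
    by (rule pred_set_eq) measurable
  have fin: "finite (boundary_edges (d \<omega>) S)" "finite (m \<omega>)" for \<omega>
  proof -
    show 1: "finite (boundary_edges (d \<omega>) S)" by (rule finite_boundary_edges[OF assms])
    show "finite (m \<omega>)" by (rule finite_subset[OF _ 1]) (auto simp: m_def is_arg_min_def)
  qed
  have inv: "invade (d \<omega>) (u \<omega>) S = h ys zs" if "boundary_edges (d \<omega>) S = set ys" "m \<omega> = set zs" for \<omega> ys zs
  proof -
    have "arg_min_on (\<lambda>e. u \<omega> (snd e)) (boundary_edges (d \<omega>) S) = (SOME e. e \<in> m \<omega>)"
      by (simp add: arg_min_on_def arg_min_def m_def)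
    then show ?thesis using that by (simp add: invade_def h_def Let_def)
  qed
  have "x \<in> invade (d \<omega>) (u \<omega>) S \<longleftrightarrow>
    (\<exists>ys zs. boundary_edges (d \<omega>) S = set ys \<and> m \<omega> = set zs \<and> x \<in> h ys zs)" for \<omega>
    using inv[of \<omega>] finite_list[OF fin(1)] finite_list[OF fin(2)] by metis
  then show ?thesis by simp
qed

lemma pred_invasion [measurable]: "Measurable.pred M (\<lambda>\<omega>. x \<in> invasion (d \<omega>) (u \<omega>) n)"
proof (induction n arbitrary: x)
  case 0
  show ?case by (simp add: invasion_def)
next
  case (Suc n)
  have [measurable]: "Measurable.pred M (\<lambda>\<omega>. invasion (d \<omega>) (u \<omega>) n = F)" for F
    by (rule pred_set_eq) (rule Suc)
  have [measurable]: "Measurable.pred M (\<lambda>\<omega>. x \<in> invade (d \<omega>) (u \<omega>) (set ys))" for ys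
    by (rule pred_invade) simp
  have "finite (invasion (d \<omega>) (u \<omega>) n)" for \<omega>
    using subtree_set_invasion by (auto simp: subtree_set_def)
  then have "x \<in> invasion (d \<omega>) (u \<omega>) (Suc n) \<longleftrightarrow>
    (\<exists>ys. invasion (d \<omega>) (u \<omega>) n = set ys \<and> x \<in> invade (d \<omega>) (u \<omega>) (set ys))" for \<omega>
    unfolding invasion_Suc using finite_list by metis
  then show ?case by simp
qed

end

section \<open>Measurability of the backbone: quantification over paths is replaced by a condition
  on single vertices\<close>

lemma infinite_descendants_cluster_iff:
  "infinite (descendants (invasion_cluster d u) x) \<longleftrightarrow> (\<exists>v. is_backbone d u v \<and> v (length x) = x)"
proof
  assume "infinite (descendants (invasion_cluster d u) x)"
  from koenig[OF invasion_cluster_subtree(2,3) this]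
  show "\<exists>v. is_backbone d u v \<and> v (length x) = x" unfolding is_backbone_iff by blast
next
  assume "\<exists>v. is_backbone d u v \<and> v (length x) = x"
  then obtain v where v: "is_backbone d u v" "v (length x) = x" by blast
  then show "infinite (descendants (invasion_cluster d u) x)"
    using path_infinite_descendants[of v "invasion_cluster d u" "length x"] by (simp add: is_backbone_iff)
qed

lemma length_is_backbone: "is_backbone d u v \<Longrightarrow> length (v k) = k"
  by (rule path_length) (auto simp: is_backbone_iff)

text \<open>Valid for every configuration, fallback included. Since vertices form a countable type,
  uniqueness of the path, stated as at most one vertex with \<open>Q\<close> at each depth, becomes
  a countable condition.\<close>

lemma backbone_eq_iff:
  fixes d u
  defines "Q x \<equiv> infinite (descendants (invasion_cluster d u) x)"
  shows "backbone d u k = x \<longleftrightarrow>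
    (if Q [] \<and> (\<forall>x y. length x = length y \<longrightarrow> Q x \<longrightarrow> Q y \<longrightarrow> x = y) then Q x \<and> length x = k
     else x = replicate k 0)"
proof -
  have Q: "Q x \<longleftrightarrow> (\<exists>v. is_backbone d u v \<and> v (length x) = x)" for x
    unfolding Q_def by (rule infinite_descendants_cluster_iff)
  have ex1: "(\<exists>!v. is_backbone d u v) \<longleftrightarrow> Q [] \<and> (\<forall>x y. length x = length y \<longrightarrow> Q x \<longrightarrow> Q y \<longrightarrow> x = y)"
  proof
    assume ex: "\<exists>!v. is_backbone d u v"
    then obtain v where v: "is_backbone d u v" "\<And>w. is_backbone d u w \<Longrightarrow> w = v" by metis
    have "Q []" unfolding Q using v(1) by (auto simp: is_backbone_iff)
    moreover have "x = v (length x)" if "Q x" for x using that v(2) unfolding Q by metis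
    ultimately show "Q [] \<and> (\<forall>x y. length x = length y \<longrightarrow> Q x \<longrightarrow> Q y \<longrightarrow> x = y)" by metis
  next
    assume R: "Q [] \<and> (\<forall>x y. length x = length y \<longrightarrow> Q x \<longrightarrow> Q y \<longrightarrow> x = y)"
    then obtain v where v: "is_backbone d u v" unfolding Q by blast
    have Qv: "Q (w k)" if "is_backbone d u w" for w k
      using that length_is_backbone[OF that] unfolding Q by metis
    have "w = v" if w: "is_backbone d u w" for w
    proof
      fix k
      show "w k = v k"
        using R Qv[OF w, of k] Qv[OF v, of k] length_is_backbone[OF w, of k] length_is_backbone[OF v, of k]
        by metis
    qed
    then show "\<exists>!v. is_backbone d u v" using v by blast
  qed
  show ?thesis
  proof (cases "\<exists>!v. is_backbone d u v")
    case True
    define b where "b = backbone d u"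
    have b: "is_backbone d u b" "\<And>w. is_backbone d u w \<Longrightarrow> w = b"
      unfolding b_def backbone_def using True theI'[OF True] by auto
    have "b k = x \<longleftrightarrow> Q x \<and> length x = k"
      unfolding Q using b length_is_backbone[OF b(1)] by metis
    then show ?thesis using True ex1 unfolding b_def by simp
  next
    case False
    then show ?thesis using ex1 by (auto simp: backbone_def)
  qed
qed

lemma length_backbone: "length (backbone d u k) = k"
proof (cases "\<exists>!v. is_backbone d u v")
  case True
  then show ?thesis using length_is_backbone theI'[OF True] by (simp add: backbone_def)
qed (simp add: backbone_def)

context random_config
begin

lemma pred_invasion_cluster [measurable]: "Measurable.pred M (\<lambda>\<omega>. x \<in> invasion_cluster (d \<omega>) (u \<omega>))"
  unfolding invasion_cluster_def by simp

lemma pred_infinite_descendants [measurable]: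
  "Measurable.pred M (\<lambda>\<omega>. infinite (descendants (invasion_cluster (d \<omega>) (u \<omega>)) x))"
proof -
  have "infinite A \<longleftrightarrow> (\<forall>n. \<exists>y. n \<le> to_nat y \<and> y \<in> A)" for A :: "vertex set"
  proof -
    have "infinite A \<longleftrightarrow> infinite (to_nat ` A)" by (simp add: finite_image_iff)
    also have "\<dots> \<longleftrightarrow> (\<forall>n. \<exists>y. n \<le> to_nat y \<and> y \<in> A)"
      unfolding infinite_nat_iff_unbounded_le by blast
    finally show ?thesis .
  qed
  then show ?thesis by (simp add: descendants_def)
qed

lemma pred_backbone_eq [measurable]: "Measurable.pred M (\<lambda>\<omega>. backbone (d \<omega>) (u \<omega>) k = x)"
  unfolding backbone_eq_iff by measurable

lemma measurable_backbone [measurable]: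
  "(\<lambda>\<omega>. backbone (d \<omega>) (u \<omega>) k) \<in> M \<rightarrow>\<^sub>M count_space UNIV"
proof -
  have "(\<lambda>\<omega>. backbone (d \<omega>) (u \<omega>) k) -` {x} \<inter> space M \<in> sets M" for x
    using pred_backbone_eq[of k x] by (simp add: pred_def vimage_def Int_def conj_commute)
  then show ?thesis by (subst measurable_count_space_eq_countable) auto
qed

lemma measurable_degree [measurable]:
  "(\<lambda>\<omega>. d \<omega> (backbone (d \<omega>) (u \<omega>) k)) \<in> M \<rightarrow>\<^sub>M count_space UNIV"
  by (rule measurable_compose_countable[where f="\<lambda>v \<omega>. d \<omega> v"]) measurable

lemma measurable_weight:
  assumes "0 < k"
  shows "(\<lambda>\<omega>. backbone_weight (d \<omega>) (u \<omega>) k) \<in> borel_measurable M"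
proof -
  have "(\<lambda>\<omega>. (if backbone (d \<omega>) (u \<omega>) k = [] then 0 else u \<omega> (backbone (d \<omega>) (u \<omega>) k))) \<in> borel_measurable M"
  proof (rule measurable_compose_countable[where f="\<lambda>v \<omega>. if v = [] then 0 else u \<omega> v"])
    show "(\<lambda>\<omega>. if v = [] then 0 else u \<omega> v) \<in> borel_measurable M" for v
      using measurable_u[of v] by (cases "v = []") auto
  qed measurable
  moreover have "backbone (d \<omega>) (u \<omega>) k \<noteq> []" for \<omega>
    using length_backbone[of "d \<omega>" "u \<omega>" k] assms by auto
  ultimately show ?thesis by (simp add: backbone_weight_def)
qed

lemma measurable_future_max [measurable]:
  "(\<lambda>\<omega>. SUP i\<in>{k<..}. backbone_weight (d \<omega>) (u \<omega>) i) \<in> borel_measurable M"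
proof -
  let ?F = "\<lambda>i \<omega>. backbone_weight (d \<omega>) (u \<omega>) i"
  have [measurable]: "?F i \<in> borel_measurable M" if "i \<in> {k<..}" for i
    by (rule measurable_weight) (use that in auto)
  let ?B = "\<lambda>\<omega>. \<exists>n::nat. \<forall>i\<in>{k<..}. ?F i \<omega> \<le> real n"
  have B: "?B \<omega> \<longleftrightarrow> bdd_above ((\<lambda>i. ?F i \<omega>) ` {k<..})" for \<omega>
    unfolding bdd_above_def by (auto, meson order_trans real_arch_simple)
  have [measurable]: "Measurable.pred M ?B" by measurable
  \<comment> \<open>Truncation makes the family bounded for every outcome, as measurability of a
    real supremum requires.\<close>
  define G where "G \<omega> = (SUP i\<in>{k<..}. if ?B \<omega> then ?F i \<omega> else 0)" for \<omega>
  \<comment> \<open>Without an upper bound the real supremum is a least element of the empty set of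
    bounds: an unspecified constant, but the same for all such outcomes.\<close>
  have eq: "(SUP i\<in>{k<..}. ?F i \<omega>) = (if ?B \<omega> then G \<omega> else (LEAST z::real. False))" for \<omega>
  proof (cases "?B \<omega>")
    case False
    then have "\<not> (\<forall>i\<in>{k<..}. ?F i \<omega> \<le> z)" for z unfolding B bdd_above_def by auto
    then have "(\<lambda>z. \<forall>i\<in>{k<..}. ?F i \<omega> \<le> z) = (\<lambda>z. False)" by (intro ext) simp
    then show ?thesis unfolding if_not_P[OF False] by (simp add: Sup_real_def)
  qed (simp add: G_def)
  have [measurable]: "G \<in> borel_measurable M"
    unfolding G_def
  proof (rule borel_measurable_cSUP)
    show "bdd_above ((\<lambda>i. if ?B \<omega> then ?F i \<omega> else 0) ` {k<..})" for \<omega>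
      using B[of \<omega>] by (cases "?B \<omega>") auto
  qed auto
  show ?thesis unfolding eq by measurable
qed

end

subsection \<open>The survival equation\<close>

locale offspring =
  fixes X :: "nat pmf"
  assumes pmf_X_0: "pmf X 0 = 0"
    and prob_ge_2_pos: "0 < measure_pmf.prob X {2..}"
begin

text \<open>Probability that at least one of X children is kept when each is kept independently with
  probability \<open>q\<close>.\<close>

definition survive :: "real \<Rightarrow> real" where
  "survive q = 1 - measure_pmf.expectation X (\<lambda>n. (1 - q) ^ n)"

text \<open>The quotient \<open>survive q / q\<close> in a form that is visibly decreasing in
  \<open>q\<close>. Its reciprocal is the weight p at which p times the survival probability equals
  \<open>q\<close>.\<close>

definition slope :: "real \<Rightarrow> real" where
  "slope q = measure_pmf.expectation X (\<lambda>n. \<Sum>j<n. (1 - q) ^ j)"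

text \<open>Probability that a path of length n with weights at most p starts at a given vertex; see
  \<open>prob_mm\<close>.\<close>

primrec survive_iter :: "nat \<Rightarrow> real \<Rightarrow> real" where
  "survive_iter 0 p = 1"
| "survive_iter (Suc n) p = survive (p * survive_iter n p)"

definition survival :: "real \<Rightarrow> real" where
  "survival p = lim (\<lambda>n. survive_iter n p)"

definition survival_hat :: "real \<Rightarrow> real" where
  "survival_hat p = p * survival p"

lemma AE_pos: "AE n in measure_pmf X. 0 < n"
  using pmf_X_0 by (auto simp: AE_measure_pmf_iff set_pmf_iff intro: gr0I)

lemma integrable_power: "0 \<le> x \<Longrightarrow> x \<le> 1 \<Longrightarrow> integrable (measure_pmf X) (\<lambda>n. x ^ n :: real)"
  by (rule measure_pmf.integrable_const_bound[where B=1]) (auto simp: power_le_one)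

lemma geometric_sum: "q \<noteq> 0 \<Longrightarrow> (\<Sum>j<n. (1 - q) ^ j) = (1 - (1 - q) ^ n) / q"
  for q :: real
  using one_diff_power_eq[of "1 - q" n] by (simp add: field_simps)

lemma integrable_slope:
  fixes q :: real
  assumes "0 < q" "q \<le> 1"
  shows "integrable (measure_pmf X) (\<lambda>n. \<Sum>j<n. (1 - q) ^ j)"
  using assms integrable_power[of "1 - q"] by (simp add: geometric_sum)

lemma survive_eq_slope: "0 < q \<Longrightarrow> q \<le> 1 \<Longrightarrow> survive q = q * slope q"
  using integrable_power[of "1 - q"] by (simp add: survive_def slope_def geometric_sum)

lemma survive_0: "survive 0 = 0"
  by (simp add: survive_def)

lemma survive_mono:
  assumes "0 \<le> q" "q \<le> q'" "q' \<le> 1"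
  shows "survive q \<le> survive q'"
  unfolding survive_def using assms
  by (intro diff_left_mono integral_mono integrable_power power_mono) auto

lemma survive_bounds:
  assumes "0 \<le> q" "q \<le> 1"
  shows "0 \<le> survive q" "survive q \<le> 1"
  using survive_mono[of 0 q] survive_0 assms by (auto simp: survive_def)

lemma survive_1: "survive 1 = 1"
proof -
  have "measure_pmf.expectation X (\<lambda>n. 0 ^ n :: real) = measure_pmf.expectation X (\<lambda>n. 0)"
    using AE_pos by (intro integral_cong_AE) (auto elim!: eventually_mono)
  then show ?thesis by (simp add: survive_def)
qed

lemma slope_ge_1:
  assumes "0 < q" "q \<le> 1"
  shows "1 \<le> slope q"
proof -
  have "measure_pmf.expectation X (\<lambda>n. 1) \<le> slope q"
    unfolding slope_def
  proof (intro integral_mono_AE integrable_slope assms)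
    have "1 \<le> (\<Sum>j<n. (1 - q) ^ j)" if "0 < n" for n
      using member_le_sum[of 0 "{..<n}" "\<lambda>j. (1 - q) ^ j"] assms that by simp
    with AE_pos show "AE n in measure_pmf X. 1 \<le> (\<Sum>j<n. (1 - q) ^ j)"
      by (auto elim!: eventually_mono)
  qed simp
  then show ?thesis by simp
qed

text \<open>Each summand decreases in q, and for n >= 2 the summand with j = 1 alone drops by
  \<open>q' - q\<close>. The quantitative form is what yields a Lipschitz constant.\<close>

lemma slope_decrease:
  assumes "0 < q" "q \<le> q'" "q' \<le> 1"
  shows "measure_pmf.prob X {2..} * (q' - q) \<le> slope q - slope q'"
proof -
  have "measure_pmf.prob X {2..} * (q' - q) = measure_pmf.expectation X (\<lambda>n. indicator {2..} n * (q' - q))"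
    by simp
  also have "\<dots> \<le> measure_pmf.expectation X (\<lambda>n. (\<Sum>j<n. (1 - q) ^ j) - (\<Sum>j<n. (1 - q') ^ j))"
  proof (intro integral_mono Bochner_Integration.integrable_diff integrable_slope)
    fix n
    have le: "0 \<le> (1 - q) ^ j - (1 - q') ^ j" for j
      using power_mono[of "1 - q'" "1 - q" j] assms by simp
    show "indicator {2..} n * (q' - q) \<le> (\<Sum>j<n. (1 - q) ^ j) - (\<Sum>j<n. (1 - q') ^ j)"
    proof (cases "2 \<le> n")
      case True
      then show ?thesis
        using member_le_sum[of 1 "{..<n}" "\<lambda>j. (1 - q) ^ j - (1 - q') ^ j"] le
        by (simp add: sum_subtractf)
    next
      case False
      then show ?thesis using le by (simp flip: sum_subtractf add: sum_nonneg)
    qed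
  qed (use assms in \<open>auto intro!: integrable_mult_left measure_pmf.integrable_const_bound[where B=1]\<close>)
  also have "\<dots> = slope q - slope q'"
    unfolding slope_def using assms by (intro Bochner_Integration.integral_diff integrable_slope) auto
  finally show ?thesis .
qed

lemma slope_strict_antimono:
  assumes "0 < q" "q < q'" "q' \<le> 1"
  shows "slope q' < slope q"
proof -
  have "0 < measure_pmf.prob X {2..} * (q' - q)" using assms prob_ge_2_pos by simp
  also have "\<dots> \<le> slope q - slope q'" using slope_decrease[of q q'] assms by simp
  finally show ?thesis by simp
qed

lemma slope_inj: "0 < q \<Longrightarrow> q \<le> 1 \<Longrightarrow> 0 < q' \<Longrightarrow> q' \<le> 1 \<Longrightarrow> slope q = slope q' \<Longrightarrow> q = q'"
  using slope_strict_antimono by (metis less_irrefl linorder_neqE)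

lemma slope_1: "slope 1 = 1"
  using survive_eq_slope[of 1] survive_1 by simp

lemma survive_iter_bounds:
  assumes "0 \<le> p" "p \<le> 1"
  shows "0 \<le> survive_iter n p \<and> survive_iter n p \<le> 1"
proof (induction n)
  case (Suc n)
  then have "0 \<le> p * survive_iter n p" "p * survive_iter n p \<le> 1" using assms by (auto intro: mult_le_one)
  from survive_bounds[OF this] show ?case by simp
qed simp

lemma survive_iter_Suc_le:
  assumes "0 \<le> p" "p \<le> 1"
  shows "survive_iter (Suc n) p \<le> survive_iter n p"
proof (induction n)
  case 0
  then show ?case using survive_iter_bounds[OF assms, of "Suc 0"] by simp
next
  case (Suc n)
  have "survive (p * survive_iter (Suc n) p) \<le> survive (p * survive_iter n p)"
    using assms survive_iter_bounds[OF assms] Suc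
    by (intro survive_mono mult_left_mono mult_nonneg_nonneg mult_le_one)
      (simp_all del: survive_iter.simps)
  then show ?case by simp
qed

lemma survive_iter_tendsto:
  assumes "0 \<le> p" "p \<le> 1"
  shows "(\<lambda>n. survive_iter n p) \<longlonglongrightarrow> survival p"
proof -
  have "decseq (\<lambda>n. survive_iter n p)" using survive_iter_Suc_le[OF assms] by (rule decseq_SucI)
  then obtain L where "(\<lambda>n. survive_iter n p) \<longlonglongrightarrow> L"
    using decseq_convergent[of "\<lambda>n. survive_iter n p" 0] survive_iter_bounds[OF assms] by metis
  then show ?thesis unfolding survival_def using limI by metis
qed

lemma survival_bounds:
  assumes "0 \<le> p" "p \<le> 1"
  shows "0 \<le> survival p" "survival p \<le> 1"
  using LIMSEQ_le_const[OF survive_iter_tendsto[OF assms], of 0]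
    LIMSEQ_le_const2[OF survive_iter_tendsto[OF assms], of 1] survive_iter_bounds[OF assms] by auto

lemma survive_tendsto:
  assumes "\<And>n. 0 \<le> q n \<and> q n \<le> 1" "q \<longlonglongrightarrow> l"
  shows "(\<lambda>n. survive (q n)) \<longlonglongrightarrow> survive l"
  unfolding survive_def
proof (intro tendsto_diff tendsto_const integral_dominated_convergence[where w="\<lambda>_. 1"])
  show "AE x in measure_pmf X. (\<lambda>i. (1 - q i) ^ x) \<longlonglongrightarrow> (1 - l) ^ x"
    by (intro AE_I2 tendsto_intros assms(2))
  show "AE x in measure_pmf X. norm ((1 - q i) ^ x) \<le> 1" for i
    using assms(1) by (auto simp: power_le_one)
qed auto

lemma survival_fixpoint:
  assumes "0 \<le> p" "p \<le> 1"
  shows "survival p = survive (survival_hat p)"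
proof (rule LIMSEQ_unique)
  show "(\<lambda>n. survive_iter (Suc n) p) \<longlonglongrightarrow> survival p"
    using survive_iter_tendsto[OF assms] by (rule LIMSEQ_Suc)
  show "(\<lambda>n. survive_iter (Suc n) p) \<longlonglongrightarrow> survive (survival_hat p)"
    unfolding survival_hat_def survive_iter.simps
    using assms survive_iter_bounds[OF assms] survive_iter_tendsto[OF assms]
    by (intro survive_tendsto tendsto_intros) (auto simp: mult_le_one)
qed

lemma survival_hat_bounds:
  assumes "0 \<le> p" "p \<le> 1"
  shows "0 \<le> survival_hat p" "survival_hat p \<le> 1" "survival_hat p \<le> p"
  using survival_bounds[OF assms] assms
  by (auto simp: survival_hat_def mult_le_one mult_left_le)

lemma survive_iter_mono:
  assumes "0 \<le> p" "p \<le> p'" "p' \<le> 1"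
  shows "survive_iter n p \<le> survive_iter n p'"
proof (induction n)
  case (Suc n)
  then show ?case using assms survive_iter_bounds[of p n] survive_iter_bounds[of p' n]
    by (auto intro!: survive_mono mult_mono mult_le_one)
qed simp

lemma survival_hat_mono:
  assumes "0 \<le> p" "p \<le> p'" "p' \<le> 1"
  shows "survival_hat p \<le> survival_hat p'"
proof -
  have "survival p \<le> survival p'"
    using assms survive_iter_mono[OF assms]
    by (intro LIMSEQ_le[OF survive_iter_tendsto survive_iter_tendsto]) auto
  then show ?thesis using assms survival_bounds[of p] by (auto simp: survival_hat_def intro!: mult_mono)
qed

text \<open>For positive q the fixed point equation reads q = p * q * \<open>slope q\<close>, and q
  cancels. So p can be read off from q.\<close>

lemma survival_hat_eq_imp:
  assumes "0 \<le> p" "p \<le> 1" "0 < survival_hat p"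
  shows "p = 1 / slope (survival_hat p)"
proof -
  let ?q = "survival_hat p"
  have "?q = p * (?q * slope ?q)"
    using survival_fixpoint[OF assms(1,2)] survive_eq_slope[OF assms(3) survival_hat_bounds(2)[OF assms(1,2)]]
    by (simp add: survival_hat_def)
  then have "1 = p * slope ?q" using assms(3) by simp
  then show ?thesis by (metis mult_zero_right nonzero_eq_divide_eq zero_neq_one)
qed

lemma inverse_slope_bounds:
  assumes "0 < q" "q \<le> 1"
  shows "0 < 1 / slope q" "1 / slope q \<le> 1"
  using slope_ge_1[OF assms] by auto

lemma inverse_slope_strict_mono:
  "0 < q \<Longrightarrow> q < q' \<Longrightarrow> q' \<le> 1 \<Longrightarrow> 1 / slope q < 1 / slope q'"
  using slope_strict_antimono[of q q'] slope_ge_1[of q'] by (simp add: frac_less2)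

text \<open>Survival is the largest fixed point, so the solution \<open>q\<close> of \<open>q = p * survive q\<close> is attained.\<close>

lemma survival_hat_inverse_slope:
  assumes "0 < q" "q \<le> 1"
  shows "survival_hat (1 / slope q) = q"
proof -
  let ?p = "1 / slope q"
  note p = inverse_slope_bounds[OF assms]
  \<comment> \<open>The iteration is monotone and starts at 1, so no iterate falls below a fixed
    point.\<close>
  have "survive q \<le> survive_iter n ?p" for n
  proof (induction n)
    case 0
    then show ?case using survive_bounds assms by simp
  next
    case (Suc n)
    have "q = ?p * survive q" using survive_eq_slope[OF assms] p by (simp add: field_simps)
    also have "\<dots> \<le> ?p * survive_iter n ?p" using Suc p by (intro mult_left_mono) auto
    finally have "survive q \<le> survive (?p * survive_iter n ?p)"
      using assms p survive_iter_bounds[of ?p n] by (intro survive_mono) (auto intro!: mult_le_one)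
    then show ?case by simp
  qed
  then have "survive q \<le> survival ?p"
    using LIMSEQ_le_const[OF survive_iter_tendsto[of ?p]] p by auto
  then have "?p * survive q \<le> survival_hat ?p" using p by (simp add: survival_hat_def divide_right_mono)
  moreover have "?p * survive q = q" using survive_eq_slope[OF assms] p by (simp add: field_simps)
  ultimately have q: "q \<le> survival_hat ?p" by simp
  then have "?p = 1 / slope (survival_hat ?p)"
    using assms p by (intro survival_hat_eq_imp) auto
  then have "slope q = slope (survival_hat ?p)" by simp
  then show ?thesis
    using slope_inj[of q "survival_hat ?p"] q assms survival_hat_bounds(2)[of ?p] p by auto
qed

lemma survival_hat_1: "survival_hat 1 = 1"
  using survival_hat_inverse_slope[of 1] slope_1 by simp

text \<open>Since p and p' are reciprocals of slopes, the slopes differ by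
  \<open>slope q * slope q' * (p' - p)\<close>, while \<open>slope_decrease\<close> bounds this
  difference below by P(X >= 2) times the increment of q. The larger slope, at the lower end point,
  gives the constant.\<close>

lemma survival_hat_Lipschitz:
  assumes "0 < q" "q \<le> 1" "p = 1 / slope q" "p \<le> p'" "p' \<le> 1"
  shows "survival_hat p' - survival_hat p \<le> (slope q)\<^sup>2 / measure_pmf.prob X {2..} * (p' - p)"
proof -
  define q' where "q' = survival_hat p'"
  note p = inverse_slope_bounds[OF assms(1,2)]
  have p0: "0 < p" using p assms by simp
  have qp: "survival_hat p = q" using survival_hat_inverse_slope[OF assms(1,2)] assms(3) by simp
  have q': "q \<le> q'" "q' \<le> 1"
    using survival_hat_mono[of p p'] survival_hat_bounds(2)[of p'] p0 assms qp by (auto simp: q'_def)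
  have p': "p' = 1 / slope q'"
    unfolding q'_def using assms(1,4,5) p0 q' by (intro survival_hat_eq_imp) (auto simp: q'_def)
  have s: "1 \<le> slope q" "1 \<le> slope q'" using slope_ge_1 assms q' by auto
  have "slope q' \<le> slope q"
    using slope_strict_antimono[of q q'] assms q' by (cases "q = q'") auto
  have "measure_pmf.prob X {2..} * (q' - q) \<le> slope q - slope q'"
    using slope_decrease assms(1) q' by simp
  also have "\<dots> = slope q * slope q' * (p' - p)"
  proof -
    have 1: "p * slope q = 1" "p' * slope q' = 1" using s assms(3) p' by simp_all
    have "slope q * slope q' * (p' - p) = slope q * (p' * slope q') - slope q' * (p * slope q)"
      by (simp add: algebra_simps)
    then show ?thesis unfolding 1 by simp
  qed
  also have "\<dots> \<le> slope q * slope q * (p' - p)"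
    using s \<open>slope q' \<le> slope q\<close> assms(4) by (intro mult_right_mono mult_left_mono) auto
  finally show ?thesis using prob_ge_2_pos qp
    by (simp add: field_simps power2_eq_square flip: q'_def)
qed

end

subsection \<open>Abelian asymptotics of tilted moments\<close>

definition gam :: "real \<Rightarrow> real \<Rightarrow> real" where
  "gam b s = (if 0 < s then s powr (b - 1) * exp (- s) else 0)"

lemma gam_nonneg: "0 \<le> gam b s"
  by (simp add: gam_def)

lemma borel_measurable_gam [measurable]: "gam b \<in> borel_measurable borel"
  unfolding gam_def by measurable

lemma has_bochner_integral_gam:
  assumes "0 < b"
  shows "has_bochner_integral lborel (gam b) (Gamma b)"
proof (rule has_bochner_integral_nn_integral)
  have "ennreal (Gamma b) = (\<integral>\<^sup>+ t. ennreal (indicator {0..} t * t powr (b - 1) / exp t) \<partial>lborel)"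
    using Gamma_conv_nn_integral_real[OF assms] .
  also have "\<dots> = (\<integral>\<^sup>+ t. ennreal (gam b t) \<partial>lborel)"
  proof (rule nn_integral_cong_AE)
    have "AE t in lborel. t \<noteq> (0::real)" by (rule AE_lborel_singleton)
    then show "AE t in lborel. ennreal (indicator {0..} t * t powr (b - 1) / exp t) = ennreal (gam b t)"
      by eventually_elim (auto simp: gam_def indicator_def exp_minus field_simps)
  qed
  finally show "(\<integral>\<^sup>+ t. ennreal (gam b t) \<partial>lborel) = ennreal (Gamma b)" by simp
  show "0 \<le> Gamma b" using Gamma_real_pos[OF assms] by simp
qed (auto simp: gam_nonneg)

lemma integrable_gam: "0 < b \<Longrightarrow> integrable lborel (gam b)"
  using has_bochner_integral_gam has_bochner_integral_iff by blast

lemma integral_gam: "0 < b \<Longrightarrow> integral\<^sup>L lborel (gam b) = Gamma b"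
  using has_bochner_integral_gam has_bochner_integral_iff by blast

text \<open>Derivative of \<open>s ^ j * exp (- s)\<close>. For j >= 1 this function vanishes at 0,
  so it is recovered by integrating \<open>dgam\<close> from 0; this turns moments into integrals of
  tail probabilities.\<close>

definition dgam :: "nat \<Rightarrow> real \<Rightarrow> real" where
  "dgam j s = (real j * s ^ (j - 1) - s ^ j) * exp (- s)"

lemma borel_measurable_dgam [measurable]: "dgam j \<in> borel_measurable borel"
  unfolding dgam_def by measurable

lemma DERIV_power_exp: "((\<lambda>s. s ^ j * exp (- s)) has_real_derivative dgam j s) (at s)"
  unfolding dgam_def by (auto intro!: derivative_eq_intros simp: algebra_simps)

lemma power_mult_powr:
  assumes "0 < (s::real)"
  shows "s ^ j * s powr e = s powr (real j + e)"
  using assms by (simp add: powr_add powr_realpow)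

lemma dgam_mult_powr:
  assumes "1 \<le> j" "0 < s"
  shows "dgam j s * s powr e = real j * gam (real j + e) s - gam (real j + e + 1) s"
proof -
  have "s ^ (j - 1) * s powr e = s powr (real j + e - 1)"
    using power_mult_powr[OF assms(2), of "j - 1" e] assms(1) by (simp add: of_nat_diff algebra_simps)
  moreover have "s ^ j * s powr e = s powr (real j + e)" using power_mult_powr[OF assms(2)] .
  ultimately show ?thesis using assms(2) by (simp add: dgam_def gam_def algebra_simps)
qed

lemma abs_dgam_mult_powr_le:
  assumes "1 \<le> j" "0 < s"
  shows "\<bar>dgam j s\<bar> * s powr e \<le> real j * gam (real j + e) s + gam (real j + e + 1) s"
proof -
  have "\<bar>dgam j s\<bar> * s powr e = \<bar>dgam j s * s powr e\<bar>" by (simp add: abs_mult)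
  then show ?thesis unfolding dgam_mult_powr[OF assms]
    using gam_nonneg[of "real j + e" s] gam_nonneg[of "real j + e + 1" s] by (simp add: abs_le_iff)
qed

lemma integrable_dgam_bound:
  assumes "0 < real j + e"
  shows "integrable lborel (\<lambda>s. real j * gam (real j + e) s + gam (real j + e + 1) s)"
  using assms by (intro Bochner_Integration.integrable_add integrable_mult_right integrable_gam) auto

lemma integrable_abs_dgam:
  assumes "1 \<le> j"
  shows "integrable lborel (\<lambda>s. if 0 < s then \<bar>dgam j s\<bar> else 0)"
proof (rule Bochner_Integration.integrable_bound[OF integrable_dgam_bound[of j 0]])
  show "AE s in lborel. norm (if 0 < s then \<bar>dgam j s\<bar> else 0) \<le> norm (real j * gam (real j + 0) s + gam (real j + 0 + 1) s)"
  proof (rule AE_I2)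
    fix s :: real
    show "norm (if 0 < s then \<bar>dgam j s\<bar> else 0) \<le> norm (real j * gam (real j + 0) s + gam (real j + 0 + 1) s)"
      using abs_dgam_mult_powr_le[OF assms, of s 0] gam_nonneg[of "real j" s] gam_nonneg[of "real j + 1" s]
      by (cases "0 < s") auto
  qed
qed (use assms in auto)

lemma integral_dgam_interval:
  assumes "1 \<le> j" "0 \<le> y"
  shows "(\<integral>s. (if 0 < s \<and> s < y then dgam j s else 0) \<partial>lborel) = y ^ j * exp (- y)"
proof -
  have "(\<integral>s. (if 0 < s \<and> s < y then dgam j s else 0) \<partial>lborel) = (\<integral>s. dgam j s * indicator {0..y} s \<partial>lborel)"
  proof (rule integral_cong_AE)
    have "AE s in lborel. s \<noteq> (0::real)" "AE s in lborel. s \<noteq> y" by (rule AE_lborel_singleton)+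
    then show "AE s in lborel. (if 0 < s \<and> s < y then dgam j s else 0) = dgam j s * indicator {0..y} s"
      by eventually_elim (auto simp: indicator_def)
  qed measurable
  also have "\<dots> = y ^ j * exp (- y) - 0 ^ j * exp (- 0)"
  proof (rule integral_FTC_Icc_real[OF assms(2) DERIV_power_exp])
    show "isCont (dgam j) x" for x unfolding dgam_def by (auto intro!: continuous_intros)
  qed
  finally show ?thesis using assms(1) by (simp add: zero_power)
qed

text \<open>A layer-cake formula by Fubini, justified by the absolute integrability of
  \<open>dgam j\<close> on the positive half-line. The set \<open>B\<close> allows for truncated
  moments.\<close>

lemma expectation_power_exp:
  assumes "1 \<le> j" "0 < a"
  shows "measure_pmf.expectation X (\<lambda>n. (a * real n) ^ j * exp (- (a * real n)) * indicator B n) =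
    (\<integral>s. (if 0 < s then dgam j s * measure_pmf.prob X {n. s < a * real n \<and> n \<in> B} else 0) \<partial>lborel)"
proof -
  let ?f = "\<lambda>n s. if 0 < s \<and> s < a * real n \<and> n \<in> B then dgam j s else 0"
  interpret pair_sigma_finite "measure_pmf X" lborel ..
  note int = integrable_abs_dgam[OF assms(1)]
  have bound: "norm (?f n s) \<le> (if 0 < s then \<bar>dgam j s\<bar> else 0)" for n s by auto
  have int1: "integrable lborel (?f n)" for n
    by (rule Bochner_Integration.integrable_bound[OF int]) (use bound in auto)
  have [measurable]: "Measurable.pred (measure_pmf X \<Otimes>\<^sub>M borel) (\<lambda>x. fst x \<in> B)"
    by (rule measurable_compose[OF measurable_fst]) simp
  have "integrable (measure_pmf X \<Otimes>\<^sub>M lborel) (case_prod ?f)"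
  proof (rule Fubini_integrable)
    show "integrable (measure_pmf X) (\<lambda>n. \<integral>s. norm (case (n, s) of (n, s) \<Rightarrow> ?f n s) \<partial>lborel)"
    proof (rule measure_pmf.integrable_const_bound[where B="\<integral>s. (if 0 < s then \<bar>dgam j s\<bar> else 0) \<partial>lborel"])
      show "AE n in measure_pmf X. norm (\<integral>s. norm (case (n, s) of (n, s) \<Rightarrow> ?f n s) \<partial>lborel)
         \<le> (\<integral>s. (if 0 < s then \<bar>dgam j s\<bar> else 0) \<partial>lborel)"
      proof (rule AE_I2)
        fix n
        have "(\<integral>s. norm (?f n s) \<partial>lborel) \<le> (\<integral>s. (if 0 < s then \<bar>dgam j s\<bar> else 0) \<partial>lborel)"
          by (rule integral_mono[OF integrable_norm[OF int1] int bound])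
        then show "norm (\<integral>s. norm (case (n, s) of (n, s) \<Rightarrow> ?f n s) \<partial>lborel)
         \<le> (\<integral>s. (if 0 < s then \<bar>dgam j s\<bar> else 0) \<partial>lborel)"
          by (simp add: integral_nonneg_AE)
      qed
    qed simp
    show "AE n in measure_pmf X. integrable lborel (\<lambda>s. case (n, s) of (n, s) \<Rightarrow> ?f n s)"
      using int1 by simp
  qed measurable
  from Fubini_integral[OF this]
  have "(\<integral>s. measure_pmf.expectation X (\<lambda>n. ?f n s) \<partial>lborel) =
    measure_pmf.expectation X (\<lambda>n. \<integral>s. ?f n s \<partial>lborel)" .
  moreover have "measure_pmf.expectation X (\<lambda>n. ?f n s) =
    (if 0 < s then dgam j s * measure_pmf.prob X {n. s < a * real n \<and> n \<in> B} else 0)" for s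
  proof (cases "0 < s")
    case True
    then have "(\<lambda>n. ?f n s) = (\<lambda>n. dgam j s * indicator {n. s < a * real n \<and> n \<in> B} n)"
      by (auto simp: fun_eq_iff)
    then show ?thesis using True by simp
  qed simp
  moreover have "(\<integral>s. ?f n s \<partial>lborel) = (a * real n) ^ j * exp (- (a * real n)) * indicator B n" for n
    using integral_dgam_interval[OF assms(1), of "a * real n"] assms(2) by (cases "n \<in> B") auto
  ultimately show ?thesis by simp
qed

section \<open>Asymptotics of exponentially tilted moments under a regularly varying tail\<close>

locale heavy_tail =
  fixes X :: "nat pmf" and \<alpha> c :: real
  assumes alpha_pos: "0 < \<alpha>" and c_pos: "0 < c"
    and tail: "((\<lambda>x::real. measure_pmf.prob X {n. real n > x} / (c * x powr (- \<alpha>))) \<longlongrightarrow> 1) at_top"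
begin

definition tail_prob :: "real \<Rightarrow> real" where
  "tail_prob x = measure_pmf.prob X {n. real n > x}"

lemma tail_prob_bounds: "0 \<le> tail_prob x" "tail_prob x \<le> 1"
  by (simp_all add: tail_prob_def)

lemma borel_measurable_tail_prob [measurable]: "tail_prob \<in> borel_measurable borel"
proof -
  have "mono (\<lambda>x. - tail_prob x)"
    unfolding tail_prob_def by (intro monoI le_imp_neg_le measure_pmf.finite_measure_mono) auto
  then have "(\<lambda>x. - (- tail_prob x)) \<in> borel_measurable borel"
    by (intro borel_measurable_uminus borel_measurable_mono)
  then show ?thesis by simp
qed

lemma tail_prob_bound: "\<exists>C>0. \<forall>x>0. tail_prob x \<le> C * x powr (- \<alpha>)"
proof -
  have "eventually (\<lambda>x. tail_prob x / (c * x powr (- \<alpha>)) < 2) at_top"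
    using order_tendstoD(2)[OF tail, of 2] by (simp add: tail_prob_def)
  then obtain x0 where x0: "\<And>x. x \<ge> x0 \<Longrightarrow> tail_prob x / (c * x powr (- \<alpha>)) < 2"
    by (auto simp: eventually_at_top_linorder)
  define x1 where "x1 = max x0 1"
  \<comment> \<open>The first entry covers large x, where the ratio in the tail assumption is below
    2; the second makes the bound at least 1 for x < \<open>x1\<close>.\<close>
  define C where "C = max (2 * c) (x1 powr \<alpha>)"
  have "tail_prob x \<le> C * x powr (- \<alpha>)" if "x > 0" for x
  proof (cases "x \<ge> x1")
    case True
    have "0 < c * x powr (- \<alpha>)" using that c_pos by simp
    then have "tail_prob x \<le> 2 * c * x powr (- \<alpha>)" using x0[of x] True by (simp add: x1_def field_simps)
    also have "\<dots> \<le> C * x powr (- \<alpha>)" by (intro mult_right_mono) (auto simp: C_def)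
    finally show ?thesis .
  next
    case False
    have "1 = x powr \<alpha> * x powr (- \<alpha>)" using that by (simp flip: powr_add)
    also have "\<dots> \<le> C * x powr (- \<alpha>)"
      using False that alpha_pos by (intro mult_right_mono) (auto simp: C_def le_max_iff_disj intro!: powr_mono2)
    finally show ?thesis using tail_prob_bounds(2)[of x] by simp
  qed
  moreover have "C > 0" using c_pos by (auto simp: C_def)
  ultimately show ?thesis by blast
qed

text \<open>The point \<open>s i\<close> may vary because the truncation point of
  \<open>truncated_moment_tendsto\<close> does.\<close>

lemma tail_prob_scaling:
  assumes a: "\<And>i. 0 < a i" "a \<longlonglongrightarrow> 0" and s: "s \<longlonglongrightarrow> l" "0 < l"
  shows "(\<lambda>i. a i powr (- \<alpha>) * tail_prob (s i / a i)) \<longlonglongrightarrow> c * l powr (- \<alpha>)"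
proof -
  have "filterlim a (at_right 0) sequentially"
    unfolding filterlim_at using a by (simp add: order_less_imp_not_eq2)
  then have lim: "filterlim (\<lambda>i. s i / a i) at_top sequentially"
    unfolding divide_inverse
    by (intro filterlim_tendsto_pos_mult_at_top[OF s] filterlim_compose[OF filterlim_inverse_at_top_right])
  have "(\<lambda>i. tail_prob (s i / a i) / (c * (s i / a i) powr (- \<alpha>)) * (c * s i powr (- \<alpha>))) \<longlonglongrightarrow> 1 * (c * l powr (- \<alpha>))"
    using s by (intro tendsto_mult filterlim_compose[OF tail[folded tail_prob_def] lim] tendsto_intros) auto
  moreover have "eventually (\<lambda>i. tail_prob (s i / a i) / (c * (s i / a i) powr (- \<alpha>)) * (c * s i powr (- \<alpha>)) =
     a i powr (- \<alpha>) * tail_prob (s i / a i)) sequentially"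
    using order_tendstoD(1)[OF s(1) s(2)]
  proof eventually_elim
    case (elim i)
    have "(s i / a i) powr (- \<alpha>) = s i powr (- \<alpha>) / a i powr (- \<alpha>)"
      using elim a(1)[of i] by (simp add: powr_divide)
    then show ?case using c_pos elim a(1)[of i] by simp
  qed
  ultimately show ?thesis using tendsto_cong by fastforce
qed

context
  fixes j :: nat and a :: "nat \<Rightarrow> real"
  assumes j: "1 \<le> j" "\<alpha> < real j" and a: "\<And>i. 0 < a i" "a \<longlonglongrightarrow> 0"
begin

text \<open>The scaled tail in the layer-cake formula converges to
  \<open>c * s powr (- \<alpha>)\<close>. The global tail bound dominates, and the dominating
  function is integrable near 0 because \<open>\<alpha> < real j\<close>. With b = j - \<alpha>, the
  limit c * (j * Gamma(b) - Gamma(b + 1)) simplifies by Gamma(b + 1) = b * Gamma(b).\<close>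

lemma full_moment_tendsto:
  "(\<lambda>i. a i powr (- \<alpha>) * measure_pmf.expectation X (\<lambda>n. (a i * real n) ^ j * exp (- (a i * real n))))
    \<longlonglongrightarrow> c * \<alpha> * Gamma (real j - \<alpha>)"
proof -
  obtain C where C: "0 < C" "\<And>x. 0 < x \<Longrightarrow> tail_prob x \<le> C * x powr (- \<alpha>)" using tail_prob_bound by blast
  let ?h = "\<lambda>i s. if 0 < s then dgam j s * (a i powr (- \<alpha>) * tail_prob (s / a i)) else 0"
  let ?w = "\<lambda>s. C * (real j * gam (real j + (- \<alpha>)) s + gam (real j + (- \<alpha>) + 1) s)"
  have eq: "a i powr (- \<alpha>) * measure_pmf.expectation X (\<lambda>n. (a i * real n) ^ j * exp (- (a i * real n))) =
    (\<integral>s. ?h i s \<partial>lborel)" for i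
  proof -
    have "{n. s < a i * real n \<and> n \<in> UNIV} = {n. real n > s / a i}" for s
      using a(1)[of i] by (auto simp: field_simps)
    then have P: "measure_pmf.prob X {n. s < a i * real n \<and> n \<in> UNIV} = tail_prob (s / a i)" for s
      unfolding tail_prob_def by simp
    have "measure_pmf.expectation X (\<lambda>n. (a i * real n) ^ j * exp (- (a i * real n))) =
      measure_pmf.expectation X (\<lambda>n. (a i * real n) ^ j * exp (- (a i * real n)) * indicator UNIV n)"
      by simp
    then show ?thesis
      unfolding expectation_power_exp[OF j(1) a(1)] P
      by (simp only: flip: integral_mult_right_zero)
         (rule Bochner_Integration.integral_cong, auto simp: algebra_simps)
  qed
  have "(\<lambda>i. \<integral>s. ?h i s \<partial>lborel) \<longlonglongrightarrow> (\<integral>s. (if 0 < s then dgam j s * (c * s powr (- \<alpha>)) else 0) \<partial>lborel)"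
  proof (rule integral_dominated_convergence[where w="?w"])
    show "integrable lborel ?w" using j by (intro integrable_mult_right integrable_dgam_bound) auto
    show "AE s in lborel. (\<lambda>i. ?h i s) \<longlonglongrightarrow> (if 0 < s then dgam j s * (c * s powr (- \<alpha>)) else 0)"
    proof (rule AE_I2)
      fix s :: real
      show "(\<lambda>i. ?h i s) \<longlonglongrightarrow> (if 0 < s then dgam j s * (c * s powr (- \<alpha>)) else 0)"
        using tail_prob_scaling[OF a, of "\<lambda>_. s" s] by (cases "0 < s") (auto intro!: tendsto_intros)
    qed
    show "AE s in lborel. norm (?h i s) \<le> ?w s" for i
    proof (rule AE_I2)
      fix s :: real
      show "norm (?h i s) \<le> ?w s"
      proof (cases "0 < s")
        case True
        have "a i powr (- \<alpha>) * tail_prob (s / a i) \<le> a i powr (- \<alpha>) * (C * (s / a i) powr (- \<alpha>))"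
          using C(2) a(1)[of i] True by (intro mult_left_mono) auto
        also have "\<dots> = C * s powr (- \<alpha>)" using a(1)[of i] True by (simp add: powr_divide)
        finally have "\<bar>dgam j s\<bar> * (a i powr (- \<alpha>) * tail_prob (s / a i)) \<le> \<bar>dgam j s\<bar> * (C * s powr (- \<alpha>))"
          by (rule mult_left_mono) simp
        also have "\<dots> = C * (\<bar>dgam j s\<bar> * s powr (- \<alpha>))" by simp
        also have "\<dots> \<le> ?w s" using abs_dgam_mult_powr_le[OF j(1) True, of "- \<alpha>"] C(1) by (intro mult_left_mono) auto
        finally show ?thesis using True tail_prob_bounds(1)[of "s / a i"] by (simp add: abs_mult)
      next
        case False
        then show ?thesis by (simp add: gam_def)
      qed
    qed
  qed measurable
  moreover have "(\<integral>s. (if 0 < s then dgam j s * (c * s powr (- \<alpha>)) else 0) \<partial>lborel) =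
    (\<integral>s. c * (real j * gam (real j + (- \<alpha>)) s - gam (real j + (- \<alpha>) + 1) s) \<partial>lborel)"
  proof (rule Bochner_Integration.integral_cong)
    fix s :: real
    have "dgam j s * (c * s powr (- \<alpha>)) = c * (dgam j s * s powr (- \<alpha>))" by simp
    then show "(if 0 < s then dgam j s * (c * s powr (- \<alpha>)) else 0) =
      c * (real j * gam (real j + (- \<alpha>)) s - gam (real j + (- \<alpha>) + 1) s)"
      using dgam_mult_powr[OF j(1), of s "- \<alpha>"] by (simp add: gam_def)
  qed simp
  moreover have "\<dots> = c * (real j * Gamma (real j - \<alpha>) - Gamma (real j - \<alpha> + 1))"
    using j integrable_gam[of "real j - \<alpha>"] integrable_gam[of "real j - \<alpha> + 1"]
    by (simp add: integral_gam)
  moreover have "\<dots> = c * \<alpha> * Gamma (real j - \<alpha>)"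
  proof -
    have "real j - \<alpha> \<notin> \<int>\<^sub>\<le>\<^sub>0" using j by (auto elim!: nonpos_Ints_cases)
    then show ?thesis by (subst Gamma_plus1) (simp_all add: left_diff_distrib)
  qed
  ultimately show ?thesis unfolding eq by (simp only:)
qed

text \<open>Integration by parts: differentiating \<open>s powr (- \<alpha>)\<close> against
  \<open>s ^ j * exp (- s)\<close> produces the Gamma kernel with shape j - \<alpha>. Subtracting
  the value at \<open>z\<close> removes the boundary term there.\<close>

lemma integral_dgam_tail_difference:
  assumes "0 < z"
  shows "(\<integral>s. (if 0 < s \<and> s < z then dgam j s * (c * s powr (- \<alpha>) - c * z powr (- \<alpha>)) else 0) \<partial>lborel)
    = c * \<alpha> * (\<integral>s. indicator {..z} s * gam (real j - \<alpha>) s \<partial>lborel)"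
proof -
  let ?b = "real j - \<alpha>"
  let ?L = "\<lambda>s. if 0 < s \<and> s < z then dgam j s * (c * s powr (- \<alpha>) - c * z powr (- \<alpha>)) else 0"
  let ?R = "\<lambda>s. if s < z then c * \<alpha> * gam ?b s else 0"
  \<comment> \<open>A primitive of the difference of the two integrands. It vanishes at 0 because
    both exponents are positive, and at \<open>z\<close> by cancellation.\<close>
  let ?H = "\<lambda>s. c * (s powr ?b * exp (- s)) - c * z powr (- \<alpha>) * (s ^ j * exp (- s))"
  let ?H' = "\<lambda>s. dgam j s * (c * s powr (- \<alpha>) - c * z powr (- \<alpha>)) - c * \<alpha> * gam ?b s"
  have intR: "integrable lborel ?R"
    by (rule Bochner_Integration.integrable_bound[OF integrable_mult_right[OF integrable_gam[of ?b], of "c * \<alpha>"]])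
       (use j in auto)
  have intL: "integrable lborel ?L"
  proof (rule Bochner_Integration.integrable_bound)
    show "integrable lborel (\<lambda>s. c * (real j * gam (real j + (- \<alpha>)) s + gam (real j + (- \<alpha>) + 1) s)
      + c * z powr (- \<alpha>) * (real j * gam (real j + 0) s + gam (real j + 0 + 1) s))"
      using j by (intro Bochner_Integration.integrable_add integrable_mult_right integrable_gam) auto
    show "AE s in lborel. norm (?L s) \<le> norm (c * (real j * gam (real j + (- \<alpha>)) s + gam (real j + (- \<alpha>) + 1) s)
      + c * z powr (- \<alpha>) * (real j * gam (real j + 0) s + gam (real j + 0 + 1) s))" (is "AE s in lborel. _ \<le> norm (?W s)")
    proof (rule AE_I2)
      fix s :: real
      have W: "0 \<le> ?W s" using c_pos by (intro add_nonneg_nonneg mult_nonneg_nonneg gam_nonneg) auto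
      show "norm (?L s) \<le> norm (?W s)"
      proof (cases "0 < s \<and> s < z")
        case True
        have "\<bar>c * s powr (- \<alpha>) - c * z powr (- \<alpha>)\<bar> \<le> c * s powr (- \<alpha>) + c * z powr (- \<alpha>) * s powr 0"
          using c_pos True by (simp add: abs_le_iff)
        then have "\<bar>dgam j s\<bar> * \<bar>c * s powr (- \<alpha>) - c * z powr (- \<alpha>)\<bar> \<le>
          \<bar>dgam j s\<bar> * (c * s powr (- \<alpha>) + c * z powr (- \<alpha>) * s powr 0)" by (rule mult_left_mono) simp
        also have "\<dots> = c * (\<bar>dgam j s\<bar> * s powr (- \<alpha>)) + c * z powr (- \<alpha>) * (\<bar>dgam j s\<bar> * s powr 0)"
          by (simp add: algebra_simps)
        also have "\<dots> \<le> ?W s"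
          using c_pos True abs_dgam_mult_powr_le[OF j(1), of s "- \<alpha>"] abs_dgam_mult_powr_le[OF j(1), of s 0]
          by (intro add_mono mult_left_mono) auto
        finally show ?thesis using True W by (simp add: abs_mult)
      qed (use W in auto)
    qed
  qed measurable
  have "(?H' has_integral (?H z - ?H 0)) {0..z}"
  \<comment> \<open>The interior version is used since \<open>s powr ?b\<close> need not be
    differentiable at 0.\<close>
  proof (rule fundamental_theorem_of_calculus_interior)
    show "continuous_on {0..z} ?H"
      using j by (intro continuous_intros continuous_on_powr') auto
    fix x assume x: "x \<in> {0<..<z}"
    have "((\<lambda>s. s powr ?b) has_real_derivative ?b * x powr (?b - 1)) (at x)"
      using x by (auto intro!: derivative_eq_intros)
    then have d1: "((\<lambda>s. s powr ?b) has_real_derivative ?b * x powr (?b - 1)) (at x)" .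
    have d2: "((\<lambda>s. exp (- s)) has_real_derivative - exp (- x)) (at x)"
      by (auto intro!: derivative_eq_intros)
    note d = DERIV_diff[OF DERIV_cmult[OF DERIV_mult[OF d1 d2], of c]
        DERIV_cmult[OF DERIV_power_exp[of j x], of "c * z powr (- \<alpha>)"]]
    have "(?H has_real_derivative ?H' x) (at x)"
    proof (rule DERIV_cong[OF d])
      have "dgam j x * x powr (- \<alpha>) = real j * (x powr (?b - 1) * exp (- x)) - x powr ?b * exp (- x)"
        using dgam_mult_powr[OF j(1), of x "- \<alpha>"] x by (simp add: gam_def)
      then have "dgam j x * (c * x powr (- \<alpha>) - c * z powr (- \<alpha>)) =
        c * (real j * (x powr (?b - 1) * exp (- x)) - x powr ?b * exp (- x)) - c * z powr (- \<alpha>) * dgam j x"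
        by (simp add: right_diff_distrib mult.left_commute mult.commute)
      then show "c * (?b * x powr (?b - 1) * exp (- x) + - exp (- x) * x powr ?b) - c * z powr (- \<alpha>) * dgam j x = ?H' x"
        using x by (simp add: gam_def algebra_simps)
    qed
    then show "(?H has_vector_derivative ?H' x) (at x)"
      by (simp add: has_real_derivative_iff_has_vector_derivative)
  qed (use assms in simp)
  moreover have "?H z - ?H 0 = 0"
  proof -
    have "z powr (- \<alpha>) * z ^ j = z powr ?b" using power_mult_powr[OF assms, of j "- \<alpha>"] by (simp add: mult.commute)
    then have "c * z powr (- \<alpha>) * (z ^ j * exp (- z)) = c * (z powr ?b * exp (- z))" by (metis mult.assoc)
    moreover have "?H 0 = 0" using j by (simp add: zero_power)
    ultimately show ?thesis by linarith
  qed
  ultimately have "(?H' has_integral 0) {0<..<z}" by (simp add: has_integral_Icc_iff_Ioo)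
  then have 1: "((\<lambda>s. if s \<in> {0<..<z} then ?H' s else 0) has_integral 0) UNIV"
    by (simp only: has_integral_restrict_UNIV)
  have 2: "(\<lambda>s. if s \<in> {0<..<z} then ?H' s else 0) = (\<lambda>s. ?L s - ?R s)"
  proof
    fix s :: real
    show "(if s \<in> {0<..<z} then ?H' s else 0) = ?L s - ?R s"
      by (cases "0 < s") (simp_all add: gam_def)
  qed
  have "((\<lambda>s. ?L s - ?R s) has_integral (integral\<^sup>L lborel (\<lambda>s. ?L s - ?R s))) UNIV"
    by (rule has_integral_integral_lborel) (rule Bochner_Integration.integrable_diff[OF intL intR])
  then have "integral\<^sup>L lborel (\<lambda>s. ?L s - ?R s) = 0"
    using 1 unfolding 2 by (rule has_integral_unique)
  then have "integral\<^sup>L lborel ?L = integral\<^sup>L lborel ?R"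
    using Bochner_Integration.integral_diff[OF intL intR] by simp
  also have "\<dots> = (\<integral>s. c * \<alpha> * (indicator {..z} s * gam ?b s) \<partial>lborel)"
  proof (rule integral_cong_AE)
    have "AE s in lborel. s \<noteq> z" by (rule AE_lborel_singleton)
    then show "AE s in lborel. ?R s = c * \<alpha> * (indicator {..z} s * gam ?b s)"
      by eventually_elim (auto simp: indicator_def)
  qed measurable
  finally show ?thesis by simp
qed

text \<open>The scheme of \<open>full_moment_tendsto\<close> with the tail replaced by the
  difference of the tails at \<open>s\<close> and at the truncation point; the first of the two
  still dominates.\<close>

lemma truncated_moment_tendsto:
  assumes z: "z \<longlonglongrightarrow> l" "0 < l"
  shows "(\<lambda>i. a i powr (- \<alpha>) * measure_pmf.expectation X
      (\<lambda>n. (a i * real n) ^ j * exp (- (a i * real n)) * indicator {n. a i * real n \<le> z i} n))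
    \<longlonglongrightarrow> c * \<alpha> * (\<integral>s. indicator {..l} s * gam (real j - \<alpha>) s \<partial>lborel)"
proof -
  obtain C where C: "0 < C" "\<And>x. 0 < x \<Longrightarrow> tail_prob x \<le> C * x powr (- \<alpha>)" using tail_prob_bound by blast
  let ?P = "\<lambda>i s. if s < z i then tail_prob (s / a i) - tail_prob (z i / a i) else 0"
  let ?h = "\<lambda>i s. if 0 < s then dgam j s * (a i powr (- \<alpha>) * ?P i s) else 0"
  let ?w = "\<lambda>s. C * (real j * gam (real j + (- \<alpha>)) s + gam (real j + (- \<alpha>) + 1) s)"
  let ?lim = "\<lambda>s. if 0 < s \<and> s < l then dgam j s * (c * s powr (- \<alpha>) - c * l powr (- \<alpha>)) else 0"
  have P: "measure_pmf.prob X {n. s < a i * real n \<and> n \<in> {n. a i * real n \<le> z i}} = ?P i s" for i s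
  proof (cases "s < z i")
    case True
    have "{n. s < a i * real n \<and> n \<in> {n. a i * real n \<le> z i}} = {n. real n > s / a i} - {n. real n > z i / a i}"
      using a(1)[of i] by (auto simp: field_simps)
    moreover have "{n. real n > z i / a i} \<subseteq> {n. real n > s / a i}"
      using True a(1)[of i] by (auto simp: field_simps)
    ultimately show ?thesis using True by (simp add: tail_prob_def measure_pmf.finite_measure_Diff)
  next
    case False
    then have "{n. s < a i * real n \<and> n \<in> {n. a i * real n \<le> z i}} = {}" by auto
    then show ?thesis using False by (simp only: measure_empty if_False)
  qed
  have P_bounds: "0 \<le> ?P i s" "?P i s \<le> tail_prob (s / a i)" for i s
  proof -
    show "0 \<le> ?P i s" unfolding P[symmetric] by simp
    show "?P i s \<le> tail_prob (s / a i)" using tail_prob_bounds(1) by auto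
  qed
  have eq: "a i powr (- \<alpha>) * measure_pmf.expectation X
      (\<lambda>n. (a i * real n) ^ j * exp (- (a i * real n)) * indicator {n. a i * real n \<le> z i} n) =
    (\<integral>s. ?h i s \<partial>lborel)" for i
    unfolding expectation_power_exp[OF j(1) a(1)] P
    by (subst integral_mult_right_zero[symmetric])
       (rule Bochner_Integration.integral_cong, auto simp: algebra_simps)
  have "(\<lambda>i. \<integral>s. ?h i s \<partial>lborel) \<longlonglongrightarrow> (\<integral>s. ?lim s \<partial>lborel)"
  proof (rule integral_dominated_convergence[where w="?w"])
    show "integrable lborel ?w" using j by (intro integrable_mult_right integrable_dgam_bound) auto
    \<comment> \<open>Away from \<open>l\<close> the comparison of \<open>s\<close> with
      \<open>z i\<close> is eventually decided.\<close>
    have "AE s in lborel. s \<noteq> l" by (rule AE_lborel_singleton)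
    then show "AE s in lborel. (\<lambda>i. ?h i s) \<longlonglongrightarrow> ?lim s"
    proof eventually_elim
      case (elim s)
      consider "s \<le> 0" | "0 < s" "s < l" | "0 < s" "l < s" using elim by linarith
      then show ?case
      proof cases
        case 2
        have "(\<lambda>i. dgam j s * (a i powr (- \<alpha>) * tail_prob (s / a i) - a i powr (- \<alpha>) * tail_prob (z i / a i)))
          \<longlonglongrightarrow> dgam j s * (c * s powr (- \<alpha>) - c * l powr (- \<alpha>))"
          using 2 z by (intro tendsto_intros tail_prob_scaling[OF a]) auto
        moreover have "eventually (\<lambda>i. dgam j s * (a i powr (- \<alpha>) * tail_prob (s / a i) - a i powr (- \<alpha>) * tail_prob (z i / a i)) = ?h i s) sequentially"
          using order_tendstoD(1)[OF z(1) 2(2)] by eventually_elim (use 2 in \<open>simp add: algebra_simps\<close>)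
        ultimately have "(\<lambda>i. ?h i s) \<longlonglongrightarrow> dgam j s * (c * s powr (- \<alpha>) - c * l powr (- \<alpha>))"
          by (rule Lim_transform_eventually)
        then show ?thesis using 2 by simp
      next
        case 3
        have "eventually (\<lambda>i. ?h i s = 0) sequentially"
          using order_tendstoD(2)[OF z(1) 3(2)] by eventually_elim simp
        then have "(\<lambda>i. ?h i s) \<longlonglongrightarrow> 0" by (rule tendsto_eventually)
        then show ?thesis using 3 by simp
      qed simp
    qed
    show "AE s in lborel. norm (?h i s) \<le> ?w s" for i
    proof (rule AE_I2)
      fix s :: real
      show "norm (?h i s) \<le> ?w s"
      proof (cases "0 < s")
        case True
        have "a i powr (- \<alpha>) * ?P i s \<le> a i powr (- \<alpha>) * (C * (s / a i) powr (- \<alpha>))"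
          using P_bounds(2)[where i=i and s=s] C(2)[of "s / a i"] a(1)[of i] True by (intro mult_left_mono) auto
        also have "\<dots> = C * s powr (- \<alpha>)" using a(1)[of i] True by (simp add: powr_divide)
        finally have "\<bar>dgam j s\<bar> * (a i powr (- \<alpha>) * ?P i s) \<le> \<bar>dgam j s\<bar> * (C * s powr (- \<alpha>))"
          by (rule mult_left_mono) simp
        also have "\<dots> = C * (\<bar>dgam j s\<bar> * s powr (- \<alpha>))" by simp
        also have "\<dots> \<le> ?w s" using abs_dgam_mult_powr_le[OF j(1) True, of "- \<alpha>"] C(1) by (intro mult_left_mono) auto
        finally have "\<bar>dgam j s\<bar> * (a i powr (- \<alpha>) * ?P i s) \<le> ?w s" .
        moreover have "norm (?h i s) = \<bar>dgam j s\<bar> * (a i powr (- \<alpha>) * ?P i s)"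
          using True P_bounds(1)[where i=i and s=s]
          by (simp only: if_True real_norm_def abs_mult abs_of_nonneg powr_ge_zero)
        ultimately show ?thesis by simp
      next
        case False
        then show ?thesis by (simp add: gam_def)
      qed
    qed
  qed measurable
  then show ?thesis unfolding eq integral_dgam_tail_difference[OF z(2)] .
qed

end

end

subsection \<open>Tilted laws\<close>

text \<open>The conditional law of the degree given the future maximum turns out to be proportional to
  \<open>n ^ j * (1 - q) ^ (n - 1) * pmf X n\<close> with \<open>j = 1\<close>, and with \<open>j = 2\<close> after size-biasing.\<close>

definition tilt :: "nat pmf \<Rightarrow> nat \<Rightarrow> real \<Rightarrow> nat set \<Rightarrow> real" where
  "tilt X j q B = measure_pmf.expectation X (\<lambda>n. real n ^ j * (1 - q) ^ (n - 1) * indicator B n)"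

definition tilt_prob :: "nat pmf \<Rightarrow> nat \<Rightarrow> real \<Rightarrow> nat set \<Rightarrow> real" where
  "tilt_prob X j q B = tilt X j q B / tilt X j q UNIV"

lemma borel_measurable_tilt [measurable]: "(\<lambda>q. tilt X j q B) \<in> borel_measurable borel"
  unfolding tilt_def by measurable

lemma borel_measurable_tilt_prob [measurable]: "(\<lambda>q. tilt_prob X j q B) \<in> borel_measurable borel"
  unfolding tilt_prob_def by measurable

lemma tilt_single: "tilt X j q {n} = real n ^ j * (1 - q) ^ (n - 1) * pmf X n"
proof -
  have "(\<lambda>m. real m ^ j * (1 - q) ^ (m - 1) * indicator {n} m) =
    (\<lambda>m. (real n ^ j * (1 - q) ^ (n - 1)) * indicator {n} m)"
    by (auto simp: fun_eq_iff indicator_def)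
  then show ?thesis unfolding tilt_def by (simp add: measure_pmf_single)
qed

lemma integrable_tilt:
  assumes "0 < q" "q < 1"
  shows "integrable (measure_pmf X) (\<lambda>n. real n ^ j * (1 - q) ^ (n - 1) * indicator B n)"
proof -
  \<comment> \<open>This makes \<open>(1 - q) ^ n\<close> equal to exp(-a * n), and t^j * exp(-t) is
    bounded along t = a * n.\<close>
  define a where "a = - ln (1 - q)"
  have a: "0 < a" using assms by (simp add: a_def)
  have "filterlim (\<lambda>n. a * real n) at_top sequentially"
    using a by (intro filterlim_tendsto_pos_mult_at_top[OF tendsto_const] filterlim_real_sequentially)
  then have "(\<lambda>n. (a * real n) ^ j / exp (a * real n)) \<longlonglongrightarrow> 0"
    by (rule filterlim_compose[OF tendsto_power_div_exp_0])
  then have "Bseq (\<lambda>n. (a * real n) ^ j / exp (a * real n))" by (intro convergent_imp_Bseq convergentI)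
  then obtain K where K: "0 < K" "\<And>n. norm ((a * real n) ^ j / exp (a * real n)) \<le> K" by (auto elim: BseqE)
  \<comment> \<open>In the bound, the summand 1 takes care of n = 0, where the exponent
    \<open>n - 1\<close> is truncated; the division by 1 - q compensates for the exponent n - 1
    instead of n.\<close>
  show ?thesis
  proof (rule measure_pmf.integrable_const_bound[where B="1 + K / a ^ j / (1 - q)"])
    show "AE n in measure_pmf X. norm (real n ^ j * (1 - q) ^ (n - 1) * indicator B n) \<le> 1 + K / a ^ j / (1 - q)"
    proof (rule AE_I2)
      fix n
      have "real n ^ j * (1 - q) ^ (n - 1) \<le> 1 + K / a ^ j / (1 - q)"
      proof (cases n)
        case 0
        then show ?thesis using K(1) a assms by (cases "j = 0") (auto simp: zero_power)
      next
        case (Suc m)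
        have "(1 - q) ^ n = exp (- (a * real n))"
          using exp_of_nat_mult[of n "ln (1 - q)"] assms by (simp add: a_def mult.commute)
        then have "real n ^ j * (1 - q) ^ n = ((a * real n) ^ j / exp (a * real n)) / a ^ j"
          using a by (simp add: exp_minus power_mult_distrib field_simps)
        also have "\<dots> \<le> K / a ^ j" using K(2)[of n] a by (intro divide_right_mono) (auto simp: abs_le_iff)
        also have "real n ^ j * (1 - q) ^ n = real n ^ j * (1 - q) ^ (n - 1) * (1 - q)"
          using Suc by simp
        finally have "real n ^ j * (1 - q) ^ (n - 1) \<le> K / a ^ j / (1 - q)"
          using assms by (subst pos_le_divide_eq) simp_all
        then show ?thesis by simp
      qed
      then show "norm (real n ^ j * (1 - q) ^ (n - 1) * indicator B n) \<le> 1 + K / a ^ j / (1 - q)"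
        using K(1) a assms by (auto simp: indicator_def)
    qed
  qed simp
qed

lemma tilt_nonneg: "0 < q \<Longrightarrow> q < 1 \<Longrightarrow> 0 \<le> tilt X j q B"
  unfolding tilt_def by (intro integral_nonneg_AE) auto

lemma tilt_mono:
  assumes "0 < q" "q < 1" "A \<subseteq> B"
  shows "tilt X j q A \<le> tilt X j q B"
  unfolding tilt_def using assms
  by (intro integral_mono integrable_tilt mult_left_mono) (auto simp: indicator_def)

lemma ennreal_tilt:
  assumes "0 < q" "q < 1"
  shows "ennreal (tilt X j q B) = (\<Sum>n. ennreal (tilt X j q {n}) * indicator B n)"
proof -
  have "ennreal (tilt X j q B) = (\<integral>\<^sup>+ n. ennreal (real n ^ j * (1 - q) ^ (n - 1) * indicator B n) \<partial>measure_pmf X)"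
    unfolding tilt_def using assms by (intro nn_integral_eq_integral[symmetric] integrable_tilt) auto
  also have "\<dots> = (\<integral>\<^sup>+ n. ennreal (pmf X n) * ennreal (real n ^ j * (1 - q) ^ (n - 1) * indicator B n) \<partial>count_space UNIV)"
    by (rule nn_integral_measure_pmf)
  also have "\<dots> = (\<Sum>n. ennreal (pmf X n) * ennreal (real n ^ j * (1 - q) ^ (n - 1) * indicator B n))"
    by (rule nn_integral_count_space_nat)
  also have "\<dots> = (\<Sum>n. ennreal (tilt X j q {n}) * indicator B n)"
    using assms by (intro suminf_cong) (auto simp: tilt_single indicator_def ennreal_mult' mult_ac)
  finally show ?thesis .
qed

lemma ennreal_divide_eq_mult: "0 \<le> a \<Longrightarrow> 0 < b \<Longrightarrow> ennreal (a / b) = ennreal a * ennreal (1 / b)"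
  by (subst ennreal_mult[symmetric]) simp_all

context offspring
begin

lemma tilt_UNIV_pos:
  assumes "0 < q" "q < 1"
  shows "0 < tilt X j q UNIV"
proof -
  obtain n where n: "n \<in> set_pmf X" using set_pmf_not_empty[of X] by blast
  then have "n \<noteq> 0" using pmf_X_0 by (metis set_pmf_iff)
  then have "0 < tilt X j q {n}" using n assms by (simp add: tilt_single pmf_positive)
  also have "\<dots> \<le> tilt X j q UNIV" using assms by (intro tilt_mono) auto
  finally show ?thesis .
qed

lemma ennreal_tilt_prob:
  assumes "0 < q" "q < 1"
  shows "ennreal (tilt_prob X j q B) = (\<Sum>n. ennreal (tilt_prob X j q {n}) * indicator B n)"
proof -
  have "ennreal (tilt_prob X j q B) = ennreal (tilt X j q B) * ennreal (1 / tilt X j q UNIV)"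
    unfolding tilt_prob_def
    by (rule ennreal_divide_eq_mult[OF tilt_nonneg[OF assms] tilt_UNIV_pos[OF assms]])
  also have "\<dots> = (\<Sum>n. ennreal (tilt X j q {n}) * indicator B n * ennreal (1 / tilt X j q UNIV))"
    by (subst ennreal_tilt[OF assms]) (rule ennreal_suminf_multc[symmetric])
  also have "\<dots> = (\<Sum>n. ennreal (tilt_prob X j q {n}) * indicator B n)"
  proof (rule suminf_cong)
    fix n
    have "ennreal (tilt X j q {n}) * ennreal (1 / tilt X j q UNIV) = ennreal (tilt_prob X j q {n})"
      unfolding tilt_prob_def
      by (rule ennreal_divide_eq_mult[OF tilt_nonneg[OF assms] tilt_UNIV_pos[OF assms], symmetric])
    then show "ennreal (tilt X j q {n}) * indicator B n * ennreal (1 / tilt X j q UNIV) =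
      ennreal (tilt_prob X j q {n}) * indicator B n"
      by (simp add: indicator_def)
  qed
  finally show ?thesis .
qed

lemma tilt_prob_bounds:
  assumes "0 < q" "q < 1"
  shows "0 \<le> tilt_prob X j q B" "tilt_prob X j q B \<le> 1" "tilt_prob X j q UNIV = 1"
  using tilt_nonneg[OF assms] tilt_UNIV_pos[OF assms, of j] tilt_mono[OF assms, of B UNIV X j]
  by (auto simp: tilt_prob_def)

lemma expectation_power_pos:
  assumes int: "integrable (measure_pmf X) (\<lambda>n. real n ^ j)"
  shows "0 < measure_pmf.expectation X (\<lambda>n. real n ^ j)"
proof -
  have "measure_pmf.expectation X (\<lambda>n. 1) \<le> measure_pmf.expectation X (\<lambda>n. real n ^ j)"
    using AE_pos by (intro integral_mono_AE int) (auto elim!: eventually_mono)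
  then show ?thesis by simp
qed

lemma tilt_prob_tendsto:
  assumes int: "integrable (measure_pmf X) (\<lambda>n. real n ^ j)"
  shows "((\<lambda>q. tilt_prob X j q {n}) \<longlongrightarrow> real n ^ j * pmf X n / measure_pmf.expectation X (\<lambda>n. real n ^ j)) (at_right 0)"
proof (rule tendsto_at_right_sequentially[of 0 1])
  fix S :: "nat \<Rightarrow> real"
  assume S: "\<And>n. 0 < S n" "\<And>n. S n < 1" "S \<longlonglongrightarrow> 0"
  have "(\<lambda>i. tilt X j (S i) UNIV) \<longlonglongrightarrow> measure_pmf.expectation X (\<lambda>n. real n ^ j)"
    unfolding tilt_def
  proof (rule integral_dominated_convergence[where w="\<lambda>n. real n ^ j"])
    show "AE x in measure_pmf X. (\<lambda>i. real x ^ j * (1 - S i) ^ (x - 1) * indicat_real UNIV x) \<longlonglongrightarrow> real x ^ j"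
    proof (rule AE_I2)
      fix x
      have "(\<lambda>i. real x ^ j * (1 - S i) ^ (x - 1) * indicat_real UNIV x) \<longlonglongrightarrow> real x ^ j * (1 - 0) ^ (x - 1) * indicat_real UNIV x"
        by (intro tendsto_intros S(3))
      then show "(\<lambda>i. real x ^ j * (1 - S i) ^ (x - 1) * indicat_real UNIV x) \<longlonglongrightarrow> real x ^ j" by simp
    qed
    show "AE x in measure_pmf X. norm (real x ^ j * (1 - S i) ^ (x - 1) * indicat_real UNIV x) \<le> real x ^ j" for i
      using S(1,2)[of i] by (intro AE_I2) (auto intro!: mult_left_le power_le_one)
  qed (use int in auto)
  moreover have "(\<lambda>i. tilt X j (S i) {n}) \<longlonglongrightarrow> real n ^ j * (1 - 0) ^ (n - 1) * pmf X n"
    unfolding tilt_single by (intro tendsto_intros S(3))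
  moreover have "measure_pmf.expectation X (\<lambda>n. real n ^ j) \<noteq> 0"
    using expectation_power_pos[OF int] by simp
  ultimately show "(\<lambda>i. tilt_prob X j (S i) {n}) \<longlonglongrightarrow> real n ^ j * pmf X n / measure_pmf.expectation X (\<lambda>n. real n ^ j)"
    unfolding tilt_prob_def by (auto intro!: tendsto_divide)
qed simp

end

lemma cdf_gamma_law:
  assumes "0 < r"
  shows "cdf (gamma_law r 1) x = (\<integral>s. indicator {..x} s * gam r s \<partial>lborel) / Gamma r"
proof -
  have G: "0 < Gamma r" by (rule Gamma_real_pos[OF assms])
  have dens: "gamma_density r 1 s = gam r s / Gamma r" for s
    by (simp add: gamma_density_def gam_def)
  have "emeasure (gamma_law r 1) {..x} = (\<integral>\<^sup>+ s. ennreal (gamma_density r 1 s) * indicator {..x} s \<partial>lborel)"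
    unfolding gamma_law_def by (rule emeasure_density) (auto simp: dens)
  also have "\<dots> = (\<integral>\<^sup>+ s. ennreal (indicator {..x} s * gam r s / Gamma r) \<partial>lborel)"
    by (intro nn_integral_cong) (auto simp: dens indicator_def)
  also have "\<dots> = ennreal (\<integral>s. indicator {..x} s * gam r s / Gamma r \<partial>lborel)"
  proof (rule nn_integral_eq_integral)
    have "integrable lborel (\<lambda>s. indicator {..x} s * gam r s)"
      using integrable_mult_indicator[OF _ integrable_gam[OF assms], of "{..x}"] by simp
    then show "integrable lborel (\<lambda>s. indicator {..x} s * gam r s / Gamma r)" by simp
  qed (use G gam_nonneg in \<open>auto simp: indicator_def\<close>)
  finally show ?thesis using G gam_nonneg by (simp add: cdf_def measure_def integral_nonneg_AE)
qed

context heavy_tail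
begin

text \<open>The tilted probability is a quotient of a truncated and a full moment. Both are of order
  a^\<alpha> with the same factor \<open>c * \<alpha>\<close>, so the tail constant disappears and a
  normalised incomplete Gamma integral remains.\<close>

lemma tilt_prob_tendsto_gamma:
  assumes X0: "pmf X 0 = 0" and j: "1 \<le> j" "real j - 1 < \<alpha>" "\<alpha> < real j" and x: "0 < x"
  shows "((\<lambda>q. tilt_prob X j q {n. q * real n \<le> x}) \<longlongrightarrow> cdf (gamma_law (real j - \<alpha>) 1) x) (at_right 0)"
proof (rule tendsto_at_right_sequentially[of 0 1])
  fix S :: "nat \<Rightarrow> real"
  assume S: "\<And>n. 0 < S n" "\<And>n. S n < 1" "S \<longlonglongrightarrow> 0"
  \<comment> \<open>With this scale the geometric weight is exactly exponential. The price is a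
    truncation point \<open>x * (a i / S i)\<close> that only tends to x.\<close>
  define a where "a i = - ln (1 - S i)" for i
  have a: "0 < a i" for i using S(1,2)[of i] by (simp add: a_def)
  have "(\<lambda>i. - ln (1 - S i)) \<longlonglongrightarrow> - ln (1 - 0)" by (intro tendsto_intros S(3)) auto
  then have a0: "a \<longlonglongrightarrow> 0" by (simp add: a_def[abs_def])
  have "((\<lambda>q. - ln (1 - q) / q) \<longlongrightarrow> 1) (at_right (0::real))"
    by real_asymp
  moreover have "filterlim S (at_right 0) sequentially"
    unfolding filterlim_at using S by (simp add: order_less_imp_not_eq2)
  ultimately have "(\<lambda>i. a i / S i) \<longlonglongrightarrow> 1" unfolding a_def by (rule filterlim_compose)
  then have "(\<lambda>i. x * (a i / S i)) \<longlonglongrightarrow> x * 1" by (intro tendsto_mult tendsto_const)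
  then have z: "(\<lambda>i. x * (a i / S i)) \<longlonglongrightarrow> x" by simp
  let ?E = "\<lambda>i B. measure_pmf.expectation X (\<lambda>n. (a i * real n) ^ j * exp (- (a i * real n)) * indicator B n)"
  \<comment> \<open>The prefactor, due to the scaling and to the exponent n - 1, does not depend on
    \<open>B\<close> and cancels in the quotient.\<close>
  have tilt_eq: "tilt X j (S i) B = exp (a i) / a i ^ j * ?E i B" for i B
  proof -
    have "real n ^ j * (1 - S i) ^ (n - 1) * indicator B n =
      exp (a i) / a i ^ j * ((a i * real n) ^ j * exp (- (a i * real n)) * indicator B n)" for n
    proof (cases n)
      case 0
      then show ?thesis using j(1) by (simp add: zero_power)
    next
      case (Suc m)
      have "(1 - S i) ^ (n - 1) = exp (- (a i * real m))"
        using exp_of_nat_mult[of m "ln (1 - S i)"] S(1,2)[of i] Suc by (simp add: a_def mult.commute)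
      also have "\<dots> = exp (a i) * exp (- (a i * real n))" using Suc by (simp add: algebra_simps flip: exp_add)
      finally show ?thesis using a[of i] by (simp add: power_mult_distrib)
    qed
    then show ?thesis unfolding tilt_def by simp
  qed
  have ratio: "tilt_prob X j (S i) {n. S i * real n \<le> x} =
    (a i powr (- \<alpha>) * ?E i {n. a i * real n \<le> x * (a i / S i)}) / (a i powr (- \<alpha>) * ?E i UNIV)" for i
  proof -
    have "{n. S i * real n \<le> x} = {n. a i * real n \<le> x * (a i / S i)}"
      using S(1)[of i] a[of i] by (auto simp: field_simps)
    then show ?thesis unfolding tilt_prob_def tilt_eq using a[of i] by simp
  qed
  have "0 < Gamma (real j - \<alpha>)" using j by (intro Gamma_real_pos) simp
  then have "c * \<alpha> * Gamma (real j - \<alpha>) \<noteq> 0" using c_pos alpha_pos by simp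
  moreover have "(\<lambda>i. a i powr (- \<alpha>) * ?E i UNIV) \<longlonglongrightarrow> c * \<alpha> * Gamma (real j - \<alpha>)"
    using full_moment_tendsto[OF j(1,3), of a] a a0 by simp
  ultimately have "(\<lambda>i. tilt_prob X j (S i) {n. S i * real n \<le> x}) \<longlonglongrightarrow>
     (c * \<alpha> * (\<integral>s. indicator {..x} s * gam (real j - \<alpha>) s \<partial>lborel)) / (c * \<alpha> * Gamma (real j - \<alpha>))"
    unfolding ratio using truncated_moment_tendsto[OF j(1,3) a a0 z x] by (intro tendsto_divide) auto
  then show "(\<lambda>i. tilt_prob X j (S i) {n. S i * real n \<le> x}) \<longlonglongrightarrow> cdf (gamma_law (real j - \<alpha>) 1) x"
    using c_pos alpha_pos j by (simp add: cdf_gamma_law)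
qed simp

lemma integrable_power_of_tail:
  assumes j: "j = 1 \<or> j = 2" "real j < \<alpha>"
  shows "integrable (measure_pmf X) (\<lambda>n. real n ^ j)"
proof -
  obtain C where C: "0 < C" "\<And>x. 0 < x \<Longrightarrow> tail_prob x \<le> C * x powr (- \<alpha>)" using tail_prob_bound by blast
  \<comment> \<open>An upper bound for (m + 1)^j - m^j when j is 1 or 2, so that n^j is dominated by
    a sum over m < n and the moment by a series of tail probabilities.\<close>
  define b where "b m = real j * real (Suc m) ^ (j - 1)" for m
  have pow: "real n ^ j \<le> (\<Sum>m<n. b m)" for n
  proof (induction n)
    case 0
    then show ?case using j(1) by (auto simp: zero_power)
  next
    case (Suc n)
    have "real (Suc n) ^ j \<le> real n ^ j + b n"
      using j(1) by (elim disjE) (simp_all add: b_def power2_eq_square algebra_simps)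
    then show ?case using Suc by simp
  qed
  have "(\<integral>\<^sup>+ n. ennreal (real n ^ j) \<partial>measure_pmf X) \<le> (\<integral>\<^sup>+ n. (\<Sum>m. ennreal (b m) * indicator {m<..} n) \<partial>measure_pmf X)"
  proof (rule nn_integral_mono)
    fix n
    have "ennreal (real n ^ j) \<le> ennreal (\<Sum>m<n. b m)" using pow by (rule ennreal_leI)
    also have "\<dots> = (\<Sum>m<n. ennreal (b m) * indicator {m<..} n)"
      by (subst sum_ennreal[symmetric]) (auto simp: b_def intro!: sum.cong)
    also have "\<dots> \<le> (\<Sum>m. ennreal (b m) * indicator {m<..} n)" by (rule sum_le_suminf) auto
    finally show "ennreal (real n ^ j) \<le> (\<Sum>m. ennreal (b m) * indicator {m<..} n)" .
  qed
  also have "\<dots> = (\<Sum>m. \<integral>\<^sup>+ n. ennreal (b m) * indicator {m<..} n \<partial>measure_pmf X)"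
    by (rule nn_integral_suminf) auto
  also have "\<dots> = (\<Sum>m. ennreal (b m * tail_prob (real m)))"
    by (intro suminf_cong)
       (auto simp: nn_integral_cmult tail_prob_def measure_pmf.emeasure_eq_measure b_def ennreal_mult greaterThan_def)
  also have "\<dots> < \<top>"
  proof -
    have "summable (\<lambda>m. b m * tail_prob (real m))"
    proof (rule summable_comparison_test_ev)
      show "summable (\<lambda>m. real j * 2 ^ (j - 1) * C * (real m powr (real j - 1 - \<alpha>)))"
        using j by (intro summable_mult) (simp add: summable_real_powr_iff)
      show "eventually (\<lambda>m. norm (b m * tail_prob (real m)) \<le> real j * 2 ^ (j - 1) * C * (real m powr (real j - 1 - \<alpha>))) sequentially"
        using eventually_gt_at_top[of 0]
      proof eventually_elim
        case (elim m)
        have "b m \<le> real j * (2 * real m) ^ (j - 1)" unfolding b_def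
          using elim by (intro mult_left_mono power_mono) auto
        then have "b m * tail_prob (real m) \<le> real j * (2 * real m) ^ (j - 1) * (C * real m powr (- \<alpha>))"
          using C(1) C(2)[of "real m"] elim tail_prob_bounds(1) by (intro mult_mono) auto
        also have "\<dots> = real j * 2 ^ (j - 1) * C * (real m ^ (j - 1) * real m powr (- \<alpha>))"
          by (simp add: power_mult_distrib)
        also have "real m ^ (j - 1) * real m powr (- \<alpha>) = real m powr (real j - 1 - \<alpha>)"
          using power_mult_powr[of "real m" "j - 1" "- \<alpha>"] elim j(1) by auto
        finally show ?case using tail_prob_bounds(1)[of "real m"] by (simp add: b_def)
      qed
    qed
    moreover have "0 \<le> b m * tail_prob (real m)" for m using tail_prob_bounds(1)[of "real m"] by (simp add: b_def)
    ultimately have "(\<Sum>m. ennreal (b m * tail_prob (real m))) = ennreal (\<Sum>m. b m * tail_prob (real m))"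
      by (intro suminf_ennreal2) auto
    then show ?thesis by (simp only: ennreal_less_top)
  qed
  finally show ?thesis by (intro integrableI_bounded) auto
qed

text \<open>Markov's inequality would bound x^j * P(X > x) by the moment, but the tail makes it at
  least a constant times x^(j - \<alpha>), which is unbounded.\<close>

lemma not_integrable_power_of_tail:
  assumes "\<alpha> < real j"
  shows "\<not> integrable (measure_pmf X) (\<lambda>n. real n ^ j)"
proof
  assume int: "integrable (measure_pmf X) (\<lambda>n. real n ^ j)"
  define E where "E = measure_pmf.expectation X (\<lambda>n. real n ^ j)"
  have le: "x ^ j * tail_prob x \<le> E" if "0 < x" for x
  proof -
    have "measure_pmf.expectation X (\<lambda>n. x ^ j * indicator {n. x < real n} n) \<le> E"
      unfolding E_def
    proof (intro integral_mono int integrable_mult_right)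
      show "integrable (measure_pmf X) (indicator {n. x < real n} :: nat \<Rightarrow> real)"
        by (rule measure_pmf.integrable_const_bound[where B=1]) auto
    qed (use that in \<open>auto simp: indicator_def intro: power_mono\<close>)
    then show ?thesis by (simp add: tail_prob_def)
  qed
  have ev1: "eventually (\<lambda>x. x ^ j * tail_prob x \<ge> c / 2 * x powr (real j - \<alpha>)) at_top"
    using order_tendstoD(1)[OF tail, of "1/2", simplified] eventually_gt_at_top[of 0]
  proof eventually_elim
    case (elim x)
    then have "c / 2 * x powr (- \<alpha>) \<le> tail_prob x" using c_pos by (simp add: tail_prob_def field_simps)
    then have "x ^ j * (c / 2 * x powr (- \<alpha>)) \<le> x ^ j * tail_prob x" using elim by (intro mult_left_mono) auto
    then show ?case using power_mult_powr[OF elim(2), of j "- \<alpha>"] by (simp add: field_simps)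
  qed
  have "filterlim (\<lambda>x::real. x powr (real j - \<alpha>)) at_top at_top"
    using assms by real_asymp
  then have "filterlim (\<lambda>x. c / 2 * x powr (real j - \<alpha>)) at_top at_top"
    using c_pos by (intro filterlim_tendsto_pos_mult_at_top[OF tendsto_const]) auto
  then have "eventually (\<lambda>x. c / 2 * x powr (real j - \<alpha>) > E) at_top" by (simp add: filterlim_at_top_dense)
  then have "eventually (\<lambda>x. E < x ^ j * tail_prob x \<and> 0 < x) at_top"
    using ev1 eventually_gt_at_top[of 0] by eventually_elim simp
  then obtain x where "E < x ^ j * tail_prob x" "0 < x"
    using eventually_happens'[OF trivial_limit_at_top_linorder] by blast
  then show False using le[of x] by simp
qed

end

subsection \<open>The weighted branching process tree\<close>

text \<open>The independent family is real-valued and carries the degrees under \<open>Inl\<close>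
  as reals, hence the floor.\<close>

definition dcfg :: "(vertex + vertex \<Rightarrow> real) \<Rightarrow> vertex \<Rightarrow> nat" where
  "dcfg y v = nat \<lfloor>y (Inl v)\<rfloor>"

definition ucfg :: "(vertex + vertex \<Rightarrow> real) \<Rightarrow> vertex \<Rightarrow> real" where
  "ucfg y v = y (Inr v)"

text \<open>A coordinate outside \<open>A\<close> is the constant \<open>undefined\<close> on the
  product space. So a whole configuration can be read off any block of coordinates without side
  conditions.\<close>

lemma measurable_PiM_coord:
  "(\<lambda>y. y i :: real) \<in> borel_measurable (PiM A (\<lambda>_. borel))"
proof (cases "i \<in> A")
  case False
  then show ?thesis
    by (subst measurable_cong[where g="\<lambda>_. undefined"]) (auto simp: space_PiM PiE_def extensional_def)
qed simp

interpretation cfg: random_config "PiM A (\<lambda>_. borel)" dcfg ucfg for A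
proof
  fix v
  show "(\<lambda>y. dcfg y v) \<in> PiM A (\<lambda>_. borel) \<rightarrow>\<^sub>M count_space UNIV"
    unfolding dcfg_def using measurable_PiM_coord[measurable] by measurable
  show "(\<lambda>y. ucfg y v) \<in> borel_measurable (PiM A (\<lambda>_. borel))"
    unfolding ucfg_def by (rule measurable_PiM_coord)
qed

text \<open>The coordinates that determine the subtree of \<open>v\<close>, without and with the edge above \<open>v\<close>.\<close>

definition down :: "vertex \<Rightarrow> (vertex + vertex) set" where
  "down v = {x. prefix v x} <+> {x. strict_prefix v x}"

definition edown :: "vertex \<Rightarrow> (vertex + vertex) set" where
  "edown v = {x. prefix v x} <+> {x. prefix v x}"

definition coords :: "(vertex + vertex) set" where
  "coords = UNIV <+> {v. v \<noteq> []}"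

lemma down_subset: "down v \<subseteq> coords" "v \<noteq> [] \<Longrightarrow> edown v \<subseteq> coords"
  by (auto simp: down_def edown_def coords_def strict_prefix_def)

lemma down_subset_edown: "down v \<subseteq> edown v"
  by (auto simp: down_def edown_def strict_prefix_def)

lemma root_in_edown: "Inr v \<in> edown v" "Inl v \<in> edown v" "Inl v \<in> down v"
  by (auto simp: edown_def down_def)

locale bp_model = offspring X + prob_space M
  for X :: "nat pmf" and M :: "'a measure" +
  fixes N :: "vertex \<Rightarrow> 'a \<Rightarrow> nat" and U :: "vertex \<Rightarrow> 'a \<Rightarrow> real"
  assumes tree: "weighted_bp_tree M X N U"
begin

definition Z :: "vertex + vertex \<Rightarrow> 'a \<Rightarrow> real" where
  "Z = case_sum (\<lambda>v \<omega>. real (N v \<omega>)) U"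

definition restr :: "(vertex + vertex) set \<Rightarrow> 'a \<Rightarrow> vertex + vertex \<Rightarrow> real" where
  "restr A \<omega> = restrict (\<lambda>i. Z i \<omega>) A"

definition lev :: "vertex \<Rightarrow> 'a \<Rightarrow> real" where
  "lev v \<omega> = level (\<lambda>v. N v \<omega>) (\<lambda>v. U v \<omega>) v"

definition elev :: "vertex \<Rightarrow> 'a \<Rightarrow> real" where
  "elev v \<omega> = elevel (\<lambda>v. N v \<omega>) (\<lambda>v. U v \<omega>) v"

definition mm :: "nat \<Rightarrow> vertex \<Rightarrow> 'a \<Rightarrow> real" where
  "mm n v \<omega> = minmax (\<lambda>v. N v \<omega>) (\<lambda>v. U v \<omega>) n v"

lemma indep_Z: "indep_vars (\<lambda>_. borel) Z coords"
  using tree by (simp add: weighted_bp_tree_def Z_def coords_def)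

lemma measurable_Z: "i \<in> coords \<Longrightarrow> Z i \<in> borel_measurable M"
  using indep_Z by (auto simp: indep_vars_def)

lemma measurable_N [measurable]: "N v \<in> M \<rightarrow>\<^sub>M count_space UNIV"
proof -
  have [measurable]: "Z (Inl v) \<in> borel_measurable M" by (rule measurable_Z) (auto simp: coords_def)
  have "N v = (\<lambda>\<omega>. nat \<lfloor>Z (Inl v) \<omega>\<rfloor>)" by (simp add: Z_def fun_eq_iff)
  then show ?thesis by simp
qed

lemma measurable_U: "v \<noteq> [] \<Longrightarrow> U v \<in> borel_measurable M"
  using measurable_Z[of "Inr v"] by (auto simp: coords_def Z_def)

sublocale random_config M "\<lambda>\<omega> v. N v \<omega>" "\<lambda>\<omega> v. U v \<omega>"
  by unfold_locales (auto simp: measurable_U)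

lemma measurable_lev [measurable]: "lev v \<in> borel_measurable M"
  unfolding lev_def[abs_def] by measurable

lemma measurable_elev: "v \<noteq> [] \<Longrightarrow> elev v \<in> borel_measurable M"
  unfolding elev_def[abs_def] by (rule measurable_elevel)

lemma measurable_mm [measurable]: "mm n v \<in> borel_measurable M"
  unfolding mm_def[abs_def] by measurable

lemma measurable_restr: "A \<subseteq> coords \<Longrightarrow> restr A \<in> M \<rightarrow>\<^sub>M PiM A (\<lambda>_. borel)"
  unfolding restr_def[abs_def] by (rule measurable_restrict) (auto intro: measurable_Z)

lemma lev_bounds: "0 \<le> lev v \<omega>" "lev v \<omega> \<le> 1"
  by (simp_all add: lev_def level_bounds)

lemma elev_eq: "elev v \<omega> = max (U v \<omega>) (lev v \<omega>)"
  by (simp add: elev_def elevel_def lev_def)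

lemma dcfg_restr: "Inl v \<in> A \<Longrightarrow> dcfg (restr A \<omega>) v = N v \<omega>"
  by (simp add: dcfg_def restr_def Z_def)

lemma ucfg_restr: "Inr v \<in> A \<Longrightarrow> ucfg (restr A \<omega>) v = U v \<omega>"
  by (simp add: ucfg_def restr_def Z_def)

lemma lev_restr:
  assumes "down v \<subseteq> A"
  shows "level (dcfg (restr A \<omega>)) (ucfg (restr A \<omega>)) v = lev v \<omega>"
  unfolding lev_def
  by (rule level_cong; subst dcfg_restr ucfg_restr)
     (use assms in \<open>auto simp: down_def strict_prefix_def\<close>)

lemma mm_restr:
  assumes "down v \<subseteq> A"
  shows "minmax (dcfg (restr A \<omega>)) (ucfg (restr A \<omega>)) n v = mm n v \<omega>"
  unfolding mm_def
  by (rule minmax_cong; subst dcfg_restr ucfg_restr)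
     (use assms in \<open>auto simp: down_def strict_prefix_def\<close>)

lemma elev_restr:
  assumes "edown v \<subseteq> A"
  shows "elevel (dcfg (restr A \<omega>)) (ucfg (restr A \<omega>)) v = elev v \<omega>"
  unfolding elev_def
  by (rule elevel_cong; subst dcfg_restr ucfg_restr)
     (use assms in \<open>auto simp: edown_def\<close>)

lemma selects_restr:
  assumes "coords - edown v \<subseteq> A"
  shows "selects (dcfg (restr A \<omega>)) (ucfg (restr A \<omega>)) (rev v) r =
    selects (\<lambda>v. N v \<omega>) (\<lambda>v. U v \<omega>) (rev v) r"
  by (rule selects_cong; subst dcfg_restr ucfg_restr)
     (use assms in \<open>auto simp: edown_def coords_def\<close>)

text \<open>Independence of two blocks in Fubini form, for integrands that couple the blocks. The
  inner integral is again over \<open>M\<close>, so laws of \<open>lev v\<close> and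
  \<open>elev v\<close> apply to it directly.\<close>

lemma nn_integral_indep:
  assumes AB: "A \<inter> B = {}" "A \<subseteq> coords" "B \<subseteq> coords"
    and F: "case_prod F \<in> borel_measurable (PiM A (\<lambda>_. borel) \<Otimes>\<^sub>M PiM B (\<lambda>_. borel))"
  shows "(\<integral>\<^sup>+\<omega>. F (restr A \<omega>) (restr B \<omega>) \<partial>M) = (\<integral>\<^sup>+\<omega>. \<integral>\<^sup>+\<omega>'. F (restr A \<omega>) (restr B \<omega>') \<partial>M \<partial>M)"
proof -
  let ?A = "PiM A (\<lambda>_. borel) :: (vertex + vertex \<Rightarrow> real) measure"
  let ?B = "PiM B (\<lambda>_. borel) :: (vertex + vertex \<Rightarrow> real) measure"
  note m [measurable] = measurable_restr[OF AB(2)] measurable_restr[OF AB(3)]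
  interpret B: prob_space "distr M ?B (restr B)" by (rule prob_space_distr) (rule m)
  have "indep_var ?A (restr A) ?B (restr B)"
    using indep_var_restrict[OF indep_Z AB] by (simp add: restr_def[abs_def])
  then have eq: "distr M ?A (restr A) \<Otimes>\<^sub>M distr M ?B (restr B) = distr M (?A \<Otimes>\<^sub>M ?B) (\<lambda>\<omega>. (restr A \<omega>, restr B \<omega>))"
    unfolding indep_var_distribution_eq by blast
  note [measurable] = F
  have "(\<integral>\<^sup>+\<omega>. F (restr A \<omega>) (restr B \<omega>) \<partial>M) = (\<integral>\<^sup>+z. case_prod F z \<partial>distr M (?A \<Otimes>\<^sub>M ?B) (\<lambda>\<omega>. (restr A \<omega>, restr B \<omega>)))"
    by (subst nn_integral_distr) auto
  also have "\<dots> = (\<integral>\<^sup>+y. \<integral>\<^sup>+y'. F y y' \<partial>distr M ?B (restr B) \<partial>distr M ?A (restr A))"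
    unfolding eq[symmetric] by (subst B.nn_integral_fst[symmetric]) auto
  also have "\<dots> = (\<integral>\<^sup>+\<omega>. \<integral>\<^sup>+y'. F (restr A \<omega>) y' \<partial>distr M ?B (restr B) \<partial>M)"
    by (subst nn_integral_distr) auto
  also have "\<dots> = (\<integral>\<^sup>+\<omega>. \<integral>\<^sup>+\<omega>'. F (restr A \<omega>) (restr B \<omega>') \<partial>M \<partial>M)"
  proof (rule nn_integral_cong)
    fix \<omega> assume "\<omega> \<in> space M"
    then have "restr A \<omega> \<in> space ?A" using m(1) by (rule measurable_space[rotated])
    then have "(\<lambda>y'. F (restr A \<omega>) y') \<in> borel_measurable ?B" using measurable_Pair2[OF F] by simp
    then show "(\<integral>\<^sup>+y'. F (restr A \<omega>) y' \<partial>distr M ?B (restr B)) = (\<integral>\<^sup>+\<omega>'. F (restr A \<omega>) (restr B \<omega>') \<partial>M)"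
      by (subst nn_integral_distr) auto
  qed
  finally show ?thesis .
qed

lemma prob_indep:
  assumes AB: "A \<inter> B = {}" "A \<subseteq> coords" "B \<subseteq> coords"
    and [measurable]: "Measurable.pred (PiM A (\<lambda>_. borel)) P" "Measurable.pred (PiM B (\<lambda>_. borel)) Q"
  shows "prob {\<omega> \<in> space M. P (restr A \<omega>) \<and> Q (restr B \<omega>)} =
    prob {\<omega> \<in> space M. P (restr A \<omega>)} * prob {\<omega> \<in> space M. Q (restr B \<omega>)}"
proof -
  note [measurable] = measurable_restr[OF AB(2)] measurable_restr[OF AB(3)]
  let ?F = "\<lambda>y y'. indicator {y. P y} y * indicator {y. Q y} y' :: ennreal"
  have "emeasure M {\<omega> \<in> space M. P (restr A \<omega>) \<and> Q (restr B \<omega>)} =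
    (\<integral>\<^sup>+\<omega>. indicator {\<omega> \<in> space M. P (restr A \<omega>) \<and> Q (restr B \<omega>)} \<omega> \<partial>M)"
    by (rule nn_integral_indicator[symmetric]) measurable
  also have "\<dots> = (\<integral>\<^sup>+\<omega>. ?F (restr A \<omega>) (restr B \<omega>) \<partial>M)"
    by (rule nn_integral_cong) (auto simp: indicator_def)
  also have "\<dots> = (\<integral>\<^sup>+\<omega>. \<integral>\<^sup>+\<omega>'. ?F (restr A \<omega>) (restr B \<omega>') \<partial>M \<partial>M)"
    by (rule nn_integral_indep[OF AB]) measurable
  also have "\<dots> = (\<integral>\<^sup>+\<omega>. indicator {\<omega> \<in> space M. P (restr A \<omega>)} \<omega> * emeasure M {\<omega> \<in> space M. Q (restr B \<omega>)} \<partial>M)"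
  proof (rule nn_integral_cong)
    fix \<omega> assume "\<omega> \<in> space M"
    have "(\<integral>\<^sup>+\<omega>'. ?F (restr A \<omega>) (restr B \<omega>') \<partial>M) = (\<integral>\<^sup>+\<omega>'. indicator {y. P y} (restr A \<omega>) * indicator {\<omega> \<in> space M. Q (restr B \<omega>)} \<omega>' \<partial>M)"
      by (rule nn_integral_cong) (auto simp: indicator_def)
    also have "\<dots> = indicator {y. P y} (restr A \<omega>) * emeasure M {\<omega> \<in> space M. Q (restr B \<omega>)}"
      by (subst nn_integral_cmult) auto
    finally show "(\<integral>\<^sup>+\<omega>'. ?F (restr A \<omega>) (restr B \<omega>') \<partial>M) =
      indicator {\<omega> \<in> space M. P (restr A \<omega>)} \<omega> * emeasure M {\<omega> \<in> space M. Q (restr B \<omega>)}"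
      using \<open>\<omega> \<in> space M\<close> by (auto simp: indicator_def)
  qed
  also have "\<dots> = emeasure M {\<omega> \<in> space M. P (restr A \<omega>)} * emeasure M {\<omega> \<in> space M. Q (restr B \<omega>)}"
    by (subst nn_integral_multc) auto
  finally show ?thesis by (simp add: emeasure_eq_measure flip: ennreal_mult)
qed

lemma prob_N: "prob {\<omega> \<in> space M. N v \<omega> = n} = pmf X n"
proof -
  have "pmf X n = measure (distr M (count_space UNIV) (N v)) {n}"
    using tree by (simp add: weighted_bp_tree_def measure_pmf_single)
  also have "\<dots> = prob (N v -` {n} \<inter> space M)" by (rule measure_distr) auto
  finally show ?thesis by (simp add: vimage_def Int_def conj_commute)
qed

lemma emeasure_U:
  assumes "v \<noteq> []" "S \<in> sets borel"
  shows "emeasure M {\<omega> \<in> space M. U v \<omega> \<in> S} = emeasure lborel ({0..1} \<inter> S)"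
proof -
  have "emeasure M {\<omega> \<in> space M. U v \<omega> \<in> S} = emeasure (distr M borel (U v)) S"
    using assms measurable_U by (subst emeasure_distr) (auto simp: vimage_def Int_def conj_commute)
  also have "distr M borel (U v) = uniform_measure lborel {0..1}"
    using tree assms by (simp add: weighted_bp_tree_def)
  finally show ?thesis using assms by (simp add: divide_ennreal_def)
qed

lemma prob_U_le:
  assumes "v \<noteq> []" "0 \<le> p" "p \<le> 1"
  shows "prob {\<omega> \<in> space M. U v \<omega> \<le> p} = p"
proof -
  have "emeasure M {\<omega> \<in> space M. U v \<omega> \<in> {..p}} = emeasure lborel ({0..1} \<inter> {..p})"
    by (rule emeasure_U) (use assms in auto)
  also have "{0..1} \<inter> {..p} = {0..p}" using assms by auto
  finally show ?thesis using assms by (simp add: emeasure_eq_measure)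
qed

lemma AE_U:
  assumes "v \<noteq> []"
  shows "AE \<omega> in M. 0 \<le> U v \<omega> \<and> U v \<omega> \<le> 1"
proof -
  have "emeasure M {\<omega> \<in> space M. U v \<omega> \<in> - {0..1}} = emeasure lborel ({0..1} \<inter> - {0..1::real})"
    by (rule emeasure_U) (use assms in auto)
  then have "emeasure M {\<omega> \<in> space M. U v \<omega> \<in> - {0..1}} = 0" by simp
  moreover have "{\<omega> \<in> space M. U v \<omega> \<in> - {0..1}} \<in> sets M" using measurable_U[OF assms] by measurable
  ultimately have "AE \<omega> in M. \<not> U v \<omega> \<in> - {0..1}" by (intro AE_I[OF _ _]) auto
  then show ?thesis by eventually_elim auto
qed

lemma AE_N_pos: "AE \<omega> in M. 0 < N v \<omega>"
proof -
  have "prob {\<omega> \<in> space M. N v \<omega> = 0} = 0" using prob_N pmf_X_0 by simp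
  then have "AE \<omega> in M. \<not> N v \<omega> = 0" by (subst (asm) prob_eq_0) auto
  then show ?thesis by eventually_elim auto
qed

lemma prob_children:
  assumes E: "\<And>i. Measurable.pred (PiM (edown (v @ [i])) (\<lambda>_. borel)) (E i)"
    and t: "\<And>i. prob {\<omega> \<in> space M. E i (restr (edown (v @ [i])) \<omega>)} = t"
  shows "prob {\<omega> \<in> space M. N v \<omega> = m \<and> (\<forall>i<m. \<not> E i (restr (edown (v @ [i])) \<omega>))} = pmf X m * (1 - t) ^ m"
proof -
  \<comment> \<open>Block 0 is the degree of \<open>v\<close>, block i + 1 the subtree of the i-th
    child with the edge above it. These blocks are disjoint, so the probability factorises.\<close>
  define K where "K j = (case j of 0 \<Rightarrow> {Inl v} | Suc i \<Rightarrow> edown (v @ [i]))" for j :: nat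
  define A where "A j = (case j of 0 \<Rightarrow> {y \<in> space (PiM (K j) (\<lambda>_. borel)). dcfg y v = m}
    | Suc i \<Rightarrow> {y \<in> space (PiM (K j) (\<lambda>_. borel)). \<not> E i y})" for j :: nat
  have K: "K j \<subseteq> coords" for j
    using down_subset(2) by (cases j) (auto simp: K_def coords_def)
  have dj: "disjoint_family_on K {..m}"
    by (auto simp: disjoint_family_on_def K_def edown_def split: nat.splits) (auto simp: prefix_def)
  have ind: "indep_vars (\<lambda>j. PiM (K j) (\<lambda>_. borel)) (\<lambda>j. restr (K j)) {..m}"
    using indep_vars_restrict[OF indep_Z K dj] by (simp add: restr_def[abs_def])
  have A: "A j \<in> sets (PiM (K j) (\<lambda>_. borel))" for j
  proof (cases j)
    case 0
    then show ?thesis unfolding A_def by (simp add: K_def)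
  next
    case (Suc i)
    have [measurable]: "Measurable.pred (PiM (K j) (\<lambda>_. borel)) (E i)" using E[of i] by (simp add: K_def Suc)
    have "{y \<in> space (PiM (K j) (\<lambda>_. borel)). \<not> E i y} \<in> sets (PiM (K j) (\<lambda>_. borel))" by measurable
    then show ?thesis by (simp add: A_def Suc)
  qed
  have v0: "restr (K 0) -` A 0 \<inter> space M = {\<omega> \<in> space M. N v \<omega> = m}"
    using measurable_space[OF measurable_restr[OF K[of 0]]] by (auto simp: A_def K_def dcfg_restr)
  have vS: "restr (K (Suc i)) -` A (Suc i) \<inter> space M = {\<omega> \<in> space M. \<not> E i (restr (edown (v @ [i])) \<omega>)}" for i
    using measurable_space[OF measurable_restr[OF K[of "Suc i"]]] by (auto simp: A_def K_def)
  have pS: "prob {\<omega> \<in> space M. \<not> E i (restr (edown (v @ [i])) \<omega>)} = 1 - t" for i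
  proof -
    note [measurable] = E measurable_restr[OF down_subset(2), of "v @ [i]", simplified]
    show ?thesis unfolding t[of i, symmetric] by (rule prob_neg) measurable
  qed
  have "{\<omega> \<in> space M. N v \<omega> = m \<and> (\<forall>i<m. \<not> E i (restr (edown (v @ [i])) \<omega>))} =
    (\<Inter>j\<in>{..m}. restr (K j) -` A j \<inter> space M)" (is "?L = ?R")
  proof -
    have "?R = (restr (K 0) -` A 0 \<inter> space M) \<inter> (\<Inter>i\<in>{..<m}. (restr (K (Suc i)) -` A (Suc i) \<inter> space M)) \<inter> space M"
      by (auto simp: atMost_Suc_eq_insert_0 lessThan_Suc_atMost[symmetric] lessThan_Suc_eq_insert_0 image_iff Ball_def)
    then show ?thesis unfolding v0 vS by auto
  qed
  also have "prob \<dots> = (\<Prod>j\<in>{..m}. prob (restr (K j) -` A j \<inter> space M))"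
    by (rule indep_varsD_finite[OF ind]) (use A in auto)
  also have "\<dots> = prob (restr (K 0) -` A 0 \<inter> space M) * (\<Prod>i<m. prob (restr (K (Suc i)) -` A (Suc i) \<inter> space M))"
    unfolding lessThan_Suc_atMost[symmetric] by (rule prod.lessThan_Suc_shift)
  also have "\<dots> = pmf X m * (1 - t) ^ m" unfolding v0 vS pS prob_N by simp
  finally show ?thesis .
qed

lemma prob_elev_mm:
  assumes "0 \<le> p" "p \<le> 1" "prob {\<omega> \<in> space M. mm n (v @ [i]) \<omega> \<le> p} = s"
  defines "E \<equiv> \<lambda>y. ucfg y (v @ [i]) \<le> p \<and> minmax (dcfg y) (ucfg y) n (v @ [i]) \<le> p"
  shows "prob {\<omega> \<in> space M. E (restr (edown (v @ [i])) \<omega>)} = p * s"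
proof -
  let ?w = "v @ [i]"
  have sub: "{Inr ?w} \<subseteq> coords" by (auto simp: coords_def)
  have [measurable]: "(\<lambda>y. ucfg y ?w) \<in> borel_measurable (PiM {Inr ?w} (\<lambda>_. borel))"
    unfolding ucfg_def by (rule measurable_PiM_coord)
  have "prob {\<omega> \<in> space M. ucfg (restr {Inr ?w} \<omega>) ?w \<le> p \<and>
      minmax (dcfg (restr (down ?w) \<omega>)) (ucfg (restr (down ?w) \<omega>)) n ?w \<le> p} =
    prob {\<omega> \<in> space M. ucfg (restr {Inr ?w} \<omega>) ?w \<le> p} *
    prob {\<omega> \<in> space M. minmax (dcfg (restr (down ?w) \<omega>)) (ucfg (restr (down ?w) \<omega>)) n ?w \<le> p}"
    by (rule prob_indep[where P="\<lambda>y. ucfg y ?w \<le> p" and Q="\<lambda>y. minmax (dcfg y) (ucfg y) n ?w \<le> p"])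
       (use sub down_subset in \<open>auto simp: down_def\<close>)
  then have "prob {\<omega> \<in> space M. U ?w \<omega> \<le> p \<and> mm n ?w \<omega> \<le> p} = p * s"
    using prob_U_le[of ?w p] assms by (simp add: ucfg_restr mm_restr)
  moreover have "E (restr (edown ?w) \<omega>) \<longleftrightarrow> U ?w \<omega> \<le> p \<and> mm n ?w \<omega> \<le> p" for \<omega>
    unfolding E_def by (simp add: mm_restr[OF down_subset_edown] ucfg_restr root_in_edown)
  ultimately show ?thesis by simp
qed

text \<open>\<open>p < 1\<close> removes the disjunct caused by the cap in
  \<open>minmax_Suc_le_iff\<close>; then each child succeeds independently with probability p *
  s.\<close>

lemma prob_mm_Suc:
  assumes "0 \<le> p" "p < 1" "\<And>i. prob {\<omega> \<in> space M. mm n (v @ [i]) \<omega> \<le> p} = s"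
  shows "prob {\<omega> \<in> space M. N v \<omega> = m \<and> p < mm (Suc n) v \<omega>} = pmf X m * (1 - p * s) ^ m"
proof -
  let ?E = "\<lambda>i y. ucfg y (v @ [i]) \<le> p \<and> minmax (dcfg y) (ucfg y) n (v @ [i]) \<le> p"
  have "prob {\<omega> \<in> space M. N v \<omega> = m \<and> (\<forall>i<m. \<not> ?E i (restr (edown (v @ [i])) \<omega>))} = pmf X m * (1 - p * s) ^ m"
    by (rule prob_children) (use prob_elev_mm[of p n v _ s] assms in auto)
  moreover have "{\<omega> \<in> space M. N v \<omega> = m \<and> p < mm (Suc n) v \<omega>} =
    {\<omega> \<in> space M. N v \<omega> = m \<and> (\<forall>i<m. \<not> ?E i (restr (edown (v @ [i])) \<omega>))}"
  proof (rule Collect_cong)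
    fix \<omega>
    have "p < mm (Suc n) v \<omega> \<longleftrightarrow> \<not> (\<exists>i<N v \<omega>. U (v @ [i]) \<omega> \<le> p \<and> mm n (v @ [i]) \<omega> \<le> p)"
      using minmax_Suc_le_iff[of "\<lambda>v. N v \<omega>" "\<lambda>v. U v \<omega>" n v p] assms(2)
      by (auto simp: mm_def simp del: minmax.simps)
    moreover have "?E i (restr (edown (v @ [i])) \<omega>) \<longleftrightarrow> U (v @ [i]) \<omega> \<le> p \<and> mm n (v @ [i]) \<omega> \<le> p" for i
      by (simp add: mm_restr[OF down_subset_edown] ucfg_restr root_in_edown)
    ultimately show "\<omega> \<in> space M \<and> N v \<omega> = m \<and> p < mm (Suc n) v \<omega> \<longleftrightarrow>
      \<omega> \<in> space M \<and> N v \<omega> = m \<and> (\<forall>i<m. \<not> ?E i (restr (edown (v @ [i])) \<omega>))"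
      by blast
  qed
  ultimately show ?thesis by simp
qed

lemma prob_sum_N:
  assumes [measurable]: "Measurable.pred M P" and h: "\<And>m. prob {\<omega> \<in> space M. N v \<omega> = m \<and> P \<omega>} = pmf X m * h m"
    and h01: "\<And>m. 0 \<le> h m" "\<And>m. h m \<le> 1"
  shows "prob {\<omega> \<in> space M. P \<omega>} = measure_pmf.expectation X h"
proof -
  have "emeasure M {\<omega> \<in> space M. P \<omega>} = emeasure M (\<Union>m. {\<omega> \<in> space M. N v \<omega> = m \<and> P \<omega>})"
    by (rule arg_cong[where f="emeasure M"]) auto
  also have "\<dots> = (\<Sum>m. emeasure M {\<omega> \<in> space M. N v \<omega> = m \<and> P \<omega>})"
    by (rule suminf_emeasure[symmetric]) (auto simp: disjoint_family_on_def)
  also have "\<dots> = (\<Sum>m. ennreal (pmf X m) * ennreal (h m))"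
    using h h01 by (simp add: emeasure_eq_measure ennreal_mult)
  also have "\<dots> = (\<integral>\<^sup>+ m. ennreal (h m) \<partial>measure_pmf X)"
    by (simp add: nn_integral_measure_pmf nn_integral_count_space_nat)
  also have "\<dots> = ennreal (measure_pmf.expectation X h)"
    using h01 by (intro nn_integral_eq_integral measure_pmf.integrable_const_bound[where B=1]) auto
  finally show ?thesis
    using h01 by (simp add: emeasure_eq_measure integral_nonneg_AE)
qed

lemma survive_iter_1: "survive_iter n 1 = 1"
  by (induction n) (simp_all add: survive_1)

lemma prob_mm:
  assumes "0 \<le> p" "p \<le> 1"
  shows "prob {\<omega> \<in> space M. mm n v \<omega> \<le> p} = survive_iter n p"
proof (cases "p = 1")
  case True
  then show ?thesis using minmax_le_1 prob_space by (simp add: mm_def survive_iter_1)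
next
  case False
  then have p: "p < 1" using assms by simp
  show ?thesis
  proof (induction n arbitrary: v)
    case 0
    then show ?case using assms prob_space by (simp add: mm_def)
  next
    case (Suc n)
    note s = survive_iter_bounds[OF assms, of n]
    have ps: "0 \<le> p * survive_iter n p" "p * survive_iter n p \<le> 1" using s assms by (auto intro: mult_le_one)
    have "prob {\<omega> \<in> space M. p < mm (Suc n) v \<omega>} = measure_pmf.expectation X (\<lambda>m. (1 - p * survive_iter n p) ^ m)"
      by (rule prob_sum_N[of _ v]) (use prob_mm_Suc[OF assms(1) p Suc] ps in \<open>auto intro: power_le_one\<close>)
    moreover have "prob {\<omega> \<in> space M. \<not> mm (Suc n) v \<omega> \<le> p} = 1 - prob {\<omega> \<in> space M. mm (Suc n) v \<omega> \<le> p}"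
      by (rule prob_neg) measurable
    ultimately show ?case by (simp add: survive_def not_le)
  qed
qed

lemma prob_lev_le:
  assumes "0 \<le> p" "p \<le> 1"
  shows "prob {\<omega> \<in> space M. lev v \<omega> \<le> p} = survival p"
proof -
  have "(\<lambda>n. prob {\<omega> \<in> space M. mm n v \<omega> \<le> p}) \<longlonglongrightarrow> prob (\<Inter>n. {\<omega> \<in> space M. mm n v \<omega> \<le> p})"
    by (intro finite_Lim_measure_decseq decseq_SucI)
       (auto simp: mm_def simp del: minmax.simps intro: order_trans[OF minmax_Suc_mono])
  moreover have "(\<Inter>n. {\<omega> \<in> space M. mm n v \<omega> \<le> p}) = {\<omega> \<in> space M. lev v \<omega> \<le> p}"
    by (auto simp: lev_def mm_def level_le_iff)
  ultimately show ?thesis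
    using survive_iter_tendsto[OF assms] LIMSEQ_unique unfolding prob_mm[OF assms] by metis
qed

lemma prob_N_lev_gt:
  assumes "0 \<le> p" "p \<le> 1"
  shows "prob {\<omega> \<in> space M. N v \<omega> = m \<and> p < lev v \<omega>} = pmf X m * (1 - survival_hat p) ^ m"
proof (cases "p = 1")
  case True
  have "{\<omega> \<in> space M. N v \<omega> = m \<and> p < lev v \<omega>} = {}" using lev_bounds(2) True by (auto simp: not_less)
  \<comment> \<open>The right-hand side is \<open>pmf X m * 0 ^ m\<close>, which vanishes also for m
    = 0 because \<open>pmf X 0 = 0\<close>.\<close>
  then show ?thesis using True pmf_X_0 survival_hat_1 by (cases m) (simp_all only: measure_empty, auto)
next
  case False
  then have p: "p < 1" using assms by simp
  let ?A = "\<lambda>n. {\<omega> \<in> space M. N v \<omega> = m \<and> p < mm (Suc n) v \<omega>}"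
  have "(\<lambda>n. prob (?A n)) \<longlonglongrightarrow> prob (\<Union>n. ?A n)"
    by (intro finite_Lim_measure_incseq incseq_SucI)
       (auto simp: mm_def simp del: minmax.simps intro: less_le_trans[OF _ minmax_Suc_mono])
  moreover have "(\<Union>n. ?A n) = {\<omega> \<in> space M. N v \<omega> = m \<and> p < lev v \<omega>}"
  proof -
    have "p < lev v \<omega> \<longleftrightarrow> (\<exists>n. p < mm (Suc n) v \<omega>)" for \<omega>
    proof -
      have "p < lev v \<omega> \<longleftrightarrow> (\<exists>n. p < mm n v \<omega>)"
        unfolding lev_def mm_def using level_le_iff[of _ _ v p] by (metis not_le)
      also have "\<dots> \<longleftrightarrow> (\<exists>n. p < mm (Suc n) v \<omega>)"
        unfolding mm_def using minmax_Suc_mono less_le_trans by metis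
      finally show ?thesis .
    qed
    then show ?thesis by auto
  qed
  moreover have "prob (?A n) = pmf X m * (1 - p * survive_iter n p) ^ m" for n
    by (rule prob_mm_Suc[OF assms(1) p]) (rule prob_mm[OF assms])
  moreover have "(\<lambda>n. pmf X m * (1 - p * survive_iter n p) ^ m) \<longlonglongrightarrow> pmf X m * (1 - survival_hat p) ^ m"
    unfolding survival_hat_def by (intro tendsto_intros survive_iter_tendsto assms)
  ultimately show ?thesis by (simp add: LIMSEQ_unique)
qed

lemma prob_elev_le:
  assumes "v \<noteq> []" "0 \<le> p" "p \<le> 1"
  shows "prob {\<omega> \<in> space M. elev v \<omega> \<le> p} = survival_hat p"
proof -
  have sub: "{Inr v} \<subseteq> coords" using assms(1) by (auto simp: coords_def)
  have [measurable]: "(\<lambda>y. ucfg y v) \<in> borel_measurable (PiM {Inr v} (\<lambda>_. borel))"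
    unfolding ucfg_def by (rule measurable_PiM_coord)
  have "prob {\<omega> \<in> space M. ucfg (restr {Inr v} \<omega>) v \<le> p \<and>
      level (dcfg (restr (down v) \<omega>)) (ucfg (restr (down v) \<omega>)) v \<le> p} =
    prob {\<omega> \<in> space M. ucfg (restr {Inr v} \<omega>) v \<le> p} *
    prob {\<omega> \<in> space M. level (dcfg (restr (down v) \<omega>)) (ucfg (restr (down v) \<omega>)) v \<le> p}"
    by (rule prob_indep[where P="\<lambda>y. ucfg y v \<le> p" and Q="\<lambda>y. level (dcfg y) (ucfg y) v \<le> p"])
       (use sub down_subset in \<open>auto simp: down_def\<close>)
  then show ?thesis
    using prob_U_le[OF assms] prob_lev_le[OF assms(2,3)]
    by (simp add: ucfg_restr lev_restr elev_eq survival_hat_def)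
qed

end

context bp_model
begin

text \<open>An atom at r is trivially excluded outside [0,1] and where the distribution function
  vanishes. Elsewhere r = \<open>1 / slope q\<close>, and the points \<open>1 / slope q'\<close>
  with q' increasing to q lie below r and have distribution function q', so there is no
  jump.\<close>

lemma prob_elev_eq:
  assumes v: "v \<noteq> []"
  shows "prob {\<omega> \<in> space M. elev v \<omega> = r} = 0"
proof -
  note [measurable] = measurable_elev[OF v]
  consider "r < 0" | "1 < r" | "0 \<le> r" "r \<le> 1" "survival_hat r = 0" | "0 \<le> r" "r \<le> 1" "0 < survival_hat r"
    using survival_hat_bounds(1)[of r] by linarith
  then show ?thesis
  proof cases
    case 1
    have "0 \<le> elev v \<omega>" for \<omega> using lev_bounds(1)[of v \<omega>] by (simp add: elev_eq)
    then have "{\<omega> \<in> space M. elev v \<omega> = r} = {}" using 1 by (auto simp: not_le[symmetric])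
    then show ?thesis by (simp only: measure_empty)
  next
    case 2
    have "AE \<omega> in M. \<not> elev v \<omega> = r"
      using AE_U[OF v]
    proof eventually_elim
      case (elim \<omega>)
      then show ?case using lev_bounds(2)[of v \<omega>] 2 by (auto simp: elev_eq)
    qed
    then show ?thesis by (subst prob_eq_0) auto
  next
    case 3
    have "prob {\<omega> \<in> space M. elev v \<omega> = r} \<le> prob {\<omega> \<in> space M. elev v \<omega> \<le> r}"
      by (rule finite_measure_mono) auto
    then show ?thesis using prob_elev_le[OF v 3(1,2)] 3(3) by (simp add: measure_le_0_iff)
  next
    case 4
    define q where "q = survival_hat r"
    have q: "0 < q" "q \<le> 1" using 4 survival_hat_bounds by (auto simp: q_def)
    have r: "r = 1 / slope q" unfolding q_def by (rule survival_hat_eq_imp) (use 4 in auto)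
    have le: "prob {\<omega> \<in> space M. elev v \<omega> = r} \<le> q - q'" if q': "0 < q'" "q' < q" for q'
    proof -
      let ?r = "1 / slope q'"
      have r': "0 \<le> ?r" "?r \<le> 1" "?r < r"
        using inverse_slope_bounds[of q'] inverse_slope_strict_mono[of q' q] q' q r by auto
      have "prob {\<omega> \<in> space M. elev v \<omega> = r} \<le> prob ({\<omega> \<in> space M. elev v \<omega> \<le> r} - {\<omega> \<in> space M. elev v \<omega> \<le> ?r})"
        by (rule finite_measure_mono) (use r' in auto)
      also have "\<dots> = prob {\<omega> \<in> space M. elev v \<omega> \<le> r} - prob {\<omega> \<in> space M. elev v \<omega> \<le> ?r}"
        by (rule finite_measure_Diff) (use r' in auto)
      also have "\<dots> = q - q'"
        using prob_elev_le[OF v 4(1,2)] prob_elev_le[OF v r'(1,2)] survival_hat_inverse_slope[of q'] q' q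
        by (simp add: q_def)
      finally show ?thesis .
    qed
    have "prob {\<omega> \<in> space M. elev v \<omega> = r} \<le> e" if "0 < e" for e
    proof -
      \<comment> \<open>The maximum keeps q' strictly between 0 and q while the gap is at most
        e.\<close>
      have "prob {\<omega> \<in> space M. elev v \<omega> = r} \<le> q - max (q - e) (q / 2)"
        by (rule le) (use q that in auto)
      then show ?thesis by linarith
    qed
    then have "prob {\<omega> \<in> space M. elev v \<omega> = r} \<le> 0" by (rule field_le_epsilon) simp
    then show ?thesis by (simp add: measure_le_0_iff)
  qed
qed

text \<open>The two values depend on disjoint blocks; once one of them is frozen, the other hits it
  with probability 0.\<close>

lemma AE_elev_distinct:
  assumes "i \<noteq> j"
  shows "AE \<omega> in M. elev (v @ [i]) \<omega> \<noteq> elev (v @ [j]) \<omega>"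
proof -
  let ?A = "edown (v @ [i])" and ?B = "edown (v @ [j])"
  let ?f = "\<lambda>y. elevel (dcfg y) (ucfg y) (v @ [i])" and ?g = "\<lambda>y. elevel (dcfg y) (ucfg y) (v @ [j])"
  have AB: "?A \<inter> ?B = {}" "?A \<subseteq> coords" "?B \<subseteq> coords"
  proof -
    show "?A \<inter> ?B = {}" using assms by (auto simp: edown_def prefix_def)
  qed (rule down_subset(2), simp)+
  note [measurable] = measurable_elev[of "v @ [i]", simplified] measurable_elev[of "v @ [j]", simplified]
  have eq: "?f (restr ?A \<omega>) = elev (v @ [i]) \<omega>" "?g (restr ?B \<omega>) = elev (v @ [j]) \<omega>" for \<omega>
    by (simp_all add: elev_restr)
  have "(\<integral>\<^sup>+\<omega>. indicator {\<omega> \<in> space M. elev (v @ [i]) \<omega> = elev (v @ [j]) \<omega>} \<omega> \<partial>M) =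
    (\<integral>\<^sup>+\<omega>. (if ?f (restr ?A \<omega>) = ?g (restr ?B \<omega>) then 1 else 0) \<partial>M)"
    unfolding eq by (rule nn_integral_cong) (auto simp: indicator_def)
  also have "\<dots> = (\<integral>\<^sup>+\<omega>. \<integral>\<^sup>+\<omega>'. (if ?f (restr ?A \<omega>) = ?g (restr ?B \<omega>') then 1 else 0) \<partial>M \<partial>M)"
    by (rule nn_integral_indep[OF AB, where F="\<lambda>y y'. if ?f y = ?g y' then 1 else 0"]) measurable
  also have "\<dots> = (\<integral>\<^sup>+\<omega>. 0 \<partial>M)"
  proof (rule nn_integral_cong)
    fix \<omega>
    have "(\<integral>\<^sup>+\<omega>'. (if ?f (restr ?A \<omega>) = ?g (restr ?B \<omega>') then 1 else 0) \<partial>M) =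
      (\<integral>\<^sup>+\<omega>'. indicator {\<omega>' \<in> space M. elev (v @ [j]) \<omega>' = elev (v @ [i]) \<omega>} \<omega>' \<partial>M)"
      unfolding eq by (rule nn_integral_cong) (auto simp: indicator_def)
    also have "\<dots> = emeasure M {\<omega>' \<in> space M. elev (v @ [j]) \<omega>' = elev (v @ [i]) \<omega>}"
      by (rule nn_integral_indicator) measurable
    also have "\<dots> = 0" using prob_elev_eq[of "v @ [j]"] by (simp add: emeasure_eq_measure)
    finally show "(\<integral>\<^sup>+\<omega>'. (if ?f (restr ?A \<omega>) = ?g (restr ?B \<omega>') then 1 else 0) \<partial>M) = 0" .
  qed
  finally have "emeasure M {\<omega> \<in> space M. elev (v @ [i]) \<omega> = elev (v @ [j]) \<omega>} = 0"
    by (subst (asm) nn_integral_indicator) auto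
  then show ?thesis by (subst AE_iff_measurable[OF _ refl]) auto
qed

lemma AE_good: "AE \<omega> in M. good_config (\<lambda>v. N v \<omega>) (\<lambda>v. U v \<omega>)"
proof -
  have "AE \<omega> in M. \<forall>v. 0 < N v \<omega>" using AE_N_pos by (simp add: AE_all_countable)
  moreover have "AE \<omega> in M. \<forall>v. v \<noteq> [] \<longrightarrow> 0 \<le> U v \<omega> \<and> U v \<omega> \<le> 1"
    unfolding AE_all_countable using AE_U by (auto intro: AE_impI)
  moreover have "AE \<omega> in M. \<forall>v i j. i \<noteq> j \<longrightarrow> elev (v @ [i]) \<omega> \<noteq> elev (v @ [j]) \<omega>"
    unfolding AE_all_countable using AE_elev_distinct by (auto intro: AE_impI)
  ultimately show ?thesis
    by eventually_elim (unfold_locales, auto simp: elev_def)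
qed

subsection \<open>The percolation function\<close>

abbreviation th :: "real \<Rightarrow> real" where
  "th \<equiv> theta_hat M N U"

lemma borel_measurable_th [measurable]: "th \<in> borel_measurable borel"
proof -
  have "mono (theta M N U)"
  proof (rule monoI)
    fix p p' :: real assume "p \<le> p'"
    have "infinite (root_component (\<lambda>v. N v \<omega>) (\<lambda>v. U v \<omega>) p')"
      if "infinite (root_component (\<lambda>v. N v \<omega>) (\<lambda>v. U v \<omega>) p)" for \<omega>
    proof (rule infinite_super[OF _ that])
      show "root_component (\<lambda>v. N v \<omega>) (\<lambda>v. U v \<omega>) p \<subseteq> root_component (\<lambda>v. N v \<omega>) (\<lambda>v. U v \<omega>) p'"
        unfolding root_component_eq open_vertices_def using \<open>p \<le> p'\<close> by fastforce
    qed
    then show "theta M N U p \<le> theta M N U p'"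
      unfolding theta_def by (intro finite_measure_mono) auto
  qed
  then have [measurable]: "theta M N U \<in> borel_measurable borel" by (rule borel_measurable_mono)
  show ?thesis unfolding theta_hat_def[abs_def] by measurable
qed

lemma th_eq:
  assumes "0 \<le> p" "p \<le> 1"
  shows "th p = survival_hat p"
proof -
  have "prob {\<omega> \<in> space M. infinite (root_component (\<lambda>v. N v \<omega>) (\<lambda>v. U v \<omega>) p)} = prob {\<omega> \<in> space M. lev [] \<omega> \<le> p}"
  proof (rule finite_measure_eq_AE)
    show "AE \<omega> in M. \<omega> \<in> {\<omega> \<in> space M. infinite (root_component (\<lambda>v. N v \<omega>) (\<lambda>v. U v \<omega>) p)} \<longleftrightarrow>
      \<omega> \<in> {\<omega> \<in> space M. lev [] \<omega> \<le> p}"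
      using AE_good
    proof eventually_elim
      case (elim \<omega>)
      interpret good_config "\<lambda>v. N v \<omega>" "\<lambda>v. U v \<omega>" by fact
      show ?case using infinite_root_component_level[OF d_pos u_le_1 assms(1)] by (simp add: lev_def)
    qed
  qed auto
  then show ?thesis using prob_lev_le[OF assms] by (simp add: theta_hat_def theta_def survival_hat_def)
qed

lemma th_lev_gt_iff:
  assumes "0 < q" "q \<le> 1" "0 \<le> p" "p \<le> 1"
  shows "q < th p \<longleftrightarrow> 1 / slope q < p"
proof -
  note b = inverse_slope_bounds[OF assms(1,2)]
  note i = survival_hat_inverse_slope[OF assms(1,2)]
  show ?thesis unfolding th_eq[OF assms(3,4)]
  proof
    assume "q < survival_hat p"
    then show "1 / slope q < p" using survival_hat_mono[of p "1 / slope q"] assms b i by (metis not_le)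
  next
    assume p: "1 / slope q < p"
    then have le: "q \<le> survival_hat p" using survival_hat_mono[of "1 / slope q" p] assms b i by auto
    moreover have "q \<noteq> survival_hat p"
      using survival_hat_eq_imp[OF assms(3,4)] p le assms(1) by auto
    ultimately show "q < survival_hat p" by simp
  qed
qed

subsection \<open>The joint law of the degree and the level\<close>

lemma measurable_indicator_N [measurable]: "(\<lambda>\<omega>. indicator {n} (N v \<omega>) :: ennreal) \<in> borel_measurable M"
  by (rule measurable_compose[OF measurable_N]) simp

text \<open>In s, the tilted weight is minus the derivative of \<open>pmf X n * (1 - s) ^ n\<close>,
  the joint tail of degree and level. This is where the factor n, hence j = 1, comes from.\<close>

lemma integral_tilt_density:
  assumes "0 \<le> x" "x < 1"
  shows "(\<integral>\<^sup>+ s. ennreal (tilt X 1 s {n}) * indicator {0<..<1} s * indicator {x<..} s \<partial>lborel) =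
    ennreal (pmf X n * (1 - x) ^ n)"
proof -
  have "(\<integral>\<^sup>+ s. ennreal (tilt X 1 s {n}) * indicator {0<..<1} s * indicator {x<..} s \<partial>lborel) =
    (\<integral>\<^sup>+ s. ennreal (real n * (1 - s) ^ (n - 1) * pmf X n) * indicator {x..1} s \<partial>lborel)"
  proof (rule nn_integral_cong_AE)
    have "AE s in lborel. s \<noteq> x" "AE s in lborel. s \<noteq> (1::real)" by (rule AE_lborel_singleton)+
    then show "AE s in lborel. ennreal (tilt X 1 s {n}) * indicator {0<..<1} s * indicator {x<..} s =
      ennreal (real n * (1 - s) ^ (n - 1) * pmf X n) * indicator {x..1} s"
      by eventually_elim (use assms in \<open>auto simp: tilt_single indicator_def\<close>)
  qed
  also have "\<dots> = ennreal (- ((1 - 1) ^ n * pmf X n) - - ((1 - x) ^ n * pmf X n))"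
    by (rule nn_integral_FTC_Icc)
       (use assms in \<open>auto intro!: derivative_eq_intros simp: has_real_derivative_iff_has_vector_derivative[symmetric]\<close>)
  also have "- ((1 - 1) ^ n * pmf X n) - - ((1 - x) ^ n * pmf X n) = pmf X n * (1 - x) ^ n"
    \<comment> \<open>For n = 0 the boundary value at s = 1 is \<open>pmf X 0\<close>, not
      automatically 0.\<close>
    using pmf_X_0 by (cases n) auto
  finally show ?thesis .
qed

lemma law_N_th_lev:
  assumes [measurable]: "\<psi> \<in> borel_measurable borel"
  shows "(\<integral>\<^sup>+\<omega>. \<psi> (th (lev v \<omega>)) * indicator {n} (N v \<omega>) \<partial>M) =
    (\<integral>\<^sup>+ s. \<psi> s * (ennreal (tilt X 1 s {n}) * indicator {0<..<1} s) \<partial>lborel)"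
proof -
  let ?Q = "\<lambda>\<omega>. th (lev v \<omega>)"
  let ?d = "\<lambda>\<omega>. indicator {n} (N v \<omega>) :: ennreal"
  let ?\<mu> = "distr (density M ?d) borel ?Q"
  let ?\<nu> = "density lborel (\<lambda>s. ennreal (tilt X 1 s {n}) * indicator {0<..<1} s)"
  have Qb: "0 \<le> ?Q \<omega>" "?Q \<omega> \<le> 1" for \<omega>
    using lev_bounds[of v \<omega>] by (simp_all add: th_eq survival_hat_bounds)
  have mu: "emeasure ?\<mu> {x<..} = emeasure M {\<omega> \<in> space M. N v \<omega> = n \<and> x < ?Q \<omega>}" for x
  proof -
    have "emeasure ?\<mu> {x<..} = (\<integral>\<^sup>+\<omega>. ?d \<omega> * indicator (?Q -` {x<..} \<inter> space M) \<omega> \<partial>M)"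
      by (subst emeasure_distr; (subst emeasure_density)?) auto
    also have "\<dots> = (\<integral>\<^sup>+\<omega>. indicator {\<omega> \<in> space M. N v \<omega> = n \<and> x < ?Q \<omega>} \<omega> \<partial>M)"
      by (rule nn_integral_cong) (auto simp: indicator_def)
    also have "\<dots> = emeasure M {\<omega> \<in> space M. N v \<omega> = n \<and> x < ?Q \<omega>}"
      by (rule nn_integral_indicator) measurable
    finally show ?thesis .
  qed
  have nu: "emeasure ?\<nu> {x<..} = (\<integral>\<^sup>+ s. ennreal (tilt X 1 s {n}) * indicator {0<..<1} s * indicator {x<..} s \<partial>lborel)" for x
    by (rule emeasure_density) auto
  have pos: "prob {\<omega> \<in> space M. N v \<omega> = n \<and> x < ?Q \<omega>} = pmf X n * (1 - x) ^ n" if "0 < x" "x < 1" for x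
  proof -
    have "{\<omega> \<in> space M. N v \<omega> = n \<and> x < ?Q \<omega>} = {\<omega> \<in> space M. N v \<omega> = n \<and> 1 / slope x < lev v \<omega>}"
      using th_lev_gt_iff that lev_bounds by auto
    then show ?thesis
      using prob_N_lev_gt[of "1 / slope x" v n] inverse_slope_bounds[of x] survival_hat_inverse_slope[of x] that by simp
  qed
  \<comment> \<open>The value x = 0 is reached as a limit from above, since \<open>pos\<close>
    requires positive x. It shows that no mass of the law sits at 0.\<close>
  have zero: "prob {\<omega> \<in> space M. N v \<omega> = n \<and> 0 < ?Q \<omega>} = pmf X n"
  proof -
    let ?x = "\<lambda>m. inverse (real (Suc (Suc m)))"
    let ?A = "\<lambda>m. {\<omega> \<in> space M. N v \<omega> = n \<and> ?x m < ?Q \<omega>}"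
    have x: "0 < ?x m" "?x m < 1" "?x (Suc m) \<le> ?x m" for m by (simp_all add: field_simps)
    have "(\<lambda>m. prob (?A m)) \<longlonglongrightarrow> prob (\<Union>m. ?A m)"
    proof (intro finite_Lim_measure_incseq incseq_SucI)
      show "?A m \<subseteq> ?A (Suc m)" for m using le_less_trans[OF x(3)] by blast
    qed auto
    moreover have "(\<Union>m. ?A m) = {\<omega> \<in> space M. N v \<omega> = n \<and> 0 < ?Q \<omega>}"
    proof -
      have "0 < ?Q \<omega> \<longleftrightarrow> (\<exists>m. ?x m < ?Q \<omega>)" for \<omega>
      proof
        assume "0 < ?Q \<omega>"
        then obtain m where "inverse (real (Suc m)) < ?Q \<omega>" using reals_Archimedean by blast
        moreover have "?x m \<le> inverse (real (Suc m))" by (rule le_imp_inverse_le) simp_all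
        ultimately show "\<exists>m. ?x m < ?Q \<omega>" using le_less_trans by blast
      next
        assume "\<exists>m. ?x m < ?Q \<omega>"
        then show "0 < ?Q \<omega>" using x(1) less_trans by blast
      qed
      then show ?thesis by auto
    qed
    moreover have "(\<lambda>m. pmf X n * (1 - ?x m) ^ n) \<longlonglongrightarrow> pmf X n * (1 - 0) ^ n"
      by (intro tendsto_intros LIMSEQ_Suc[OF LIMSEQ_inverse_real_of_nat])
    ultimately show ?thesis using pos[OF x(1,2)] by (simp add: LIMSEQ_unique)
  qed
  have "?\<mu> = ?\<nu>"
  proof (rule measure_eqI_lessThan)
    show "emeasure ?\<mu> {x<..} < \<infinity>" for x unfolding mu by (simp add: emeasure_eq_measure)
    fix x :: real
    consider "x < 0" | "x = 0" | "0 < x" "x < 1" | "1 \<le> x" by linarith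
    then show "emeasure ?\<mu> {x<..} = emeasure ?\<nu> {x<..}"
    proof cases
      case 1
      have "{\<omega> \<in> space M. N v \<omega> = n \<and> x < ?Q \<omega>} = {\<omega> \<in> space M. N v \<omega> = n}"
        using 1 Qb(1) by (auto intro: less_le_trans)
      moreover have "emeasure ?\<nu> {x<..} = emeasure ?\<nu> {0<..}"
        unfolding nu using 1 by (intro nn_integral_cong) (auto simp: indicator_def)
      ultimately show ?thesis unfolding mu nu using prob_N[of v n] integral_tilt_density[of 0 n]
        by (simp add: emeasure_eq_measure)
    next
      case 2
      then show ?thesis unfolding mu nu using zero integral_tilt_density[of 0 n] by (simp add: emeasure_eq_measure)
    next
      case 3
      then show ?thesis unfolding mu nu using pos integral_tilt_density[of x n] by (simp add: emeasure_eq_measure)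
    next
      case 4
      have "{\<omega> \<in> space M. N v \<omega> = n \<and> x < ?Q \<omega>} = {}" using 4 Qb(2) order_trans by (auto simp: not_less)
      moreover have "emeasure ?\<nu> {x<..} = 0"
        unfolding nu using 4 by (intro nn_integral_zero') (auto simp: indicator_def)
      ultimately show ?thesis unfolding mu by (simp only: emeasure_empty)
    qed
  qed auto
  then have "(\<integral>\<^sup>+ s. \<psi> s \<partial>?\<mu>) = (\<integral>\<^sup>+ s. \<psi> s \<partial>?\<nu>)" by simp
  then show ?thesis
    by (simp add: nn_integral_distr nn_integral_density mult.commute)
qed

lemma law_th_lev:
  assumes [measurable]: "\<psi> \<in> borel_measurable borel"
  shows "(\<integral>\<^sup>+\<omega>. \<psi> (th (lev v \<omega>)) \<partial>M) = (\<integral>\<^sup>+ s. \<psi> s * (ennreal (tilt X 1 s UNIV) * indicator {0<..<1} s) \<partial>lborel)"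
proof -
  have "(\<integral>\<^sup>+\<omega>. \<psi> (th (lev v \<omega>)) \<partial>M) = (\<integral>\<^sup>+\<omega>. (\<Sum>n. \<psi> (th (lev v \<omega>)) * indicator {n} (N v \<omega>)) \<partial>M)"
  proof (rule nn_integral_cong)
    fix \<omega>
    have "(\<Sum>n. \<psi> (th (lev v \<omega>)) * indicator {n} (N v \<omega>)) = (\<Sum>n\<in>{N v \<omega>}. \<psi> (th (lev v \<omega>)) * indicator {n} (N v \<omega>))"
      by (rule suminf_finite) auto
    then show "\<psi> (th (lev v \<omega>)) = (\<Sum>n. \<psi> (th (lev v \<omega>)) * indicator {n} (N v \<omega>))" by simp
  qed
  also have "\<dots> = (\<Sum>n. \<integral>\<^sup>+\<omega>. \<psi> (th (lev v \<omega>)) * indicator {n} (N v \<omega>) \<partial>M)"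
    by (rule nn_integral_suminf) measurable
  also have "\<dots> = (\<Sum>n. \<integral>\<^sup>+ s. \<psi> s * (ennreal (tilt X 1 s {n}) * indicator {0<..<1} s) \<partial>lborel)"
    by (simp only: law_N_th_lev[OF assms])
  also have "\<dots> = (\<integral>\<^sup>+ s. (\<Sum>n. \<psi> s * (ennreal (tilt X 1 s {n}) * indicator {0<..<1} s)) \<partial>lborel)"
    by (rule nn_integral_suminf[symmetric]) measurable
  also have "\<dots> = (\<integral>\<^sup>+ s. \<psi> s * (ennreal (tilt X 1 s UNIV) * indicator {0<..<1} s) \<partial>lborel)"
  proof (rule nn_integral_cong)
    fix s
    show "(\<Sum>n. \<psi> s * (ennreal (tilt X 1 s {n}) * indicator {0<..<1} s)) = \<psi> s * (ennreal (tilt X 1 s UNIV) * indicator {0<..<1} s)"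
    proof (cases "s \<in> {0<..<1}")
      case True
      then have "ennreal (tilt X 1 s UNIV) = (\<Sum>n. ennreal (tilt X 1 s {n}))"
        using ennreal_tilt[of s X 1 UNIV] by simp
      then show ?thesis using True by simp
    qed simp
  qed
  finally show ?thesis .
qed

lemma AE_th_lev: "AE \<omega> in M. 0 < th (lev v \<omega>) \<and> th (lev v \<omega>) < 1"
proof -
  have "(\<integral>\<^sup>+\<omega>. indicator (- {0<..<1}) (th (lev v \<omega>)) \<partial>M) =
    (\<integral>\<^sup>+ s. indicator (- {0<..<1}) s * (ennreal (tilt X 1 s UNIV) * indicator {0<..<1} s) \<partial>lborel)"
    by (rule law_th_lev) measurable
  also have "\<dots> = (\<integral>\<^sup>+ s. 0 \<partial>(lborel::real measure))" by (rule nn_integral_cong) (auto simp: indicator_def)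
  finally have "(\<integral>\<^sup>+\<omega>. indicator (- {0<..<1}) (th (lev v \<omega>)) \<partial>M) = 0" by simp
  then have "AE \<omega> in M. indicator (- {0<..<1}) (th (lev v \<omega>)) = (0::ennreal)"
    by (subst (asm) nn_integral_0_iff_AE) auto
  then show ?thesis by eventually_elim (auto simp: indicator_def split: if_splits)
qed

text \<open>Both sides are integrals over the law of \<open>th (lev v)\<close>, from which \<open>lev v\<close> is recovered by inverting \<open>th\<close>.\<close>

lemma law_N_lev:
  assumes [measurable]: "\<phi> \<in> borel_measurable borel"
  shows "(\<integral>\<^sup>+\<omega>. \<phi> (lev v \<omega>) * indicator {n} (N v \<omega>) \<partial>M) =
    (\<integral>\<^sup>+\<omega>. \<phi> (lev v \<omega>) * ennreal (tilt_prob X 1 (th (lev v \<omega>)) {n}) \<partial>M)"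
proof -
  \<comment> \<open>On (0,1] this is \<open>1 / slope s\<close>, the inverse of
    \<open>survival_hat\<close>.\<close>
  define inv where "inv s = s / survive s" for s
  have [measurable]: "inv \<in> borel_measurable borel" unfolding inv_def survive_def by measurable
  have inv: "AE \<omega> in M. inv (th (lev v \<omega>)) = lev v \<omega>"
    using AE_th_lev[of v]
  proof eventually_elim
    case (elim \<omega>)
    have "lev v \<omega> = 1 / slope (th (lev v \<omega>))"
      using survival_hat_eq_imp[OF lev_bounds] elim by (simp add: th_eq lev_bounds)
    then show ?case using survive_eq_slope[of "th (lev v \<omega>)"] elim by (simp add: inv_def)
  qed
  have "(\<integral>\<^sup>+\<omega>. \<phi> (lev v \<omega>) * indicator {n} (N v \<omega>) \<partial>M) =
    (\<integral>\<^sup>+\<omega>. \<phi> (inv (th (lev v \<omega>))) * indicator {n} (N v \<omega>) \<partial>M)"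
    by (rule nn_integral_cong_AE) (use inv in eventually_elim, simp)
  also have "\<dots> = (\<integral>\<^sup>+ s. \<phi> (inv s) * (ennreal (tilt X 1 s {n}) * indicator {0<..<1} s) \<partial>lborel)"
    by (rule law_N_th_lev) measurable
  also have "\<dots> = (\<integral>\<^sup>+ s. (\<phi> (inv s) * ennreal (tilt_prob X 1 s {n})) * (ennreal (tilt X 1 s UNIV) * indicator {0<..<1} s) \<partial>lborel)"
  proof (rule nn_integral_cong)
    fix s
    show "\<phi> (inv s) * (ennreal (tilt X 1 s {n}) * indicator {0<..<1} s) =
      (\<phi> (inv s) * ennreal (tilt_prob X 1 s {n})) * (ennreal (tilt X 1 s UNIV) * indicator {0<..<1} s)"
    proof (cases "s \<in> {0<..<1}")
      case True
      then have s: "0 < s" "s < 1" by auto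
      have "ennreal (tilt X 1 s {n}) = ennreal (tilt_prob X 1 s {n}) * ennreal (tilt X 1 s UNIV)"
        using tilt_UNIV_pos[OF s, of 1] tilt_prob_bounds(1)[OF s, of 1 "{n}"]
        by (subst ennreal_mult[symmetric]) (auto simp: tilt_prob_def)
      then show ?thesis using True by (simp add: mult.assoc)
    qed simp
  qed
  also have "\<dots> = (\<integral>\<^sup>+\<omega>. \<phi> (inv (th (lev v \<omega>))) * ennreal (tilt_prob X 1 (th (lev v \<omega>)) {n}) \<partial>M)"
    by (rule law_th_lev[symmetric]) measurable
  also have "\<dots> = (\<integral>\<^sup>+\<omega>. \<phi> (lev v \<omega>) * ennreal (tilt_prob X 1 (th (lev v \<omega>)) {n}) \<partial>M)"
    by (rule nn_integral_cong_AE) (use inv in eventually_elim, simp)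
  finally show ?thesis .
qed

end

section \<open>Joint law of degree and future maximum at the backbone vertex\<close>

lemma random_config_compose:
  assumes "random_config M d u" and g: "g \<in> M' \<rightarrow>\<^sub>M M"
  shows "random_config M' (\<lambda>z. d (g z)) (\<lambda>z. u (g z))"
proof -
  interpret random_config M d u by fact
  show ?thesis
    using measurable_compose[OF g measurable_d] measurable_compose[OF g measurable_u] by unfold_locales
qed

text \<open>Reduces comparisons along the random backbone vertex to its countably many possible
  values. Used in both directions it also yields equalities.\<close>

lemma nn_integral_mono_partition:
  fixes b :: "'a \<Rightarrow> 'b :: countable"
  assumes b [measurable]: "b \<in> M \<rightarrow>\<^sub>M count_space UNIV"
    and [measurable]: "f \<in> borel_measurable M" "g \<in> borel_measurable M"
    and le: "\<And>v. (\<integral>\<^sup>+\<omega>. f \<omega> * indicator {v} (b \<omega>) \<partial>M) \<le> (\<integral>\<^sup>+\<omega>. g \<omega> * indicator {v} (b \<omega>) \<partial>M)"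
  shows "(\<integral>\<^sup>+\<omega>. f \<omega> \<partial>M) \<le> (\<integral>\<^sup>+\<omega>. g \<omega> \<partial>M)"
proof -
  have split: "(\<integral>\<^sup>+\<omega>. h \<omega> \<partial>M) = (\<Sum>m. \<integral>\<^sup>+\<omega>. h \<omega> * indicator {m} (to_nat (b \<omega>)) \<partial>M)"
    if [measurable]: "h \<in> borel_measurable M" for h :: "'a \<Rightarrow> ennreal"
  proof -
    have [measurable]: "(\<lambda>\<omega>. indicator {m} (to_nat (b \<omega>)) :: ennreal) \<in> borel_measurable M" for m :: nat
      by (rule measurable_compose[OF b]) simp
    have "(\<integral>\<^sup>+\<omega>. h \<omega> \<partial>M) = (\<integral>\<^sup>+\<omega>. (\<Sum>m. h \<omega> * indicator {m} (to_nat (b \<omega>))) \<partial>M)"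
    proof (rule nn_integral_cong)
      fix \<omega>
      have "(\<Sum>m. h \<omega> * indicator {m} (to_nat (b \<omega>))) = (\<Sum>m\<in>{to_nat (b \<omega>)}. h \<omega> * indicator {m} (to_nat (b \<omega>)))"
        by (rule suminf_finite) auto
      then show "h \<omega> = (\<Sum>m. h \<omega> * indicator {m} (to_nat (b \<omega>)))" by simp
    qed
    also have "\<dots> = (\<Sum>m. \<integral>\<^sup>+\<omega>. h \<omega> * indicator {m} (to_nat (b \<omega>)) \<partial>M)"
      by (rule nn_integral_suminf) measurable
    finally show ?thesis .
  qed
  have "(\<integral>\<^sup>+\<omega>. f \<omega> * indicator {m} (to_nat (b \<omega>)) \<partial>M) \<le> (\<integral>\<^sup>+\<omega>. g \<omega> * indicator {m} (to_nat (b \<omega>)) \<partial>M)" for m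
  proof (cases "m \<in> range (to_nat :: 'b \<Rightarrow> nat)")
    case True
    then obtain v :: 'b where "m = to_nat v" by blast
    then have "indicator {m} (to_nat (b \<omega>)) = (indicator {v} (b \<omega>) :: ennreal)" for \<omega>
      by (simp add: indicator_def)
    then show ?thesis using le[of v] by simp
  next
    case False
    then have "indicator {m} (to_nat (b \<omega>)) = (0 :: ennreal)" for \<omega> by (auto simp: indicator_def)
    then show ?thesis by simp
  qed
  then show ?thesis by (subst (1 2) split) (auto intro: suminf_le)
qed

text \<open>The sequence is nonincreasing and bounded below, and its limit l satisfies l <= C * (l -
  l) = 0.\<close>

lemma tendsto_0_of_decrement:
  fixes x :: "nat \<Rightarrow> real"
  assumes x: "\<And>k. 0 \<le> x k" and C: "0 < C" "\<And>k. x k \<le> C * (x k - x (Suc k))"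
  shows "x \<longlonglongrightarrow> 0"
proof -
  have dec: "x (Suc k) \<le> x k" for k
  proof -
    have "0 \<le> C * (x k - x (Suc k))" using x[of k] C(2)[of k] by simp
    then show ?thesis using C(1) by (simp add: zero_le_mult_iff)
  qed
  then have "decseq x" by (rule decseq_SucI)
  then obtain l where l: "x \<longlonglongrightarrow> l" using decseq_convergent[of x 0] x by metis
  have "l \<le> C * (l - l)"
    using C(2) by (intro LIMSEQ_le[OF l tendsto_mult[OF tendsto_const tendsto_diff[OF l LIMSEQ_Suc[OF l]]]]) auto
  moreover have "0 \<le> l" using LIMSEQ_le_const[OF l] x by auto
  ultimately show ?thesis using l by simp
qed

context bp_model
begin

abbreviation bb :: "nat \<Rightarrow> 'a \<Rightarrow> vertex" where
  "bb k \<omega> \<equiv> backbone (\<lambda>v. N v \<omega>) (\<lambda>v. U v \<omega>) k"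

abbreviation fut :: "nat \<Rightarrow> 'a \<Rightarrow> real" where
  "fut \<equiv> future_max N U"

abbreviation deg :: "nat \<Rightarrow> 'a \<Rightarrow> nat" where
  "deg \<equiv> backbone_degree N U"

lemma measurable_fut [measurable]: "fut k \<in> borel_measurable M"
  unfolding future_max_def[abs_def] by measurable

lemma measurable_deg [measurable]: "deg k \<in> M \<rightarrow>\<^sub>M count_space UNIV"
  unfolding backbone_degree_def[abs_def] by measurable

lemma measurable_indicator_bb [measurable]:
  "(\<lambda>\<omega>. indicator {v} (bb k \<omega>) :: ennreal) \<in> borel_measurable M"
  by (rule measurable_compose[OF measurable_backbone]) simp

lemma measurable_indicator_deg [measurable]:
  "(\<lambda>\<omega>. indicator {n} (deg k \<omega>) :: ennreal) \<in> borel_measurable M"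
  by (rule measurable_compose[OF measurable_deg]) simp

lemma AE_fut_eq: "AE \<omega> in M. fut k \<omega> = lev (bb k \<omega>) \<omega>"
  using AE_good
proof eventually_elim
  case (elim \<omega>)
  interpret good_config "\<lambda>v. N v \<omega>" "\<lambda>v. U v \<omega>" by fact
  show ?case using level_backbone by (simp add: future_max_def lev_def)
qed

lemma AE_bb_iff: "AE \<omega> in M. bb k \<omega> = v \<longleftrightarrow>
  length v = k \<and> selects (\<lambda>v. N v \<omega>) (\<lambda>v. U v \<omega>) (rev v) (elev v \<omega>)"
  using AE_good
proof eventually_elim
  case (elim \<omega>)
  interpret good_config "\<lambda>v. N v \<omega>" "\<lambda>v. U v \<omega>" by fact
  show ?case unfolding elev_def by (rule backbone_iff_selects)
qed

lemma AE_fut_Suc: "AE \<omega> in M. fut k \<omega> = elev (bb (Suc k) \<omega>) \<omega>"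
  using AE_good
proof eventually_elim
  case (elim \<omega>)
  interpret good_config "\<lambda>v. N v \<omega>" "\<lambda>v. U v \<omega>" by fact
  obtain i where "bb (Suc k) \<omega> = bb k \<omega> @ [i]" "elevel (\<lambda>v. N v \<omega>) (\<lambda>v. U v \<omega>) (bb k \<omega> @ [i]) = level (\<lambda>v. N v \<omega>) (\<lambda>v. U v \<omega>) (bb k \<omega>)"
    using backbone_child[OF is_backbone_backbone] by blast
  then show ?case using level_backbone by (simp add: future_max_def elev_def)
qed

lemma AE_fut_bounds: "AE \<omega> in M. 0 \<le> fut k \<omega> \<and> fut k \<omega> \<le> 1"
  using AE_fut_eq[of k] by eventually_elim (simp add: lev_bounds)

text \<open>The outside coordinates \<open>y\<close> and the candidate value \<open>r\<close> are
  separate arguments, so that \<open>y\<close> can be frozen while \<open>r\<close> varies with the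
  subtree.\<close>

definition selG :: "vertex \<Rightarrow> (vertex + vertex \<Rightarrow> real) \<Rightarrow> real \<Rightarrow> ennreal" where
  "selG v y r = (if selects (dcfg y) (ucfg y) (rev v) r then 1 else 0)"

lemma measurable_selG:
  assumes [measurable]: "f \<in> P \<rightarrow>\<^sub>M PiM A (\<lambda>_. borel)" "g \<in> borel_measurable P"
  shows "(\<lambda>z. selG v (f z) (g z)) \<in> borel_measurable P"
proof -
  interpret random_config P "\<lambda>z. dcfg (f z)" "\<lambda>z. ucfg (f z)"
    by (rule random_config_compose[OF cfg.random_config_axioms]) measurable
  show ?thesis unfolding selG_def by measurable
qed

text \<open>If \<open>v\<close> is the backbone vertex, the future maximum is \<open>lev v\<close>,
  and the selection is a function of the outside and of \<open>lev v\<close>. With the outside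
  frozen, the selection is absorbed into the test function of \<open>law_N_lev\<close>.\<close>

lemma law_deg_fut_vertex:
  assumes [measurable]: "\<phi> \<in> borel_measurable borel"
  shows "(\<integral>\<^sup>+\<omega>. \<phi> (fut k \<omega>) * indicator {n} (deg k \<omega>) * indicator {v} (bb k \<omega>) \<partial>M) =
    (\<integral>\<^sup>+\<omega>. \<phi> (fut k \<omega>) * ennreal (tilt_prob X 1 (th (fut k \<omega>)) {n}) * indicator {v} (bb k \<omega>) \<partial>M)"
proof (cases "length v = k")
  case False
  then have "bb k \<omega> \<noteq> v" for \<omega> using length_backbone by blast
  then show ?thesis by simp
next
  case True
  \<comment> \<open>The weight of the edge above \<open>v\<close> belongs to the outer block, so the
    subtree enters the selection only through \<open>lev v\<close>.\<close>
  let ?A = "coords - down v" and ?B = "down v"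
  have AB: "?A \<inter> ?B = {}" "?A \<subseteq> coords" "?B \<subseteq> coords" using down_subset(1) by auto
  have cA: "coords - edown v \<subseteq> ?A" using down_subset_edown by auto
  let ?S = "\<lambda>y l. selG v y (max (ucfg y v) l)"
  have sel: "AE \<omega> in M. indicator {v} (bb k \<omega>) = ?S (restr ?A \<omega>) (lev v \<omega>) \<and> (bb k \<omega> = v \<longrightarrow> fut k \<omega> = lev v \<omega>)"
    using AE_fut_eq[of k] AE_bb_iff[of k v]
  proof eventually_elim
    case (elim \<omega>)
    have "selects (\<lambda>v. N v \<omega>) (\<lambda>v. U v \<omega>) (rev v) (max (ucfg (restr ?A \<omega>) v) (lev v \<omega>)) \<longleftrightarrow>
      selects (\<lambda>v. N v \<omega>) (\<lambda>v. U v \<omega>) (rev v) (elev v \<omega>)"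
    proof (cases "v = []")
      case False
      then have "Inr v \<in> ?A" by (auto simp: coords_def down_def)
      then show ?thesis by (simp add: ucfg_restr elev_eq)
    qed simp
    then show ?case using elim True unfolding selG_def selects_restr[OF cA] by (auto simp: indicator_def)
  qed
  have meas_u [measurable]: "(\<lambda>y. ucfg y v) \<in> borel_measurable (PiM ?A (\<lambda>_. borel))"
    unfolding ucfg_def by (rule measurable_PiM_coord)
  have meas_lev [measurable]: "(\<lambda>y. level (dcfg y) (ucfg y) v) \<in> borel_measurable (PiM ?B (\<lambda>_. borel))"
    by (rule cfg.measurable_level)
  have [measurable]: "case_prod ?S \<in> borel_measurable (PiM ?A (\<lambda>_. borel) \<Otimes>\<^sub>M borel)"
    unfolding split_beta' by (rule measurable_selG[where A="?A"]) measurable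
  \<comment> \<open>Used twice: with h the indicator of the degree to freeze the outside, and with h
    the tilted probability to undo this.\<close>
  have key: "(\<integral>\<^sup>+\<omega>. \<phi> (lev v \<omega>) * h \<omega> * ?S (restr ?A \<omega>) (lev v \<omega>) \<partial>M) =
    (\<integral>\<^sup>+\<omega>. \<integral>\<^sup>+\<omega>'. (\<phi> (lev v \<omega>') * ?S (restr ?A \<omega>) (lev v \<omega>')) * h \<omega>' \<partial>M \<partial>M)"
    if h: "\<And>\<omega>. h \<omega> = h' (restr ?B \<omega>)" and [measurable]: "h' \<in> borel_measurable (PiM ?B (\<lambda>_. borel))" for h h'
  proof -
    have l: "lev v \<omega> = level (dcfg (restr ?B \<omega>)) (ucfg (restr ?B \<omega>)) v" for \<omega> by (simp add: lev_restr)
    let ?F = "\<lambda>y y'. (\<phi> (level (dcfg y') (ucfg y') v) * ?S y (level (dcfg y') (ucfg y') v)) * h' y'"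
    have "(\<lambda>z. ?S (fst z) (level (dcfg (snd z)) (ucfg (snd z)) v)) \<in> borel_measurable (PiM ?A (\<lambda>_. borel) \<Otimes>\<^sub>M PiM ?B (\<lambda>_. borel))"
      by (rule measurable_selG[where A="?A"]) measurable
    then have "case_prod ?F \<in> borel_measurable (PiM ?A (\<lambda>_. borel) \<Otimes>\<^sub>M PiM ?B (\<lambda>_. borel))"
      unfolding split_beta' by measurable
    from nn_integral_indep[OF AB this] show ?thesis unfolding l h by (simp add: mult_ac)
  qed
  have eq1: "(\<integral>\<^sup>+\<omega>. \<phi> (fut k \<omega>) * indicator {n} (deg k \<omega>) * indicator {v} (bb k \<omega>) \<partial>M) =
    (\<integral>\<^sup>+\<omega>. \<phi> (lev v \<omega>) * indicator {n} (N v \<omega>) * ?S (restr ?A \<omega>) (lev v \<omega>) \<partial>M)"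
  proof (rule nn_integral_cong_AE)
    show "AE \<omega> in M. \<phi> (fut k \<omega>) * indicator {n} (deg k \<omega>) * indicator {v} (bb k \<omega>) =
      \<phi> (lev v \<omega>) * indicator {n} (N v \<omega>) * ?S (restr ?A \<omega>) (lev v \<omega>)"
      using sel
    proof eventually_elim
      case (elim \<omega>)
      then show ?case unfolding conjunct1[OF elim, symmetric]
        by (cases "bb k \<omega> = v") (auto simp: backbone_degree_def)
    qed
  qed
  also have "\<dots> = (\<integral>\<^sup>+\<omega>. \<integral>\<^sup>+\<omega>'. (\<phi> (lev v \<omega>') * ?S (restr ?A \<omega>) (lev v \<omega>')) * indicator {n} (N v \<omega>') \<partial>M \<partial>M)"
  proof (rule key)
    show "indicator {n} (N v \<omega>) = (indicator {n} (dcfg (restr ?B \<omega>) v) :: ennreal)" for \<omega>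
      by (simp add: dcfg_restr root_in_edown)
    show "(\<lambda>y. indicator {n} (dcfg y v) :: ennreal) \<in> borel_measurable (PiM ?B (\<lambda>_. borel))"
      by (rule measurable_compose[OF cfg.measurable_d]) simp
  qed
  also have "\<dots> = (\<integral>\<^sup>+\<omega>. \<integral>\<^sup>+\<omega>'. (\<phi> (lev v \<omega>') * ?S (restr ?A \<omega>) (lev v \<omega>')) * ennreal (tilt_prob X 1 (th (lev v \<omega>')) {n}) \<partial>M \<partial>M)"
  proof (rule nn_integral_cong)
    fix \<omega> assume "\<omega> \<in> space M"
    then have "restr ?A \<omega> \<in> space (PiM ?A (\<lambda>_. borel))" using measurable_space[OF measurable_restr[OF AB(2)]] by blast
    then have [measurable]: "(\<lambda>l. ?S (restr ?A \<omega>) l) \<in> borel_measurable borel"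
      by (rule measurable_Pair2[of "case_prod ?S", simplified, rotated]) measurable
    show "(\<integral>\<^sup>+\<omega>'. (\<phi> (lev v \<omega>') * ?S (restr ?A \<omega>) (lev v \<omega>')) * indicator {n} (N v \<omega>') \<partial>M) =
      (\<integral>\<^sup>+\<omega>'. (\<phi> (lev v \<omega>') * ?S (restr ?A \<omega>) (lev v \<omega>')) * ennreal (tilt_prob X 1 (th (lev v \<omega>')) {n}) \<partial>M)"
      by (rule law_N_lev[of "\<lambda>l. \<phi> l * ?S (restr ?A \<omega>) l"]) measurable
  qed
  also have "\<dots> = (\<integral>\<^sup>+\<omega>. \<phi> (lev v \<omega>) * ennreal (tilt_prob X 1 (th (lev v \<omega>)) {n}) * ?S (restr ?A \<omega>) (lev v \<omega>) \<partial>M)"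
  proof (rule key[symmetric])
    show "ennreal (tilt_prob X 1 (th (lev v \<omega>)) {n}) =
      ennreal (tilt_prob X 1 (th (level (dcfg (restr ?B \<omega>)) (ucfg (restr ?B \<omega>)) v)) {n})" for \<omega>
      by (simp add: lev_restr)
  qed measurable
  also have "\<dots> = (\<integral>\<^sup>+\<omega>. \<phi> (fut k \<omega>) * ennreal (tilt_prob X 1 (th (fut k \<omega>)) {n}) * indicator {v} (bb k \<omega>) \<partial>M)"
  proof (rule nn_integral_cong_AE)
    show "AE \<omega> in M. \<phi> (lev v \<omega>) * ennreal (tilt_prob X 1 (th (lev v \<omega>)) {n}) * ?S (restr ?A \<omega>) (lev v \<omega>) =
      \<phi> (fut k \<omega>) * ennreal (tilt_prob X 1 (th (fut k \<omega>)) {n}) * indicator {v} (bb k \<omega>)"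
      using sel
    proof eventually_elim
      case (elim \<omega>)
      then show ?case unfolding conjunct1[OF elim, symmetric] by (cases "bb k \<omega> = v") auto
    qed
  qed
  finally show ?thesis .
qed

lemma law_deg_fut:
  assumes [measurable]: "\<phi> \<in> borel_measurable borel"
  shows "(\<integral>\<^sup>+\<omega>. \<phi> (fut k \<omega>) * indicator {n} (deg k \<omega>) \<partial>M) =
    (\<integral>\<^sup>+\<omega>. \<phi> (fut k \<omega>) * ennreal (tilt_prob X 1 (th (fut k \<omega>)) {n}) \<partial>M)"
  by (rule antisym; rule nn_integral_mono_partition[OF measurable_backbone[of k]])
     (auto simp: law_deg_fut_vertex[OF assms])

lemma AE_th_fut: "AE \<omega> in M. 0 < th (fut k \<omega>) \<and> th (fut k \<omega>) < 1"
proof -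
  have "AE \<omega> in M. \<forall>v. 0 < th (lev v \<omega>) \<and> th (lev v \<omega>) < 1"
    unfolding AE_all_countable using AE_th_lev by blast
  with AE_fut_eq[of k] show ?thesis by eventually_elim simp
qed

subsection \<open>The future maximum decreases to the critical point\<close>

text \<open>If the next edge of the backbone or the level below it exceeds \<open>p\<close>, then with probability bounded
  below it is the edge alone, because \<open>survival_hat\<close> is Lipschitz beyond \<open>p\<close>.\<close>

lemma prob_elev_selected_le:
  assumes v: "v \<noteq> []" and q: "0 < q" "q < 1" "p = 1 / slope q"
    and J: "Measurable.pred borel J" "\<And>r r'. J r \<Longrightarrow> r' \<le> r \<Longrightarrow> J r'"
  shows "prob {\<omega> \<in> space M. p < elev v \<omega> \<and> J (elev v \<omega>)} \<le>
    (slope q)\<^sup>2 / measure_pmf.prob X {2..} / survival p *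
      prob {\<omega> \<in> space M. p < elev v \<omega> \<and> J (elev v \<omega>) \<and> lev v \<omega> \<le> p}"
proof -
  note [measurable] = measurable_elev[OF v] J(1) measurable_U[OF v]
  have p: "0 < p" "p \<le> 1" using inverse_slope_bounds[of q] q by auto
  have hat: "survival_hat p = q" using survival_hat_inverse_slope[of q] q by simp
  have "0 < p * survival p" using hat q(1) by (simp only: survival_hat_def)
  then have sp: "0 < survival p" using p(1) by (rule zero_less_mult_pos)
  let ?L = "(slope q)\<^sup>2 / measure_pmf.prob X {2..}"
  have L: "0 \<le> ?L" using prob_ge_2_pos by simp
  have elev1: "AE \<omega> in M. elev v \<omega> \<le> 1"
    using AE_U[OF v] by eventually_elim (simp add: elev_eq lev_bounds)
  show ?thesis
  proof (cases "\<exists>r. J r \<and> r \<le> 1 \<and> p < r")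
    case False
    have "AE \<omega> in M. \<not> (p < elev v \<omega> \<and> J (elev v \<omega>))"
      using elev1 by eventually_elim (use False in blast)
    then have "prob {\<omega> \<in> space M. p < elev v \<omega> \<and> J (elev v \<omega>)} = 0" by (subst prob_eq_0) auto
    then show ?thesis using L sp by simp
  next
    case True
    then obtain r0 where r0: "J r0" "r0 \<le> 1" "p < r0" by blast
    \<comment> \<open>The down-set \<open>J\<close> is, below 1, an interval ending at
      \<open>z\<close>. Whether \<open>z\<close> belongs to it does not matter: the upper estimate
      uses r <= z, the lower one r < z.\<close>
    define z where "z = Sup {r. J r \<and> r \<le> 1}"
    have bdd: "bdd_above {r. J r \<and> r \<le> 1}" by (auto intro: bdd_aboveI[of _ 1])
    have zu: "r \<le> z" if "J r" "r \<le> 1" for r unfolding z_def by (rule cSup_upper[OF _ bdd]) (use that in auto)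
    have z1: "z \<le> 1" unfolding z_def by (rule cSup_least) (use r0 in auto)
    have zJ: "J r" if "r < z" for r
    proof -
      have "{r. J r \<and> r \<le> 1} \<noteq> {}" using r0 by blast
      then have "r < z \<longleftrightarrow> (\<exists>r'\<in>{r. J r \<and> r \<le> 1}. r < r')" unfolding z_def by (rule less_cSup_iff[OF _ bdd])
      then have "\<exists>r'. J r' \<and> r < r'" using that by auto
      then obtain r' where "J r'" "r < r'" by (elim exE conjE)
      then show ?thesis by (intro J(2)[of r' r] less_imp_le)
    qed
    have pz: "p < z" using zu[OF r0(1,2)] r0(3) by simp
    have "prob {\<omega> \<in> space M. p < elev v \<omega> \<and> J (elev v \<omega>)} \<le> prob ({\<omega> \<in> space M. elev v \<omega> \<le> z} - {\<omega> \<in> space M. elev v \<omega> \<le> p})"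
    proof (rule finite_measure_mono_AE)
      show "AE \<omega> in M. \<omega> \<in> {\<omega> \<in> space M. p < elev v \<omega> \<and> J (elev v \<omega>)} \<longrightarrow>
        \<omega> \<in> {\<omega> \<in> space M. elev v \<omega> \<le> z} - {\<omega> \<in> space M. elev v \<omega> \<le> p}"
        using elev1 by eventually_elim (auto intro: zu)
    qed auto
    also have "\<dots> = prob {\<omega> \<in> space M. elev v \<omega> \<le> z} - prob {\<omega> \<in> space M. elev v \<omega> \<le> p}"
      by (rule finite_measure_Diff) (use pz in auto)
    also have "\<dots> = survival_hat z - survival_hat p"
      using prob_elev_le[OF v] p pz z1 by simp
    also have "\<dots> \<le> ?L * (z - p)" by (rule survival_hat_Lipschitz) (use q pz z1 in auto)
    also have "\<dots> = ?L / survival p * ((z - p) * survival p)" using sp by simp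
    finally have le: "prob {\<omega> \<in> space M. p < elev v \<omega> \<and> J (elev v \<omega>)} \<le> ?L / survival p * ((z - p) * survival p)" .
    \<comment> \<open>If the edge weight lies strictly between p and z and the level is at most p,
      then \<open>elev v\<close> equals the edge weight, which satisfies \<open>J\<close>. Edge
      weight and level are independent.\<close>
    have "(z - p) * survival p \<le> prob {\<omega> \<in> space M. p < elev v \<omega> \<and> J (elev v \<omega>) \<and> lev v \<omega> \<le> p}"
    proof -
      have sub: "{Inr v} \<subseteq> coords" using v by (auto simp: coords_def)
      have [measurable]: "(\<lambda>y. ucfg y v) \<in> borel_measurable (PiM {Inr v} (\<lambda>_. borel))"
        unfolding ucfg_def by (rule measurable_PiM_coord)
      have "prob {\<omega> \<in> space M. (p < ucfg (restr {Inr v} \<omega>) v \<and> ucfg (restr {Inr v} \<omega>) v < z) \<and>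
          level (dcfg (restr (down v) \<omega>)) (ucfg (restr (down v) \<omega>)) v \<le> p} =
        prob {\<omega> \<in> space M. p < ucfg (restr {Inr v} \<omega>) v \<and> ucfg (restr {Inr v} \<omega>) v < z} *
        prob {\<omega> \<in> space M. level (dcfg (restr (down v) \<omega>)) (ucfg (restr (down v) \<omega>)) v \<le> p}"
        by (rule prob_indep[where P="\<lambda>y. p < ucfg y v \<and> ucfg y v < z" and Q="\<lambda>y. level (dcfg y) (ucfg y) v \<le> p"])
           (use sub down_subset in \<open>auto simp: down_def\<close>)
      then have "prob {\<omega> \<in> space M. (p < U v \<omega> \<and> U v \<omega> < z) \<and> lev v \<omega> \<le> p} =
        prob {\<omega> \<in> space M. p < U v \<omega> \<and> U v \<omega> < z} * survival p"
        using prob_lev_le[of p v] p by (simp add: ucfg_restr lev_restr)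
      moreover have "prob {\<omega> \<in> space M. p < U v \<omega> \<and> U v \<omega> < z} = z - p"
      proof -
        have "emeasure M {\<omega> \<in> space M. U v \<omega> \<in> {p<..<z}} = emeasure lborel ({0..1} \<inter> {p<..<z})"
          by (rule emeasure_U[OF v]) simp
        also have "{0..1} \<inter> {p<..<z} = {p<..<z}" using p z1 by auto
        finally show ?thesis using pz by (simp add: emeasure_eq_measure)
      qed
      moreover have "prob {\<omega> \<in> space M. (p < U v \<omega> \<and> U v \<omega> < z) \<and> lev v \<omega> \<le> p} \<le>
        prob {\<omega> \<in> space M. p < elev v \<omega> \<and> J (elev v \<omega>) \<and> lev v \<omega> \<le> p}"
        by (rule finite_measure_mono) (auto simp: elev_eq intro!: zJ)
      ultimately show ?thesis by simp
    qed
    then have "?L / survival p * ((z - p) * survival p) \<le>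
      ?L / survival p * prob {\<omega> \<in> space M. p < elev v \<omega> \<and> J (elev v \<omega>) \<and> lev v \<omega> \<le> p}"
      by (rule mult_left_mono) (use L sp in simp)
    with le show ?thesis by (rule order_trans)
  qed
qed

text \<open>When \<open>bb (Suc k)\<close> is \<open>v\<close>, the values \<open>fut k\<close> and
  \<open>fut (Suc k)\<close> are \<open>elev v\<close> and \<open>lev v\<close>. With the
  coordinates outside \<open>edown v\<close> frozen, the estimate is
  \<open>prob_elev_selected_le\<close>, \<open>J\<close> being the selection as a condition on r;
  the constant does not depend on \<open>v\<close>.\<close>

lemma prob_fut_gt_le:
  assumes q: "0 < q" "q < 1" "p = 1 / slope q"
  defines "C \<equiv> (slope q)\<^sup>2 / measure_pmf.prob X {2..} / survival p"
  shows "prob {\<omega> \<in> space M. p < fut k \<omega>} \<le> C * prob {\<omega> \<in> space M. p < fut k \<omega> \<and> fut (Suc k) \<omega> \<le> p}"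
proof -
  have C: "0 \<le> C" unfolding C_def using survival_bounds(1)[of p] inverse_slope_bounds[of q] q by auto
  let ?f = "\<lambda>\<omega>. indicator {\<omega> \<in> space M. p < fut k \<omega>} \<omega> :: ennreal"
  let ?g = "\<lambda>\<omega>. ennreal C * indicator {\<omega> \<in> space M. p < fut k \<omega> \<and> fut (Suc k) \<omega> \<le> p} \<omega> :: ennreal"
  have "(\<integral>\<^sup>+\<omega>. ?f \<omega> \<partial>M) \<le> (\<integral>\<^sup>+\<omega>. ?g \<omega> \<partial>M)"
  proof (rule nn_integral_mono_partition[OF measurable_backbone[of "Suc k"]])
    fix v
    show "(\<integral>\<^sup>+\<omega>. ?f \<omega> * indicator {v} (bb (Suc k) \<omega>) \<partial>M) \<le> (\<integral>\<^sup>+\<omega>. ?g \<omega> * indicator {v} (bb (Suc k) \<omega>) \<partial>M)"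
    proof (cases "length v = Suc k")
      case False
      then have "bb (Suc k) \<omega> \<noteq> v" for \<omega> using length_backbone by blast
      then show ?thesis by simp
    next
      case True
      then have v: "v \<noteq> []" by auto
      note [measurable] = measurable_elev[OF v]
      \<comment> \<open>Unlike in \<open>law_deg_fut_vertex\<close>, the edge above \<open>v\<close>
        is in the inner block, since its weight has to be averaged over.\<close>
      let ?A = "coords - edown v" and ?B = "edown v"
      have AB: "?A \<inter> ?B = {}" "?A \<subseteq> coords" "?B \<subseteq> coords" using down_subset(2)[OF v] by auto
      have sel: "AE \<omega> in M. (indicator {v} (bb (Suc k) \<omega>) = selG v (restr ?A \<omega>) (elev v \<omega>)) \<and>
          (bb (Suc k) \<omega> = v \<longrightarrow> fut k \<omega> = elev v \<omega> \<and> fut (Suc k) \<omega> = lev v \<omega>)"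
        using AE_fut_eq[of "Suc k"] AE_bb_iff[of "Suc k" v] AE_fut_Suc[of k]
      proof eventually_elim
        case (elim \<omega>)
        then show ?case using True unfolding selG_def selects_restr[OF subset_refl] by (auto simp: indicator_def)
      qed
      have meas_elev [measurable]: "(\<lambda>y. elevel (dcfg y) (ucfg y) v) \<in> borel_measurable (PiM ?B (\<lambda>_. borel))"
        by (rule cfg.measurable_elevel[OF v])
      have meas_lev [measurable]: "(\<lambda>y. level (dcfg y) (ucfg y) v) \<in> borel_measurable (PiM ?B (\<lambda>_. borel))"
        by (rule cfg.measurable_level)
      have [measurable]: "(\<lambda>z. selG v (fst z) (elevel (dcfg (snd z)) (ucfg (snd z)) v)) \<in>
        borel_measurable (PiM ?A (\<lambda>_. borel) \<Otimes>\<^sub>M PiM ?B (\<lambda>_. borel))"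
        by (rule measurable_selG[where A="?A"]) measurable
      have e: "elev v \<omega> = elevel (dcfg (restr ?B \<omega>)) (ucfg (restr ?B \<omega>)) v"
        and l: "lev v \<omega> = level (dcfg (restr ?B \<omega>)) (ucfg (restr ?B \<omega>)) v" for \<omega>
        by (simp_all add: elev_restr lev_restr[OF down_subset_edown])
      have "(\<integral>\<^sup>+\<omega>. ?f \<omega> * indicator {v} (bb (Suc k) \<omega>) \<partial>M) =
        (\<integral>\<^sup>+\<omega>. (if p < elev v \<omega> then 1 else 0) * selG v (restr ?A \<omega>) (elev v \<omega>) \<partial>M)"
      proof (rule nn_integral_cong_AE)
        show "AE \<omega> in M. ?f \<omega> * indicator {v} (bb (Suc k) \<omega>) =
          (if p < elev v \<omega> then 1 else 0) * selG v (restr ?A \<omega>) (elev v \<omega>)"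
          using sel AE_space
        proof eventually_elim
          case (elim \<omega>)
          then show ?case unfolding conjunct1[OF elim(1), symmetric] by (cases "bb (Suc k) \<omega> = v") auto
        qed
      qed
      also have "\<dots> = (\<integral>\<^sup>+\<omega>. \<integral>\<^sup>+\<omega>'. (if p < elev v \<omega>' then 1 else 0) * selG v (restr ?A \<omega>) (elev v \<omega>') \<partial>M \<partial>M)"
        unfolding e
        by (rule nn_integral_indep[OF AB, where F="\<lambda>y y'. (if p < elevel (dcfg y') (ucfg y') v then 1 else 0) * selG v y (elevel (dcfg y') (ucfg y') v)"])
           (unfold split_beta', measurable)
      also have "\<dots> \<le> (\<integral>\<^sup>+\<omega>. \<integral>\<^sup>+\<omega>'. ennreal C * (if p < elev v \<omega>' \<and> lev v \<omega>' \<le> p then 1 else 0) * selG v (restr ?A \<omega>) (elev v \<omega>') \<partial>M \<partial>M)"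
      proof (rule nn_integral_mono)
        fix \<omega> assume \<omega>: "\<omega> \<in> space M"
        define J where "J r = selects (dcfg (restr ?A \<omega>)) (ucfg (restr ?A \<omega>)) (rev v) r" for r
        have space: "restr ?A \<omega> \<in> space (PiM ?A (\<lambda>_. borel))" using measurable_space[OF measurable_restr[OF AB(2)] \<omega>] .
        interpret c: random_config "borel :: real measure" "\<lambda>_. dcfg (restr ?A \<omega>)" "\<lambda>_. ucfg (restr ?A \<omega>)"
          by unfold_locales auto
        have Jm [measurable]: "Measurable.pred borel J"
          unfolding J_def[abs_def] by (rule c.measurable_selects) simp
        have J: "J r'" if "J r" "r' \<le> r" for r r' using that selects_antimono unfolding J_def by blast
        have "(\<integral>\<^sup>+\<omega>'. (if p < elev v \<omega>' then 1 else 0) * selG v (restr ?A \<omega>) (elev v \<omega>') \<partial>M) =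
          (\<integral>\<^sup>+\<omega>'. indicator {\<omega>' \<in> space M. p < elev v \<omega>' \<and> J (elev v \<omega>')} \<omega>' \<partial>M)"
          by (rule nn_integral_cong) (auto simp: selG_def J_def indicator_def)
        also have "\<dots> = emeasure M {\<omega>' \<in> space M. p < elev v \<omega>' \<and> J (elev v \<omega>')}"
          by (rule nn_integral_indicator) measurable
        also have "\<dots> \<le> ennreal (C * prob {\<omega>' \<in> space M. p < elev v \<omega>' \<and> J (elev v \<omega>') \<and> lev v \<omega>' \<le> p})"
          unfolding emeasure_eq_measure C_def
          by (intro ennreal_leI prob_elev_selected_le[OF v q Jm]) (rule J)
        also have "\<dots> = ennreal C * emeasure M {\<omega>' \<in> space M. p < elev v \<omega>' \<and> J (elev v \<omega>') \<and> lev v \<omega>' \<le> p}"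
          using C by (simp add: emeasure_eq_measure ennreal_mult)
        also have "\<dots> = ennreal C * (\<integral>\<^sup>+\<omega>'. indicator {\<omega>' \<in> space M. p < elev v \<omega>' \<and> J (elev v \<omega>') \<and> lev v \<omega>' \<le> p} \<omega>' \<partial>M)"
          by (subst nn_integral_indicator) auto
        also have "\<dots> = (\<integral>\<^sup>+\<omega>'. ennreal C * indicator {\<omega>' \<in> space M. p < elev v \<omega>' \<and> J (elev v \<omega>') \<and> lev v \<omega>' \<le> p} \<omega>' \<partial>M)"
          by (rule nn_integral_cmult[symmetric]) measurable
        also have "\<dots> = (\<integral>\<^sup>+\<omega>'. ennreal C * (if p < elev v \<omega>' \<and> lev v \<omega>' \<le> p then 1 else 0) * selG v (restr ?A \<omega>) (elev v \<omega>') \<partial>M)"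
          by (rule nn_integral_cong) (auto simp: selG_def J_def indicator_def)
        finally show "(\<integral>\<^sup>+\<omega>'. (if p < elev v \<omega>' then 1 else 0) * selG v (restr ?A \<omega>) (elev v \<omega>') \<partial>M) \<le>
          (\<integral>\<^sup>+\<omega>'. ennreal C * (if p < elev v \<omega>' \<and> lev v \<omega>' \<le> p then 1 else 0) * selG v (restr ?A \<omega>) (elev v \<omega>') \<partial>M)" .
      qed
      also have "\<dots> = (\<integral>\<^sup>+\<omega>. ennreal C * (if p < elev v \<omega> \<and> lev v \<omega> \<le> p then 1 else 0) * selG v (restr ?A \<omega>) (elev v \<omega>) \<partial>M)"
        unfolding e l
        by (rule nn_integral_indep[OF AB, symmetric, where F="\<lambda>y y'. ennreal C * (if p < elevel (dcfg y') (ucfg y') v \<and> level (dcfg y') (ucfg y') v \<le> p then 1 else 0) * selG v y (elevel (dcfg y') (ucfg y') v)"])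
           (unfold split_beta', measurable)
      also have "\<dots> = (\<integral>\<^sup>+\<omega>. ?g \<omega> * indicator {v} (bb (Suc k) \<omega>) \<partial>M)"
      proof (rule nn_integral_cong_AE)
        show "AE \<omega> in M. ennreal C * (if p < elev v \<omega> \<and> lev v \<omega> \<le> p then 1 else 0) * selG v (restr ?A \<omega>) (elev v \<omega>) =
          ?g \<omega> * indicator {v} (bb (Suc k) \<omega>)"
          using sel AE_space
        proof eventually_elim
          case (elim \<omega>)
          then show ?case unfolding conjunct1[OF elim(1), symmetric] by (cases "bb (Suc k) \<omega> = v") auto
        qed
      qed
      finally show ?thesis .
    qed
  qed measurable
  then have "emeasure M {\<omega> \<in> space M. p < fut k \<omega>} \<le> ennreal C * emeasure M {\<omega> \<in> space M. p < fut k \<omega> \<and> fut (Suc k) \<omega> \<le> p}"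
    by (simp add: nn_integral_cmult)
  then show ?thesis using C by (simp add: emeasure_eq_measure flip: ennreal_mult)
qed

lemma prob_th_fut_tendsto:
  assumes q: "0 < q" "q < 1"
  shows "(\<lambda>k. prob {\<omega> \<in> space M. q < th (fut k \<omega>)}) \<longlonglongrightarrow> 0"
proof -
  define p where "p = 1 / slope q"
  have p: "0 < p" "p \<le> 1" using inverse_slope_bounds[of q] q by (auto simp: p_def)
  have hat: "survival_hat p = q" using survival_hat_inverse_slope[of q] q by (simp add: p_def)
  have "0 < p * survival p" using hat q(1) by (simp only: survival_hat_def)
  then have sp: "0 < survival p" using p(1) by (rule zero_less_mult_pos)
  define C where "C = (slope q)\<^sup>2 / measure_pmf.prob X {2..} / survival p"
  have C: "0 < C" unfolding C_def using sp prob_ge_2_pos slope_ge_1[of q] q by simp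
  have "(\<lambda>k. prob {\<omega> \<in> space M. p < fut k \<omega>}) \<longlonglongrightarrow> 0"
  proof (rule tendsto_0_of_decrement[OF _ C])
    fix k
    have "prob {\<omega> \<in> space M. p < fut k \<omega>} \<le> C * prob {\<omega> \<in> space M. p < fut k \<omega> \<and> fut (Suc k) \<omega> \<le> p}"
      unfolding C_def by (rule prob_fut_gt_le[OF q p_def])
    also have "prob {\<omega> \<in> space M. p < fut k \<omega> \<and> fut (Suc k) \<omega> \<le> p} =
      prob ({\<omega> \<in> space M. p < fut k \<omega>} - {\<omega> \<in> space M. p < fut k \<omega> \<and> p < fut (Suc k) \<omega>})"
      by (rule arg_cong[where f=prob]) auto
    also have "\<dots> = prob {\<omega> \<in> space M. p < fut k \<omega>} - prob {\<omega> \<in> space M. p < fut k \<omega> \<and> p < fut (Suc k) \<omega>}"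
      by (rule finite_measure_Diff) auto
    \<comment> \<open>Future maxima are almost surely nonincreasing, so the probability of crossing
      p is a difference of consecutive terms.\<close>
    also have "prob {\<omega> \<in> space M. p < fut k \<omega> \<and> p < fut (Suc k) \<omega>} = prob {\<omega> \<in> space M. p < fut (Suc k) \<omega>}"
    proof (rule finite_measure_eq_AE)
      show "AE \<omega> in M. \<omega> \<in> {\<omega> \<in> space M. p < fut k \<omega> \<and> p < fut (Suc k) \<omega>} \<longleftrightarrow> \<omega> \<in> {\<omega> \<in> space M. p < fut (Suc k) \<omega>}"
        using AE_fut_eq[of "Suc k"] AE_bb_iff[of "Suc k" v] AE_fut_Suc[of k]
      proof eventually_elim
        case (elim \<omega>)
        then have "fut (Suc k) \<omega> \<le> fut k \<omega>" by (simp add: elev_eq)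
        then show ?case by auto
      qed
    qed auto
    finally show "prob {\<omega> \<in> space M. p < fut k \<omega>} \<le> C * (prob {\<omega> \<in> space M. p < fut k \<omega>} - prob {\<omega> \<in> space M. p < fut (Suc k) \<omega>})" .
  qed simp
  moreover have "prob {\<omega> \<in> space M. q < th (fut k \<omega>)} = prob {\<omega> \<in> space M. p < fut k \<omega>}" for k
  proof (rule finite_measure_eq_AE)
    show "AE \<omega> in M. \<omega> \<in> {\<omega> \<in> space M. q < th (fut k \<omega>)} \<longleftrightarrow> \<omega> \<in> {\<omega> \<in> space M. p < fut k \<omega>}"
      using AE_fut_bounds[of k] by eventually_elim (use th_lev_gt_iff q in \<open>auto simp: p_def\<close>)
  qed auto
  ultimately show ?thesis by simp
qed

end

section \<open>Size biasing and limits in law along the backbone\<close>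

lemma pmf_size_biased_tilt_prob:
  assumes off: "offspring X" and q: "0 < q" "q < 1" and P: "\<And>y. pmf P y = tilt_prob X 1 q {y}"
  shows "pmf (size_biased P) y = tilt_prob X 2 q {y}"
proof -
  interpret offspring X by fact
  let ?T = "\<lambda>j. tilt X j q UNIV"
  have T: "0 < ?T j" for j by (rule tilt_UNIV_pos[OF q])
  have mult: "real n * tilt_prob X 1 q {n} = tilt X 2 q {n} / ?T 1" for n
    by (simp add: tilt_prob_def tilt_single power2_eq_square)
  \<comment> \<open>For 0 < q < 1 the mean is the quotient of the second and first tilted masses.
    Its finiteness, whatever \<alpha> is, makes \<open>size_biased\<close> meaningful here.\<close>
  have "(\<integral>\<^sup>+ n. ennreal (real n) \<partial>measure_pmf P) = (\<Sum>n. ennreal (pmf P n) * ennreal (real n))"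
    by (simp add: nn_integral_measure_pmf nn_integral_count_space_nat)
  also have "\<dots> = (\<Sum>n. ennreal (tilt X 2 q {n}) * indicator UNIV n * ennreal (1 / ?T 1))"
  proof (rule suminf_cong)
    fix n
    have "ennreal (pmf P n) * ennreal (real n) = ennreal (real n * pmf P n)"
      by (simp add: ennreal_mult mult.commute)
    also have "\<dots> = ennreal (tilt X 2 q {n} / ?T 1)" unfolding P mult ..
    also have "\<dots> = ennreal (tilt X 2 q {n}) * ennreal (1 / ?T 1)"
      by (rule ennreal_divide_eq_mult[OF tilt_nonneg[OF q] T])
    finally show "ennreal (pmf P n) * ennreal (real n) =
      ennreal (tilt X 2 q {n}) * indicator UNIV n * ennreal (1 / ?T 1)" by simp
  qed
  also have "\<dots> = ennreal (?T 2) * ennreal (1 / ?T 1)"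
    by (subst ennreal_tilt[OF q, of X 2 UNIV]) (rule ennreal_suminf_multc)
  also have "\<dots> = ennreal (?T 2 / ?T 1)"
    by (rule ennreal_divide_eq_mult[OF tilt_nonneg[OF q] T, symmetric])
  finally have nn: "(\<integral>\<^sup>+ n. ennreal (real n) \<partial>measure_pmf P) = ennreal (?T 2 / ?T 1)" .
  have pos: "0 < ?T 2 / ?T 1" using T by simp
  have hb: "has_bochner_integral (measure_pmf P) real (?T 2 / ?T 1)"
    by (rule has_bochner_integral_nn_integral[OF _ _ less_imp_le[OF pos] nn]) auto
  then have int: "integrable (measure_pmf P) real" and E: "measure_pmf.expectation P real = ?T 2 / ?T 1"
    by (auto simp: has_bochner_integral_iff)
  have "pmf (size_biased P) y = real y * pmf P y / (?T 2 / ?T 1)"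
    using pmf_size_biased[OF int, of y] pos unfolding E by simp
  also have "\<dots> = tilt_prob X 2 q {y}" unfolding P mult using T[of 1] by (simp add: tilt_prob_def)
  finally show ?thesis .
qed

context offspring
begin

text \<open>The mean of the size-biased law is E[X^2] / E[X], computed in \<open>ennreal\<close> so
  that the infinite case is included.\<close>

lemma integrable_size_biased_iff:
  assumes int: "integrable (measure_pmf X) real"
  shows "integrable (measure_pmf (size_biased X)) real \<longleftrightarrow> integrable (measure_pmf X) (\<lambda>n. real n ^ 2)"
proof -
  let ?E = "measure_pmf.expectation X real"
  have E: "0 < ?E" using expectation_power_pos[of 1] int by simp
  have "(\<integral>\<^sup>+ n. ennreal (real n) \<partial>measure_pmf (size_biased X)) =
    (\<Sum>n. ennreal (pmf X n) * ennreal (real n ^ 2) * ennreal (1 / ?E))"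
    unfolding nn_integral_measure_pmf nn_integral_count_space_nat
  proof (rule suminf_cong)
    fix n
    have "pmf (size_biased X) n * real n = pmf X n * real n ^ 2 * (1 / ?E)"
      using pmf_size_biased[OF int E, of n] by (simp add: power2_eq_square)
    then show "ennreal (pmf (size_biased X) n) * ennreal (real n) = ennreal (pmf X n) * ennreal (real n ^ 2) * ennreal (1 / ?E)"
      using E by (simp flip: ennreal_mult)
  qed
  also have "\<dots> = (\<integral>\<^sup>+ n. ennreal (real n ^ 2) \<partial>measure_pmf X) * ennreal (1 / ?E)"
    unfolding nn_integral_measure_pmf nn_integral_count_space_nat by (rule ennreal_suminf_multc)
  finally have "(\<integral>\<^sup>+ n. ennreal (real n) \<partial>measure_pmf (size_biased X)) < \<infinity> \<longleftrightarrow>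
    (\<integral>\<^sup>+ n. ennreal (real n ^ 2) \<partial>measure_pmf X) < \<infinity>"
    using E by (auto simp: ennreal_mult_less_top ennreal_mult_eq_top_iff less_top)
  then show ?thesis by (simp add: integrable_iff_bounded)
qed

end

context bp_model
begin

text \<open>Convergence in probability of \<open>th (fut k)\<close> to 0 suffices because H is
  bounded on (0,1): near 0 it is close to L, and elsewhere the error is at most 1 on an event of
  small probability.\<close>

lemma expectation_th_fut_tendsto:
  fixes H :: "real \<Rightarrow> real"
  assumes [measurable]: "H \<in> borel_measurable borel"
    and H: "\<And>q. 0 < q \<Longrightarrow> q < 1 \<Longrightarrow> 0 \<le> H q \<and> H q \<le> 1" and lim: "(H \<longlongrightarrow> L) (at_right 0)"
  shows "(\<lambda>k. expectation (\<lambda>\<omega>. H (th (fut k \<omega>)))) \<longlonglongrightarrow> L"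
proof (rule metric_LIMSEQ_I)
  fix r :: real assume r: "0 < r"
  have ev1: "eventually (\<lambda>q::real. 0 < q \<and> q < 1) (at_right 0)"
    by (auto simp: eventually_at_right[of 0 1] intro!: exI[of _ 1])
  have "eventually (\<lambda>q. 0 \<le> H q) (at_right 0)" "eventually (\<lambda>q. H q \<le> 1) (at_right 0)"
    using ev1 by (eventually_elim, use H in blast)+
  then have L: "0 \<le> L" "L \<le> 1"
    using tendsto_lowerbound[OF lim, of 0] tendsto_upperbound[OF lim, of 1] by simp_all
  have "eventually (\<lambda>q. dist (H q) L < r / 4) (at_right 0)" using lim r by (intro tendstoD) auto
  then obtain b where b: "0 < b" "\<And>q. 0 < q \<Longrightarrow> q < b \<Longrightarrow> dist (H q) L < r / 4"
    by (auto simp: eventually_at_right[of 0 1])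
  \<comment> \<open>Strictly below b, where H is close to L, and below 1, as
    \<open>prob_th_fut_tendsto\<close> requires.\<close>
  define q0 where "q0 = min (b / 2) (1 / 2)"
  have q0: "0 < q0" "q0 < 1" "q0 < b" using b(1) by (auto simp: q0_def)
  obtain k0 where k0: "\<And>k. k0 \<le> k \<Longrightarrow> prob {\<omega> \<in> space M. q0 < th (fut k \<omega>)} < r / 4"
    using order_tendstoD(2)[OF prob_th_fut_tendsto[OF q0(1,2)], of "r / 4"] r
    by (auto simp: eventually_sequentially)
  show "\<exists>k0. \<forall>k\<ge>k0. dist (expectation (\<lambda>\<omega>. H (th (fut k \<omega>)))) L < r"
  proof (intro exI allI impI)
    fix k assume k: "k0 \<le> k"
    let ?A = "{\<omega> \<in> space M. q0 < th (fut k \<omega>)}"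
    have int: "integrable M (\<lambda>\<omega>. H (th (fut k \<omega>)))"
    proof (rule integrable_const_bound[where B=1])
      show "AE \<omega> in M. norm (H (th (fut k \<omega>))) \<le> 1"
        using AE_th_fut[of k] by eventually_elim (use H in auto)
    qed measurable
    have intA: "integrable M (\<lambda>\<omega>. r / 4 + indicator ?A \<omega>)"
      by (intro Bochner_Integration.integrable_add integrable_const integrable_const_bound[where B=1]) auto
    have "\<bar>expectation (\<lambda>\<omega>. H (th (fut k \<omega>))) - L\<bar> = \<bar>expectation (\<lambda>\<omega>. H (th (fut k \<omega>)) - L)\<bar>"
      using int by (simp add: prob_space)
    also have "\<dots> \<le> expectation (\<lambda>\<omega>. \<bar>H (th (fut k \<omega>)) - L\<bar>)"
      by (rule integral_abs_bound)
    also have "\<dots> \<le> expectation (\<lambda>\<omega>. r / 4 + indicator ?A \<omega>)"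
    proof (rule integral_mono_AE)
      show "AE \<omega> in M. \<bar>H (th (fut k \<omega>)) - L\<bar> \<le> r / 4 + indicator ?A \<omega>"
        using AE_th_fut[of k] AE_space
      proof eventually_elim
        case (elim \<omega>)
        show ?case
        proof (cases "q0 < th (fut k \<omega>)")
          case True
          have "\<bar>H (th (fut k \<omega>)) - L\<bar> \<le> 1" using H[of "th (fut k \<omega>)"] elim(1) L by (auto simp: abs_le_iff)
          then show ?thesis using True elim(2) r by simp
        next
          case False
          then have "dist (H (th (fut k \<omega>))) L < r / 4" using elim(1) q0(3) by (intro b(2)) auto
          then show ?thesis using False by (simp add: dist_real_def)
        qed
      qed
    qed (use int intA in auto)
    also have "\<dots> = r / 4 + prob ?A"
      by (subst Bochner_Integration.integral_add) (auto simp: prob_space intro!: integrable_const_bound[where B=1])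
    also have "\<dots> < r" using k0[OF k] r by simp
    finally show "dist (expectation (\<lambda>\<omega>. H (th (fut k \<omega>)))) L < r" by (simp add: dist_real_def)
  qed
qed

text \<open>The conditional law given the future maximum, expressed by joint probabilities instead
  of kernels. The degree satisfies this with j = 1 and every size-biased variable with j =
  2.\<close>

definition tilted_law :: "nat \<Rightarrow> nat \<Rightarrow> ('a \<Rightarrow> nat) \<Rightarrow> bool" where
  "tilted_law j k Y \<longleftrightarrow> Y \<in> M \<rightarrow>\<^sub>M count_space UNIV \<and>
     (\<forall>n. \<forall>B\<in>sets borel. prob {\<omega> \<in> space M. fut k \<omega> \<in> B \<and> Y \<omega> = n} =
       expectation (\<lambda>\<omega>. indicator B (fut k \<omega>) * tilt_prob X j (th (fut k \<omega>)) {n}))"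

lemma tilted_lawD:
  "tilted_law j k Y \<Longrightarrow> B \<in> sets borel \<Longrightarrow> prob {\<omega> \<in> space M. fut k \<omega> \<in> B \<and> Y \<omega> = n} =
    expectation (\<lambda>\<omega>. indicator B (fut k \<omega>) * tilt_prob X j (th (fut k \<omega>)) {n})"
  unfolding tilted_law_def by simp

lemma AE_tilt_prob_bounds:
  "AE \<omega> in M. 0 \<le> tilt_prob X j (th (fut k \<omega>)) B \<and> tilt_prob X j (th (fut k \<omega>)) B \<le> 1"
  using AE_th_fut[of k] by eventually_elim (simp add: tilt_prob_bounds)

lemma integrable_tilt_prob:
  assumes "h \<in> borel_measurable M" "\<And>\<omega>. 0 \<le> h \<omega>" "\<And>\<omega>. h \<omega> \<le> 1"
  shows "integrable M (\<lambda>\<omega>. h \<omega> * tilt_prob X j (th (fut k \<omega>)) B)"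
proof (rule integrable_const_bound[where B=1])
  note [measurable] = assms(1)
  show "AE \<omega> in M. norm (h \<omega> * tilt_prob X j (th (fut k \<omega>)) B) \<le> 1"
    using AE_tilt_prob_bounds[of j k B] by eventually_elim (use assms in \<open>auto intro!: mult_le_one\<close>)
  show "(\<lambda>\<omega>. h \<omega> * tilt_prob X j (th (fut k \<omega>)) B) \<in> borel_measurable M" by measurable
qed

lemma tilted_law_deg: "tilted_law 1 k (deg k)"
  unfolding tilted_law_def
proof (intro conjI allI ballI)
  fix n and B :: "real set" assume B [measurable]: "B \<in> sets borel"
  have "emeasure M {\<omega> \<in> space M. fut k \<omega> \<in> B \<and> deg k \<omega> = n} =
    (\<integral>\<^sup>+\<omega>. indicator {\<omega> \<in> space M. fut k \<omega> \<in> B \<and> deg k \<omega> = n} \<omega> \<partial>M)"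
    by (rule nn_integral_indicator[symmetric]) measurable
  also have "\<dots> = (\<integral>\<^sup>+\<omega>. indicator B (fut k \<omega>) * indicator {n} (deg k \<omega>) \<partial>M)"
    by (rule nn_integral_cong) (auto simp: indicator_def)
  also have "\<dots> = (\<integral>\<^sup>+\<omega>. indicator B (fut k \<omega>) * ennreal (tilt_prob X 1 (th (fut k \<omega>)) {n}) \<partial>M)"
    by (rule law_deg_fut) measurable
  also have "\<dots> = (\<integral>\<^sup>+\<omega>. ennreal (indicator B (fut k \<omega>) * tilt_prob X 1 (th (fut k \<omega>)) {n}) \<partial>M)"
    by (rule nn_integral_cong) (auto simp: indicator_def)
  also have "\<dots> = ennreal (expectation (\<lambda>\<omega>. indicator B (fut k \<omega>) * tilt_prob X 1 (th (fut k \<omega>)) {n}))"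
  proof (rule nn_integral_eq_integral)
    show "integrable M (\<lambda>\<omega>. indicator B (fut k \<omega>) * tilt_prob X 1 (th (fut k \<omega>)) {n})"
      by (rule integrable_tilt_prob) auto
    show "AE \<omega> in M. 0 \<le> indicator B (fut k \<omega>) * tilt_prob X 1 (th (fut k \<omega>)) {n}"
      using AE_tilt_prob_bounds[of 1 k "{n}"] by eventually_elim (simp add: indicator_def)
  qed
  finally have "ennreal (prob {\<omega> \<in> space M. fut k \<omega> \<in> B \<and> deg k \<omega> = n}) =
    ennreal (expectation (\<lambda>\<omega>. indicator B (fut k \<omega>) * tilt_prob X 1 (th (fut k \<omega>)) {n}))"
    by (simp add: emeasure_eq_measure)
  moreover have "0 \<le> expectation (\<lambda>\<omega>. indicator B (fut k \<omega>) * tilt_prob X 1 (th (fut k \<omega>)) {n})"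
    by (rule integral_nonneg_AE)
       (use AE_tilt_prob_bounds[of 1 k "{n}"] in eventually_elim, simp add: indicator_def)
  ultimately show "prob {\<omega> \<in> space M. fut k \<omega> \<in> B \<and> deg k \<omega> = n} =
    expectation (\<lambda>\<omega>. indicator B (fut k \<omega>) * tilt_prob X 1 (th (fut k \<omega>)) {n})"
    by simp
qed measurable

lemma tilted_law_prob:
  assumes "tilted_law j k Y"
  shows "prob {\<omega> \<in> space M. Y \<omega> = n} = expectation (\<lambda>\<omega>. tilt_prob X j (th (fut k \<omega>)) {n})"
  using tilted_lawD[OF assms, of UNIV n] by simp

lemma borel_measurable_tilt_prob_scaled [measurable]:
  "(\<lambda>q. tilt_prob X j q {n. q * real n \<le> x}) \<in> borel_measurable borel"
proof -
  have "tilt X j q {n. q * real n \<le> x} =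
    measure_pmf.expectation X (\<lambda>n. real n ^ j * (1 - q) ^ (n - 1) * (if q * real n \<le> x then 1 else 0))" for q
    unfolding tilt_def by (rule Bochner_Integration.integral_cong) (auto simp: indicator_def)
  then show ?thesis unfolding tilt_prob_def by simp
qed

text \<open>The scaling factor is itself a function of the future maximum, so for each value n of
  \<open>Y\<close> the inequality is an event in \<open>fut k\<close> alone, to which the definition
  applies.\<close>

lemma tilted_law_scaled_prob:
  assumes Y: "tilted_law j k Y"
  shows "prob {\<omega> \<in> space M. th (fut k \<omega>) * real (Y \<omega>) \<le> x} =
    expectation (\<lambda>\<omega>. tilt_prob X j (th (fut k \<omega>)) {n. th (fut k \<omega>) * real n \<le> x})"
proof -
  have [measurable]: "Y \<in> M \<rightarrow>\<^sub>M count_space UNIV" using Y by (simp add: tilted_law_def)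
  let ?B = "\<lambda>n. {w. th w * real n \<le> x}"
  let ?t = "\<lambda>\<omega> n. tilt_prob X j (th (fut k \<omega>)) {n}"
  let ?T = "\<lambda>\<omega>. tilt_prob X j (th (fut k \<omega>)) {n. th (fut k \<omega>) * real n \<le> x}"
  have B [measurable]: "?B n \<in> sets borel" for n by measurable
  have "emeasure M {\<omega> \<in> space M. th (fut k \<omega>) * real (Y \<omega>) \<le> x} =
    emeasure M (\<Union>n. {\<omega> \<in> space M. fut k \<omega> \<in> ?B n \<and> Y \<omega> = n})"
    by (rule arg_cong[where f="emeasure M"]) auto
  also have "\<dots> = (\<Sum>n. emeasure M {\<omega> \<in> space M. fut k \<omega> \<in> ?B n \<and> Y \<omega> = n})"
    by (rule suminf_emeasure[symmetric]) (auto simp: disjoint_family_on_def)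
  also have "\<dots> = (\<Sum>n. \<integral>\<^sup>+\<omega>. ennreal (indicator (?B n) (fut k \<omega>) * ?t \<omega> n) \<partial>M)"
  proof (rule suminf_cong)
    fix n
    have "emeasure M {\<omega> \<in> space M. fut k \<omega> \<in> ?B n \<and> Y \<omega> = n} =
      ennreal (expectation (\<lambda>\<omega>. indicator (?B n) (fut k \<omega>) * ?t \<omega> n))"
      unfolding emeasure_eq_measure tilted_lawD[OF Y B] ..
    also have "\<dots> = (\<integral>\<^sup>+\<omega>. ennreal (indicator (?B n) (fut k \<omega>) * ?t \<omega> n) \<partial>M)"
    proof (rule nn_integral_eq_integral[symmetric])
      show "integrable M (\<lambda>\<omega>. indicator (?B n) (fut k \<omega>) * ?t \<omega> n)"
        by (rule integrable_tilt_prob) auto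
      show "AE \<omega> in M. 0 \<le> indicator (?B n) (fut k \<omega>) * ?t \<omega> n"
        using AE_tilt_prob_bounds[of j k "{n}"] by eventually_elim (simp add: indicator_def)
    qed
    finally show "emeasure M {\<omega> \<in> space M. fut k \<omega> \<in> ?B n \<and> Y \<omega> = n} =
      (\<integral>\<^sup>+\<omega>. ennreal (indicator (?B n) (fut k \<omega>) * ?t \<omega> n) \<partial>M)" .
  qed
  also have "\<dots> = (\<integral>\<^sup>+\<omega>. (\<Sum>n. ennreal (indicator (?B n) (fut k \<omega>) * ?t \<omega> n)) \<partial>M)"
    by (rule nn_integral_suminf[symmetric]) measurable
  also have "\<dots> = (\<integral>\<^sup>+\<omega>. ennreal (?T \<omega>) \<partial>M)"
  proof (rule nn_integral_cong_AE)
    show "AE \<omega> in M. (\<Sum>n. ennreal (indicator (?B n) (fut k \<omega>) * ?t \<omega> n)) = ennreal (?T \<omega>)"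
      using AE_th_fut[of k]
    proof eventually_elim
      case (elim \<omega>)
      have "ennreal (?T \<omega>) = (\<Sum>n. ennreal (?t \<omega> n) * indicator {n. th (fut k \<omega>) * real n \<le> x} n)"
        by (rule ennreal_tilt_prob) (use elim in auto)
      also have "\<dots> = (\<Sum>n. ennreal (indicator (?B n) (fut k \<omega>) * ?t \<omega> n))"
        by (rule suminf_cong) (auto simp: indicator_def)
      finally show ?case by simp
    qed
  qed
  also have "\<dots> = ennreal (expectation ?T)"
  proof (rule nn_integral_eq_integral)
    have T: "AE \<omega> in M. 0 \<le> ?T \<omega> \<and> ?T \<omega> \<le> 1"
      using AE_th_fut[of k] by eventually_elim (simp add: tilt_prob_bounds)
    show "AE \<omega> in M. 0 \<le> ?T \<omega>" using T by eventually_elim simp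
    show "integrable M ?T"
    proof (rule integrable_const_bound[where B=1])
      show "AE \<omega> in M. norm (?T \<omega>) \<le> 1" using T by eventually_elim simp
      show "?T \<in> borel_measurable M"
        by (rule measurable_compose[OF _ borel_measurable_tilt_prob_scaled[of j x]]) measurable
    qed
  qed
  finally have "ennreal (prob {\<omega> \<in> space M. th (fut k \<omega>) * real (Y \<omega>) \<le> x}) = ennreal (expectation ?T)"
    by (simp add: emeasure_eq_measure)
  moreover have "0 \<le> expectation ?T"
    by (rule integral_nonneg_AE) (use AE_th_fut[of k] in eventually_elim, simp add: tilt_prob_bounds)
  ultimately show ?thesis by simp
qed

lemma conv_in_law_tilted:
  assumes Y: "\<And>k. tilted_law j k (Y k)"
    and int: "integrable (measure_pmf X) (\<lambda>n. real n ^ j)"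
    and P: "\<And>n. pmf P n = real n ^ j * pmf X n / measure_pmf.expectation X (\<lambda>n. real n ^ j)"
  shows "conv_in_law M (\<lambda>k \<omega>. real (Y k \<omega>)) (real_law P)"
  unfolding conv_in_law_def weak_conv_m_def weak_conv_def
proof (intro allI impI)
  fix x :: real
  have [measurable]: "Y k \<in> M \<rightarrow>\<^sub>M count_space UNIV" for k using Y by (simp add: tilted_law_def)
  \<comment> \<open>For natural-valued variables the distribution function is a finite sum of point
    probabilities at every x, so convergence of the latter is enough.\<close>
  let ?A = "{n. real n \<le> x}"
  have "?A \<subseteq> {..nat \<lfloor>x\<rfloor>}" by (auto simp: le_nat_floor)
  then have fin: "finite ?A" by (rule finite_subset) simp
  have cdfY: "cdf (distr M borel (\<lambda>\<omega>. real (Y k \<omega>))) x = (\<Sum>n\<in>?A. prob {\<omega> \<in> space M. Y k \<omega> = n})" for k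
  proof -
    have "cdf (distr M borel (\<lambda>\<omega>. real (Y k \<omega>))) x = prob ((\<lambda>\<omega>. real (Y k \<omega>)) -` {..x} \<inter> space M)"
      unfolding cdf_def by (rule measure_distr) auto
    also have "(\<lambda>\<omega>. real (Y k \<omega>)) -` {..x} \<inter> space M = (\<Union>n\<in>?A. {\<omega> \<in> space M. Y k \<omega> = n})" by auto
    also have "prob \<dots> = (\<Sum>n\<in>?A. prob {\<omega> \<in> space M. Y k \<omega> = n})"
      by (rule finite_measure_finite_Union[OF fin]) (auto simp: disjoint_family_on_def)
    finally show ?thesis .
  qed
  have cdfP: "cdf (real_law P) x = (\<Sum>n\<in>?A. pmf P n)"
  proof -
    have "cdf (real_law P) x = measure_pmf.prob P (real -` {..x} \<inter> space (measure_pmf P))"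
      unfolding cdf_def real_law_def by (rule measure_distr) auto
    also have "real -` {..x} \<inter> space (measure_pmf P) = ?A" by auto
    finally show ?thesis using fin by (simp add: measure_measure_pmf_finite)
  qed
  show "(\<lambda>k. cdf (distr M borel (\<lambda>\<omega>. real (Y k \<omega>))) x) \<longlonglongrightarrow> cdf (real_law P) x"
    unfolding cdfY cdfP tilted_law_prob[OF Y] P
    by (intro tendsto_sum expectation_th_fut_tendsto tilt_prob_tendsto[OF int]) (auto simp: tilt_prob_bounds)
qed

lemma conv_in_law_tilted_gamma:
  assumes "heavy_tail X \<alpha> c" and Y: "\<And>k. tilted_law j k (Y k)"
    and j: "1 \<le> j" "real j - 1 < \<alpha>" "\<alpha> < real j"
  shows "conv_in_law M (\<lambda>k \<omega>. th (fut k \<omega>) * real (Y k \<omega>)) (gamma_law (real j - \<alpha>) 1)"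
  unfolding conv_in_law_def weak_conv_m_def weak_conv_def
proof (intro allI impI)
  interpret heavy_tail X \<alpha> c by fact
  fix x :: real
  have [measurable]: "Y k \<in> M \<rightarrow>\<^sub>M count_space UNIV" for k using Y by (simp add: tilted_law_def)
  have cdfY: "cdf (distr M borel (\<lambda>\<omega>. th (fut k \<omega>) * real (Y k \<omega>))) x =
    expectation (\<lambda>\<omega>. tilt_prob X j (th (fut k \<omega>)) {n. th (fut k \<omega>) * real n \<le> x})" for k
  proof -
    have "cdf (distr M borel (\<lambda>\<omega>. th (fut k \<omega>) * real (Y k \<omega>))) x =
      prob ((\<lambda>\<omega>. th (fut k \<omega>) * real (Y k \<omega>)) -` {..x} \<inter> space M)"
      unfolding cdf_def by (rule measure_distr) auto
    also have "(\<lambda>\<omega>. th (fut k \<omega>) * real (Y k \<omega>)) -` {..x} \<inter> space M = {\<omega> \<in> space M. th (fut k \<omega>) * real (Y k \<omega>) \<le> x}"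
      by auto
    finally show ?thesis unfolding tilted_law_scaled_prob[OF Y] .
  qed
  have lim: "((\<lambda>q. tilt_prob X j q {n. q * real n \<le> x}) \<longlongrightarrow> cdf (gamma_law (real j - \<alpha>) 1) x) (at_right 0)"
  proof (cases "0 < x")
    case True
    then show ?thesis by (rule tilt_prob_tendsto_gamma[OF pmf_X_0 j])
  next
    case False
    have "(\<integral>s. indicator {..x} s * gam (real j - \<alpha>) s \<partial>lborel) = (\<integral>s. 0 \<partial>(lborel::real measure))"
      by (rule Bochner_Integration.integral_cong) (use False in \<open>auto simp: gam_def indicator_def\<close>)
    then have 0: "cdf (gamma_law (real j - \<alpha>) 1) x = 0" using j by (simp add: cdf_gamma_law)
    have "eventually (\<lambda>q::real. 0 < q \<and> q < 1) (at_right 0)"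
      by (auto simp: eventually_at_right[of 0 1] intro!: exI[of _ 1])
    then have "eventually (\<lambda>q. tilt_prob X j q {n. q * real n \<le> x} = 0) (at_right 0)"
    proof eventually_elim
      case (elim q)
      \<comment> \<open>For x <= 0 only the degree 0 could contribute, and it has no mass.\<close>
      have "{n. q * real n \<le> x} \<subseteq> {0}"
      proof
        fix n assume "n \<in> {n. q * real n \<le> x}"
        then have "q * real n \<le> 0" using False by simp
        then show "n \<in> {0}" using elim by (simp add: mult_le_0_iff)
      qed
      then have "tilt X j q {n. q * real n \<le> x} \<le> tilt X j q {0}" using elim by (intro tilt_mono) auto
      also have "\<dots> = 0" using pmf_X_0 by (simp add: tilt_single)
      finally have "tilt X j q {n. q * real n \<le> x} = 0" using tilt_nonneg[of q X j] elim by (auto intro: antisym)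
      then show ?case by (simp add: tilt_prob_def)
    qed
    then show ?thesis unfolding 0 by (rule tendsto_eventually)
  qed
  show "(\<lambda>k. cdf (distr M borel (\<lambda>\<omega>. th (fut k \<omega>) * real (Y k \<omega>))) x) \<longlonglongrightarrow> cdf (gamma_law (real j - \<alpha>) 1) x"
    unfolding cdfY
    by (rule expectation_th_fut_tendsto[OF borel_measurable_tilt_prob_scaled _ lim]) (simp add: tilt_prob_bounds)
qed

text \<open>The kernel is just some version of the conditional law of the degree. Uniqueness of
  conditional expectations identifies it with the tilted law for j = 1 at almost every value of the
  future maximum; only then can its size-biased version be computed.\<close>

lemma tilted_law_size_biased:
  assumes "cond_size_biased M (deg k) (fut k) Ds"
  shows "tilted_law 2 k Ds"
proof -
  let ?F = "vimage_algebra (space M) (fut k) borel"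
  obtain \<kappa> where D: "cond_law M (deg k) (fut k) \<kappa>" and S: "cond_law M Ds (fut k) (\<lambda>w. size_biased (\<kappa> w))"
    using assms unfolding cond_size_biased_def by blast
  have [measurable]: "Ds \<in> M \<rightarrow>\<^sub>M count_space UNIV" using S by (simp add: cond_law_def)
  have setsF: "sets ?F = {fut k -` B \<inter> space M |B. B \<in> sets borel}"
    by (rule sets_vimage_algebra2) auto
  have sub: "subalgebra M ?F"
    unfolding subalgebra_def using setsF by auto
  interpret finite_measure_subalgebra M ?F by unfold_locales (rule sub)
  have [measurable]: "fut k \<in> borel_measurable ?F" by (rule measurable_vimage_algebra1) simp
  have set_int: "(\<integral>\<omega>\<in>fut k -` B \<inter> space M. f \<omega> \<partial>M) = expectation (\<lambda>\<omega>. indicator B (fut k \<omega>) * f \<omega>)"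
    for B and f :: "'a \<Rightarrow> real"
    unfolding set_lebesgue_integral_def
    by (rule Bochner_Integration.integral_cong) (auto simp: indicator_def)
  have ind: "expectation (\<lambda>\<omega>. indicator B (fut k \<omega>) * indicat_real {\<omega>'. Y \<omega>' = n} \<omega>) =
      prob {\<omega> \<in> space M. fut k \<omega> \<in> B \<and> Y \<omega> = n}"
    if [measurable]: "B \<in> sets borel" "Y \<in> M \<rightarrow>\<^sub>M count_space UNIV" for B Y n
  proof -
    have "expectation (\<lambda>\<omega>. indicator B (fut k \<omega>) * indicat_real {\<omega>'. Y \<omega>' = n} \<omega>) =
      expectation (indicat_real {\<omega> \<in> space M. fut k \<omega> \<in> B \<and> Y \<omega> = n})"
      by (rule Bochner_Integration.integral_cong) (auto simp: indicator_def)
    also have "\<dots> = prob {\<omega> \<in> space M. fut k \<omega> \<in> B \<and> Y \<omega> = n}" by simp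
    finally show ?thesis .
  qed
  have int_ind: "integrable M (indicat_real {\<omega>'. Y \<omega>' = n})"
    if [measurable]: "Y \<in> M \<rightarrow>\<^sub>M count_space UNIV" for Y and n :: nat
  proof (rule integrable_const_bound[where B=1])
    have "(\<lambda>\<omega>. indicat_real {n} (Y \<omega>)) \<in> borel_measurable M"
      by (rule measurable_compose[OF that]) simp
    moreover have "indicat_real {\<omega>'. Y \<omega>' = n} = (\<lambda>\<omega>. indicat_real {n} (Y \<omega>))"
      by (auto simp: indicator_def)
    ultimately show "indicat_real {\<omega>'. Y \<omega>' = n} \<in> borel_measurable M" by simp
  qed auto
  have charact: "AE \<omega> in M. real_cond_exp M ?F (indicat_real {\<omega>'. deg k \<omega>' = n}) \<omega> = tilt_prob X 1 (th (fut k \<omega>)) {n}" for n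
  proof (rule real_cond_exp_charact)
    fix A assume "A \<in> sets ?F"
    then obtain B where B: "A = fut k -` B \<inter> space M" "B \<in> sets borel" unfolding setsF by blast
    show "(\<integral>\<omega>\<in>A. indicat_real {\<omega>'. deg k \<omega>' = n} \<omega> \<partial>M) = (\<integral>\<omega>\<in>A. tilt_prob X 1 (th (fut k \<omega>)) {n} \<partial>M)"
      unfolding B(1) set_int ind[OF B(2) measurable_deg]
      by (rule tilted_lawD[OF tilted_law_deg B(2)])
  next
    show "integrable M (indicat_real {\<omega>'. deg k \<omega>' = n})" by (rule int_ind) measurable
    show "integrable M (\<lambda>\<omega>. tilt_prob X 1 (th (fut k \<omega>)) {n})"
      using integrable_tilt_prob[of "\<lambda>_. 1" 1 k "{n}"] by simp
    show "(\<lambda>\<omega>. tilt_prob X 1 (th (fut k \<omega>)) {n}) \<in> borel_measurable ?F" by measurable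
  qed
  have "AE \<omega> in M. pmf (\<kappa> (fut k \<omega>)) n = tilt_prob X 1 (th (fut k \<omega>)) {n}" for n
  proof -
    have "AE \<omega> in M. real_cond_exp M ?F (indicat_real {\<omega>'. deg k \<omega>' = n}) \<omega> = pmf (\<kappa> (fut k \<omega>)) n"
      using D by (simp add: cond_law_def)
    with charact[of n] show ?thesis by eventually_elim simp
  qed
  \<comment> \<open>A single null set for all n is needed, because size biasing involves the whole
    law through its mean.\<close>
  then have "AE \<omega> in M. \<forall>n. pmf (\<kappa> (fut k \<omega>)) n = tilt_prob X 1 (th (fut k \<omega>)) {n}"
    unfolding AE_all_countable by blast
  then have sb: "AE \<omega> in M. pmf (size_biased (\<kappa> (fut k \<omega>))) n = tilt_prob X 2 (th (fut k \<omega>)) {n}" for n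
    using AE_th_fut[of k]
  proof eventually_elim
    case (elim \<omega>)
    then show ?case using pmf_size_biased_tilt_prob[OF offspring_axioms, of "th (fut k \<omega>)" "\<kappa> (fut k \<omega>)" n] by blast
  qed
  show ?thesis
    unfolding tilted_law_def
  proof (intro conjI allI ballI)
    fix n and B :: "real set" assume B [measurable]: "B \<in> sets borel"
    let ?f = "indicat_real {\<omega>'. Ds \<omega>' = n}"
    have AF: "fut k -` B \<inter> space M \<in> sets ?F" unfolding setsF using B by blast
    have "prob {\<omega> \<in> space M. fut k \<omega> \<in> B \<and> Ds \<omega> = n} = (\<integral>\<omega>\<in>fut k -` B \<inter> space M. ?f \<omega> \<partial>M)"
      unfolding set_int by (rule ind[symmetric]) measurable
    also have "\<dots> = (\<integral>\<omega>\<in>fut k -` B \<inter> space M. real_cond_exp M ?F ?f \<omega> \<partial>M)"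
      by (rule real_cond_exp_intA[OF int_ind AF]) measurable
    also have "\<dots> = expectation (\<lambda>\<omega>. indicator B (fut k \<omega>) * tilt_prob X 2 (th (fut k \<omega>)) {n})"
      unfolding set_int
    proof (rule integral_cong_AE)
      have "AE \<omega> in M. real_cond_exp M ?F ?f \<omega> = pmf (size_biased (\<kappa> (fut k \<omega>))) n"
        using S by (simp add: cond_law_def)
      with sb[of n] show "AE \<omega> in M. indicator B (fut k \<omega>) * real_cond_exp M ?F ?f \<omega> =
        indicator B (fut k \<omega>) * tilt_prob X 2 (th (fut k \<omega>)) {n}"
        by eventually_elim simp
    qed measurable
    finally show "prob {\<omega> \<in> space M. fut k \<omega> \<in> B \<and> Ds \<omega> = n} =
      expectation (\<lambda>\<omega>. indicator B (fut k \<omega>) * tilt_prob X 2 (th (fut k \<omega>)) {n})" .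
  qed measurable
qed

end

section \<open>Assembly of the three regimes of \<alpha>\<close>

lemma (in heavy_tail) prob_ge_2_pos_of_tail: "0 < measure_pmf.prob X {2..}"
proof -
  have "eventually (\<lambda>x. 0 < tail_prob x / (c * x powr (- \<alpha>))) at_top"
    using order_tendstoD(1)[OF tail, of 0] by (simp add: tail_prob_def)
  then have "eventually (\<lambda>x. 0 < tail_prob x \<and> 1 \<le> x) at_top"
    using eventually_ge_at_top[of 1]
  proof eventually_elim
    case (elim x)
    then show ?case using tail_prob_bounds(1)[of x] by (auto simp: order.order_iff_strict)
  qed
  then obtain x where x: "0 < tail_prob x" "1 \<le> x"
    using eventually_happens'[OF trivial_limit_at_top_linorder] by blast
  have "tail_prob x \<le> measure_pmf.prob X {2..}"
    unfolding tail_prob_def by (rule measure_pmf.finite_measure_mono) (use x(2) in auto)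
  then show ?thesis using x(1) by simp
qed

theorem theorem1p9:
  fixes M :: "'a measure"
    and X :: "nat pmf"
    and N :: "vertex \<Rightarrow> 'a \<Rightarrow> nat"
    and U :: "vertex \<Rightarrow> 'a \<Rightarrow> real"
    and \<alpha> c\<^sub>X :: real
  assumes tree: "weighted_bp_tree M X N U"
    and X_pos: "measure_pmf.prob X {0} = 0"
    and \<alpha>_pos: "\<alpha> > 0"
    and c_pos: "c\<^sub>X > 0"
    and tail: "((\<lambda>x::real. measure_pmf.prob X {n. real n > x} / (c\<^sub>X * x powr (- \<alpha>)))
                 \<longlongrightarrow> 1) at_top"
  shows
    "(\<alpha> > 2 \<longrightarrow>
        conv_in_law M (\<lambda>k \<omega>. real (backbone_degree N U k \<omega>)) (real_law (size_biased X)) \<and>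
        (\<forall>Ds. (\<forall>k. cond_size_biased M (backbone_degree N U k) (future_max N U k) (Ds k)) \<longrightarrow>
           conv_in_law M (\<lambda>k \<omega>. real (Ds k \<omega>)) (real_law (doubly_size_biased X))) \<and>
        integrable (measure_pmf (size_biased X)) real) \<and>
     (1 < \<alpha> \<and> \<alpha> < 2 \<longrightarrow>
        conv_in_law M (\<lambda>k \<omega>. real (backbone_degree N U k \<omega>)) (real_law (size_biased X)) \<and>
        (\<forall>Ds. (\<forall>k. cond_size_biased M (backbone_degree N U k) (future_max N U k) (Ds k)) \<longrightarrow>
           conv_in_law M (\<lambda>k \<omega>. theta_hat M N U (future_max N U k \<omega>) * real (Ds k \<omega>))
             (gamma_law (2 - \<alpha>) 1)) \<and>
        \<not> integrable (measure_pmf (size_biased X)) real) \<and>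
     (0 < \<alpha> \<and> \<alpha> < 1 \<longrightarrow>
        conv_in_law M
          (\<lambda>k \<omega>. theta_hat M N U (future_max N U k \<omega>) * real (backbone_degree N U k \<omega>))
          (gamma_law (1 - \<alpha>) 1))"
proof -
  interpret heavy_tail X \<alpha> c\<^sub>X
    by unfold_locales (fact \<alpha>_pos, fact c_pos, fact tail)
  have "prob_space M" using tree by (simp add: weighted_bp_tree_def)
  then interpret bp_model X M N U
  proof (intro bp_model.intro bp_model_axioms.intro offspring.intro)
    show "pmf X 0 = 0" using X_pos by (simp add: measure_pmf_single)
  qed (use prob_ge_2_pos_of_tail tree in auto)
  have heavy: "heavy_tail X \<alpha> c\<^sub>X" by (rule heavy_tail_axioms)
  have first: "conv_in_law M (\<lambda>k \<omega>. real (deg k \<omega>)) (real_law (size_biased X))"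
    if "1 < \<alpha>"
  proof (rule conv_in_law_tilted[where j=1])
    show int: "integrable (measure_pmf X) (\<lambda>n. real n ^ 1)"
      by (rule integrable_power_of_tail) (use that in auto)
    show "pmf (size_biased X) n = real n ^ 1 * pmf X n / measure_pmf.expectation X (\<lambda>n. real n ^ 1)" for n
      using pmf_size_biased[of X n] expectation_power_pos[OF int] int by simp
  qed (rule tilted_law_deg)
  have int1: "integrable (measure_pmf X) real" if "1 < \<alpha>"
    using integrable_power_of_tail[of 1] that by simp
  show ?thesis
  proof (intro conjI impI allI)
    assume \<alpha>: "2 < \<alpha>"
    have int2: "integrable (measure_pmf X) (\<lambda>n. real n ^ 2)"
      by (rule integrable_power_of_tail) (use \<alpha> in auto)
    show "conv_in_law M (\<lambda>k \<omega>. real (deg k \<omega>)) (real_law (size_biased X))" using first \<alpha> by simp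
    show "integrable (measure_pmf (size_biased X)) real"
      using integrable_size_biased_iff int1 int2 \<alpha> by simp
    fix Ds assume "\<forall>k. cond_size_biased M (deg k) (fut k) (Ds k)"
    then have "tilted_law 2 k (Ds k)" for k by (simp add: tilted_law_size_biased)
    then show "conv_in_law M (\<lambda>k \<omega>. real (Ds k \<omega>)) (real_law (doubly_size_biased X))"
      by (rule conv_in_law_tilted[OF _ int2])
         (rule pmf_doubly_size_biased[OF int2 expectation_power_pos[OF int2]])
  next
    assume \<alpha>: "1 < \<alpha> \<and> \<alpha> < 2"
    show "conv_in_law M (\<lambda>k \<omega>. real (deg k \<omega>)) (real_law (size_biased X))" using first \<alpha> by simp
    show "\<not> integrable (measure_pmf (size_biased X)) real"
      using integrable_size_biased_iff int1 not_integrable_power_of_tail[of 2] \<alpha> by simp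
    fix Ds assume "\<forall>k. cond_size_biased M (deg k) (fut k) (Ds k)"
    then have "tilted_law 2 k (Ds k)" for k by (simp add: tilted_law_size_biased)
    from conv_in_law_tilted_gamma[OF heavy this]
    show "conv_in_law M (\<lambda>k \<omega>. th (fut k \<omega>) * real (Ds k \<omega>)) (gamma_law (2 - \<alpha>) 1)"
      using \<alpha> by simp
  next
    assume \<alpha>: "0 < \<alpha> \<and> \<alpha> < 1"
    from conv_in_law_tilted_gamma[OF heavy tilted_law_deg]
    show "conv_in_law M (\<lambda>k \<omega>. th (fut k \<omega>) * real (deg k \<omega>)) (gamma_law (1 - \<alpha>) 1)"
      using \<alpha> by simp
  qed
qed

end
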